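(* Let $R$ be a (commutative) Noetherian local ring, $I$ an ideal of $R$, and $S=R/I$. Let $F$ be a free direct summand of the conormal module $I/I^2$ as an $S$-module. Then the natural map of graded $S$-algebras $\bigwedge_S F\to \operatorname{Tor}^R_*(S,S)$ splits as a map of algebras; that is, there is a homomorphism of graded $S$-algebras $\operatorname{Tor}^R_*(S,S)\to\bigwedge_S F$ whose composition with the natural map, $\bigwedge_S F\to\operatorname{Tor}^R_*(S,S)\to\bigwedge_S F$, is the identity.
   Context: $\operatorname{Tor}^R_*(S,S)=\bigoplus_{i\ge 0}\operatorname{Tor}^R_i(S,S)$ carries its usual structure of a (strictly) graded-commutative $S$-algebra, e.g. computed as the homology of $P\otimes_R S$, where $P\to S$ is a resolution of $S$ by a graded-commutative differential graded $R$-algebra that is free as a graded $R$-module. There is a canonical isomorphism $\operatorname{Tor}^R_1(S,S)\cong I/I^2$ (if $x\in P_1$ has $\partial(x)=a\in I$, then the class of $x\otimes 1$ corresponds to the class of $a$ in $I/I^2$). The natural map $\bigwedge_S F\to\operatorname{Tor}^R_*(S,S)$ is the unique homomorphism of graded $S$-algebras which in degree $1$ is the inclusion $F\hookrightarrow I/I^2\cong\operatorname{Tor}^R_1(S,S)$. The projective dimension of $I$ is not assumed finite. *)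

theory Defs
  imports "HOL-Algebra.Module" "HOL-Algebra.Ideal_Product" "HOL-Algebra.Ring_Divisibility"
begin

section \<open>Local rings, free modules, conormal module\<close>

definition local_ring :: "('a, 'm) ring_scheme \<Rightarrow> bool"
  where "local_ring R \<longleftrightarrow> cring R \<and> (\<exists>!M. maximalideal M R)"

definition fin_supp :: "('a, 'm) ring_scheme \<Rightarrow> 'g set \<Rightarrow> ('g \<Rightarrow> 'a) set"
  where "fin_supp R Y = {f. (\<forall>x\<in>Y. f x \<in> carrier R) \<and> (\<forall>x. x \<notin> Y \<longrightarrow> f x = \<zero>\<^bsub>R\<^esub>)
                          \<and> finite {x. f x \<noteq> \<zero>\<^bsub>R\<^esub>}}"

definition is_basis :: "('a, 'm) ring_scheme \<Rightarrow> ('a, 'b, 'n) module_scheme \<Rightarrow> 'b set \<Rightarrow> bool"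
  where "is_basis R M B \<longleftrightarrow> B \<subseteq> carrier M \<and>
    (\<forall>x\<in>carrier M. \<exists>!c. c \<in> fin_supp R B \<and>
        (\<Oplus>\<^bsub>M\<^esub>b\<in>{b. c b \<noteq> \<zero>\<^bsub>R\<^esub>}. c b \<odot>\<^bsub>M\<^esub> b) = x)"

definition free_module :: "('a, 'm) ring_scheme \<Rightarrow> ('a, 'b, 'n) module_scheme \<Rightarrow> bool"
  where "free_module R M \<longleftrightarrow> module R M \<and> (\<exists>B. is_basis R M B)"

definition free_direct_summand ::
    "('a, 'm) ring_scheme \<Rightarrow> ('a, 'b, 'n) module_scheme \<Rightarrow> 'b set \<Rightarrow> bool"
  where "free_direct_summand R M F \<longleftrightarrow>
    submodule F R M \<and> free_module R (M\<lparr>carrier := F\<rparr>) \<and>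
    (\<exists>G. submodule G R M \<and> F \<inter> G = {\<zero>\<^bsub>M\<^esub>} \<and> F <+>\<^bsub>M\<^esub> G = carrier M)"

text \<open>The module \<open>I/I\<^sup>2\<close> over \<open>R/I\<close>.  The fields \<open>mult\<close> and \<open>one\<close> of a module record play no role
  in \<^locale>\<open>module\<close>.\<close>

definition conormal_module :: "('a, 'm) ring_scheme \<Rightarrow> 'a set \<Rightarrow> ('a set, 'a set) module"
  where "conormal_module R I =
    \<lparr>carrier = (\<lambda>a. (I \<cdot>\<^bsub>R\<^esub> I) +>\<^bsub>R\<^esub> a) ` I, monoid.mult = undefined, monoid.one = undefined,
     ring.zero = I \<cdot>\<^bsub>R\<^esub> I, ring.add = set_add R, module.smult = rcoset_mult R (I \<cdot>\<^bsub>R\<^esub> I)\<rparr>"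


section \<open>Graded associative algebras\<close>

text \<open>The locale \<^locale>\<open>algebra\<close> of the library requires commutativity.\<close>

locale assoc_algebra = module R A + ring A for R (structure) and A (structure) +
  assumes smult_mult_left:
      "\<lbrakk>r \<in> carrier R; x \<in> carrier A; y \<in> carrier A\<rbrakk>
        \<Longrightarrow> (r \<odot>\<^bsub>A\<^esub> x) \<otimes>\<^bsub>A\<^esub> y = r \<odot>\<^bsub>A\<^esub> (x \<otimes>\<^bsub>A\<^esub> y)"
    and smult_mult_right:
      "\<lbrakk>r \<in> carrier R; x \<in> carrier A; y \<in> carrier A\<rbrakk>
        \<Longrightarrow> x \<otimes>\<^bsub>A\<^esub> (r \<odot>\<^bsub>A\<^esub> y) = r \<odot>\<^bsub>A\<^esub> (x \<otimes>\<^bsub>A\<^esub> y)"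

locale graded_algebra = assoc_algebra R A
  for R :: "('a, 'm) ring_scheme" (structure)
    and A :: "('a, 'b, 'n) module_scheme" (structure) +
  fixes gr :: "nat \<Rightarrow> 'b set"
  assumes gr_submodule: "submodule (gr i) R A"
    and gr_one: "\<one>\<^bsub>A\<^esub> \<in> gr 0"
    and gr_mult: "\<lbrakk>x \<in> gr i; y \<in> gr j\<rbrakk> \<Longrightarrow> x \<otimes>\<^bsub>A\<^esub> y \<in> gr (i + j)"
    and gr_direct_sum: "x \<in> carrier A \<Longrightarrow>
      \<exists>!c. (\<forall>i. c i \<in> gr i) \<and> finite {i. c i \<noteq> \<zero>\<^bsub>A\<^esub>} \<and> (\<Oplus>\<^bsub>A\<^esub>i\<in>{i. c i \<noteq> \<zero>\<^bsub>A\<^esub>}. c i) = x"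

definition graded_algebra_hom ::
    "('a, 'm) ring_scheme \<Rightarrow> ('a, 'b, 'n) module_scheme \<Rightarrow> (nat \<Rightarrow> 'b set)
      \<Rightarrow> ('a, 'c, 'k) module_scheme \<Rightarrow> (nat \<Rightarrow> 'c set) \<Rightarrow> ('b \<Rightarrow> 'c) set"
  where "graded_algebra_hom R A grA B grB =
    {h. h \<in> ring_hom A B \<and>
        (\<forall>r\<in>carrier R. \<forall>x\<in>carrier A. h (r \<odot>\<^bsub>A\<^esub> x) = r \<odot>\<^bsub>B\<^esub> h x) \<and>
        (\<forall>i. \<forall>x\<in>grA i. h x \<in> grB i)}"


section \<open>Differential graded algebra resolutions\<close>

definition koszul_sign :: "('b, 'n) ring_scheme \<Rightarrow> nat \<Rightarrow> 'b \<Rightarrow> 'b"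
  where "koszul_sign A n x = (if even n then x else \<ominus>\<^bsub>A\<^esub> x)"

locale dg_algebra = graded_algebra R P gr
  for R :: "('a, 'm) ring_scheme" (structure)
    and P :: "('a, 'b, 'n) module_scheme" (structure)
    and gr :: "nat \<Rightarrow> 'b set" +
  fixes d :: "'b \<Rightarrow> 'b"
  assumes d_closed: "x \<in> carrier P \<Longrightarrow> d x \<in> carrier P"
    and d_add: "\<lbrakk>x \<in> carrier P; y \<in> carrier P\<rbrakk> \<Longrightarrow> d (x \<oplus>\<^bsub>P\<^esub> y) = d x \<oplus>\<^bsub>P\<^esub> d y"
    and d_smult: "\<lbrakk>r \<in> carrier R; x \<in> carrier P\<rbrakk> \<Longrightarrow> d (r \<odot>\<^bsub>P\<^esub> x) = r \<odot>\<^bsub>P\<^esub> d x"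
    and d_degree_0: "x \<in> gr 0 \<Longrightarrow> d x = \<zero>\<^bsub>P\<^esub>"
    and d_degree_Suc: "x \<in> gr (Suc i) \<Longrightarrow> d x \<in> gr i"
    and d_d: "x \<in> carrier P \<Longrightarrow> d (d x) = \<zero>\<^bsub>P\<^esub>"
    and leibniz: "\<lbrakk>x \<in> gr i; y \<in> carrier P\<rbrakk>
      \<Longrightarrow> d (x \<otimes>\<^bsub>P\<^esub> y) = d x \<otimes>\<^bsub>P\<^esub> y \<oplus>\<^bsub>P\<^esub> koszul_sign P i (x \<otimes>\<^bsub>P\<^esub> d y)"

locale comm_dg_algebra = dg_algebra +
  assumes graded_comm: "\<lbrakk>x \<in> gr i; y \<in> gr j\<rbrakk>
      \<Longrightarrow> x \<otimes>\<^bsub>P\<^esub> y = koszul_sign P (i * j) (y \<otimes>\<^bsub>P\<^esub> x)"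
    and odd_square_zero: "\<lbrakk>x \<in> gr i; odd i\<rbrakk> \<Longrightarrow> x \<otimes>\<^bsub>P\<^esub> x = \<zero>\<^bsub>P\<^esub>"

text \<open>\<open>aug : P \<rightarrow> R/I\<close> is a quasi-isomorphism of differential graded algebras, \<open>R/I\<close> being
  concentrated in degree \<open>0\<close>.  The degree \<open>0\<close> part of \<open>P\<close> may be larger than \<open>R\<close>.\<close>

locale free_comm_dg_resolution = comm_dg_algebra R P gr d + ideal I R
  for R :: "('a, 'm) ring_scheme" (structure)
    and I :: "'a set"
    and P :: "('a, 'b, 'n) module_scheme" (structure)
    and gr :: "nat \<Rightarrow> 'b set"
    and d :: "'b \<Rightarrow> 'b" +
  fixes aug :: "'b \<Rightarrow> 'a set"
  assumes gr_free: "free_module R (P\<lparr>carrier := gr i\<rparr>)"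
    and aug_hom: "aug \<in> ring_hom P (R Quot I)"
    and aug_smult_one: "r \<in> carrier R \<Longrightarrow> aug (r \<odot>\<^bsub>P\<^esub> \<one>\<^bsub>P\<^esub>) = I +>\<^bsub>R\<^esub> r"
    and aug_degree_Suc: "x \<in> gr (Suc i) \<Longrightarrow> aug x = \<zero>\<^bsub>R Quot I\<^esub>"
    and aug_surj: "aug ` gr 0 = carrier (R Quot I)"
    and exact_0: "{x \<in> gr 0. aug x = \<zero>\<^bsub>R Quot I\<^esub>} = d ` gr 1"
    and exact_Suc: "{x \<in> gr (Suc i). d x = \<zero>\<^bsub>P\<^esub>} = d ` gr (Suc (Suc i))"


section \<open>Monoid algebras and quotient algebras\<close>

definition with_smult :: "('b, 'n) ring_scheme \<Rightarrow> ('a \<Rightarrow> 'b \<Rightarrow> 'b) \<Rightarrow> ('a, 'b) module"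
  where "with_smult A s =
    \<lparr>carrier = carrier A, monoid.mult = (\<otimes>\<^bsub>A\<^esub>), monoid.one = \<one>\<^bsub>A\<^esub>, ring.zero = \<zero>\<^bsub>A\<^esub>,
     ring.add = (\<oplus>\<^bsub>A\<^esub>), module.smult = s\<rparr>"

text \<open>\<open>quot_algebra A J\<close> is meaningful for a two-sided ideal \<open>J\<close> that is also a submodule.\<close>

definition quot_algebra :: "('a, 'b, 'n) module_scheme \<Rightarrow> 'b set \<Rightarrow> ('a, 'b set) module"
  where "quot_algebra A J = with_smult (A Quot J) (\<lambda>r Y. \<Union>x\<in>Y. J +>\<^bsub>A\<^esub> (r \<odot>\<^bsub>A\<^esub> x))"

definition single :: "('a, 'm) ring_scheme \<Rightarrow> 'g \<Rightarrow> 'a \<Rightarrow> 'g \<Rightarrow> 'a"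
  where "single R g a = (\<lambda>x. if x = g then a else \<zero>\<^bsub>R\<^esub>)"

definition monoid_algebra ::
    "('a, 'm) ring_scheme \<Rightarrow> ('g, 'k) monoid_scheme \<Rightarrow> ('a, 'g \<Rightarrow> 'a) module"
  where "monoid_algebra R G =
    \<lparr>carrier = fin_supp R (carrier G),
     monoid.mult = (\<lambda>f g x. \<Oplus>\<^bsub>R\<^esub>p\<in>{p. f (fst p) \<noteq> \<zero>\<^bsub>R\<^esub> \<and> g (snd p) \<noteq> \<zero>\<^bsub>R\<^esub> \<and> fst p \<otimes>\<^bsub>G\<^esub> snd p = x}.
                        f (fst p) \<otimes>\<^bsub>R\<^esub> g (snd p)),
     monoid.one = single R \<one>\<^bsub>G\<^esub> \<one>\<^bsub>R\<^esub>,
     ring.zero = (\<lambda>x. \<zero>\<^bsub>R\<^esub>),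
     ring.add = (\<lambda>f g x. f x \<oplus>\<^bsub>R\<^esub> g x),
     module.smult = (\<lambda>a f x. a \<otimes>\<^bsub>R\<^esub> f x)\<rparr>"


section \<open>Exterior algebra\<close>

text \<open>The exterior algebra of \<open>M\<close> is the tensor algebra of \<open>M\<close> modulo all squares \<open>x \<otimes> x\<close>.  Here the
  tensor algebra is itself presented as the free associative algebra on the elements of \<open>M\<close>
  (the monoid algebra of words) modulo the linear relations of \<open>M\<close>.\<close>

definition word_algebra ::
    "('a, 'm) ring_scheme \<Rightarrow> ('a, 'b, 'n) module_scheme \<Rightarrow> ('a, 'b list \<Rightarrow> 'a) module"
  where "word_algebra S M =
    monoid_algebra S \<lparr>carrier = lists (carrier M), monoid.mult = (@), monoid.one = []\<rparr>"

definition exterior_ideal ::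
    "('a, 'm) ring_scheme \<Rightarrow> ('a, 'b, 'n) module_scheme \<Rightarrow> ('b list \<Rightarrow> 'a) set"
  where "exterior_ideal S M =
    (let W = word_algebra S M; e = (\<lambda>w. single S w \<one>\<^bsub>S\<^esub>) in
     genideal W
       ({e [x \<oplus>\<^bsub>M\<^esub> y] \<ominus>\<^bsub>W\<^esub> (e [x] \<oplus>\<^bsub>W\<^esub> e [y]) | x y. x \<in> carrier M \<and> y \<in> carrier M} \<union>
        {e [s \<odot>\<^bsub>M\<^esub> x] \<ominus>\<^bsub>W\<^esub> (s \<odot>\<^bsub>W\<^esub> e [x]) | s x. s \<in> carrier S \<and> x \<in> carrier M} \<union>
        {e [x, x] | x. x \<in> carrier M}))"

definition exterior_algebra ::
    "('a, 'm) ring_scheme \<Rightarrow> ('a, 'b, 'n) module_scheme \<Rightarrow> ('a, ('b list \<Rightarrow> 'a) set) module"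
  where "exterior_algebra S M = quot_algebra (word_algebra S M) (exterior_ideal S M)"

definition exterior_gr ::
    "('a, 'm) ring_scheme \<Rightarrow> ('a, 'b, 'n) module_scheme \<Rightarrow> nat \<Rightarrow> ('b list \<Rightarrow> 'a) set set"
  where "exterior_gr S M n =
    {exterior_ideal S M +>\<^bsub>word_algebra S M\<^esub> f | f.
       f \<in> carrier (word_algebra S M) \<and> (\<forall>w. f w \<noteq> \<zero>\<^bsub>S\<^esub> \<longrightarrow> length w = n)}"

definition exterior_incl ::
    "('a, 'm) ring_scheme \<Rightarrow> ('a, 'b, 'n) module_scheme \<Rightarrow> 'b \<Rightarrow> ('b list \<Rightarrow> 'a) set"
  where "exterior_incl S M x = exterior_ideal S M +>\<^bsub>word_algebra S M\<^esub> single S [x] \<one>\<^bsub>S\<^esub>"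


section \<open>Tensor products of algebras\<close>

text \<open>\<open>A \<otimes>\<^sub>R B\<close> is the free \<open>R\<close>-module on \<open>A \<times> B\<close> modulo the bilinearity relations, with product
  \<open>(a \<otimes> b) (a' \<otimes> b') = a a' \<otimes> b b'\<close>; so it is a quotient of the monoid algebra of \<open>A \<times> B\<close>.  (The
  submodule generated by the bilinearity relations is already an ideal.)  There are no Koszul signs
  in the product, nor in the differential \<open>d \<otimes> 1\<close> below: \<open>B\<close> is only ever an algebra in degree
  \<open>0\<close>.\<close>

definition pair_algebra ::
    "('a, 'm) ring_scheme \<Rightarrow> ('a, 'b, 'n) module_scheme \<Rightarrow> ('a, 'c, 'k) module_scheme
      \<Rightarrow> ('a, 'b \<times> 'c \<Rightarrow> 'a) module"
  where "pair_algebra R A B = monoid_algebra R (A \<times>\<times> B)"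

definition tensor_ideal ::
    "('a, 'm) ring_scheme \<Rightarrow> ('a, 'b, 'n) module_scheme \<Rightarrow> ('a, 'c, 'k) module_scheme
      \<Rightarrow> ('b \<times> 'c \<Rightarrow> 'a) set"
  where "tensor_ideal R A B =
    (let K = pair_algebra R A B; e = (\<lambda>a b. single R (a, b) \<one>\<^bsub>R\<^esub>) in
     genideal K
       ({e (a \<oplus>\<^bsub>A\<^esub> a') b \<ominus>\<^bsub>K\<^esub> (e a b \<oplus>\<^bsub>K\<^esub> e a' b) | a a' b.
           a \<in> carrier A \<and> a' \<in> carrier A \<and> b \<in> carrier B} \<union>
        {e a (b \<oplus>\<^bsub>B\<^esub> b') \<ominus>\<^bsub>K\<^esub> (e a b \<oplus>\<^bsub>K\<^esub> e a b') | a b b'.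
           a \<in> carrier A \<and> b \<in> carrier B \<and> b' \<in> carrier B} \<union>
        {e (r \<odot>\<^bsub>A\<^esub> a) b \<ominus>\<^bsub>K\<^esub> (r \<odot>\<^bsub>K\<^esub> e a b) | r a b.
           r \<in> carrier R \<and> a \<in> carrier A \<and> b \<in> carrier B} \<union>
        {e a (r \<odot>\<^bsub>B\<^esub> b) \<ominus>\<^bsub>K\<^esub> (r \<odot>\<^bsub>K\<^esub> e a b) | r a b.
           r \<in> carrier R \<and> a \<in> carrier A \<and> b \<in> carrier B}))"

definition tensor_algebra ::
    "('a, 'm) ring_scheme \<Rightarrow> ('a, 'b, 'n) module_scheme \<Rightarrow> ('a, 'c, 'k) module_scheme
      \<Rightarrow> ('a, ('b \<times> 'c \<Rightarrow> 'a) set) module"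
  where "tensor_algebra R A B = quot_algebra (pair_algebra R A B) (tensor_ideal R A B)"

definition pure_tensor ::
    "('a, 'm) ring_scheme \<Rightarrow> ('a, 'b, 'n) module_scheme \<Rightarrow> ('a, 'c, 'k) module_scheme
      \<Rightarrow> 'b \<Rightarrow> 'c \<Rightarrow> ('b \<times> 'c \<Rightarrow> 'a) set"
  where "pure_tensor R A B a b =
    tensor_ideal R A B +>\<^bsub>pair_algebra R A B\<^esub> single R (a, b) \<one>\<^bsub>R\<^esub>"

text \<open>The ring \<open>A \<otimes>\<^sub>R B\<close> as an algebra over \<open>B\<close> by way of \<open>b \<mapsto> 1 \<otimes> b\<close>.\<close>

definition base_change ::
    "('a, 'm) ring_scheme \<Rightarrow> ('a, 'b, 'n) module_scheme \<Rightarrow> ('a, 'c, 'k) module_scheme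
      \<Rightarrow> ('c, ('b \<times> 'c \<Rightarrow> 'a) set) module"
  where "base_change R A B = with_smult (tensor_algebra R A B)
    (\<lambda>b Y. pure_tensor R A B \<one>\<^bsub>A\<^esub> b \<otimes>\<^bsub>tensor_algebra R A B\<^esub> Y)"

text \<open>The grading of \<open>A \<otimes>\<^sub>R B\<close> by the images of \<open>gr i \<otimes>\<^sub>R B\<close>, and the differential \<open>d \<otimes> 1\<close>.\<close>

definition base_change_gr ::
    "('a, 'm) ring_scheme \<Rightarrow> ('a, 'b, 'n) module_scheme \<Rightarrow> ('a, 'c, 'k) module_scheme
      \<Rightarrow> (nat \<Rightarrow> 'b set) \<Rightarrow> nat \<Rightarrow> ('b \<times> 'c \<Rightarrow> 'a) set set"
  where "base_change_gr R A B gr i =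
    {tensor_ideal R A B +>\<^bsub>pair_algebra R A B\<^esub> f | f.
       f \<in> carrier (pair_algebra R A B) \<and> (\<forall>a b. f (a, b) \<noteq> \<zero>\<^bsub>R\<^esub> \<longrightarrow> a \<in> gr i)}"

definition base_change_diff ::
    "('a, 'm) ring_scheme \<Rightarrow> ('a, 'b, 'n) module_scheme \<Rightarrow> ('a, 'c, 'k) module_scheme
      \<Rightarrow> ('b \<Rightarrow> 'b) \<Rightarrow> ('b \<times> 'c \<Rightarrow> 'a) set \<Rightarrow> ('b \<times> 'c \<Rightarrow> 'a) set"
  where "base_change_diff R A B d Y =
    (\<Union>f\<in>Y. tensor_ideal R A B +>\<^bsub>pair_algebra R A B\<^esub>
       (\<Oplus>\<^bsub>pair_algebra R A B\<^esub>p\<in>{p. f p \<noteq> \<zero>\<^bsub>R\<^esub>}. single R (d (fst p), snd p) (f p)))"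


section \<open>Homology and the Tor algebra\<close>

definition cycles :: "('b, 'n) ring_scheme \<Rightarrow> ('b \<Rightarrow> 'b) \<Rightarrow> 'b set"
  where "cycles T D = {x \<in> carrier T. D x = \<zero>\<^bsub>T\<^esub>}"

definition homology_algebra :: "('a, 'b) module \<Rightarrow> ('b \<Rightarrow> 'b) \<Rightarrow> ('a, 'b set) module"
  where "homology_algebra T D = quot_algebra (T\<lparr>carrier := cycles T D\<rparr>) (D ` carrier T)"

definition homology_class :: "('b, 'n) ring_scheme \<Rightarrow> ('b \<Rightarrow> 'b) \<Rightarrow> 'b \<Rightarrow> 'b set"
  where "homology_class T D z = D ` carrier T +>\<^bsub>T\<^esub> z"

text \<open>The \<open>R\<close>-algebra \<open>R/I\<close>.\<close>

definition residue_algebra :: "('a, 'm) ring_scheme \<Rightarrow> 'a set \<Rightarrow> ('a, 'a set) module"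
  where "residue_algebra R I =
    with_smult (R Quot I) (\<lambda>r Y. (I +>\<^bsub>R\<^esub> r) \<otimes>\<^bsub>R Quot I\<^esub> Y)"

text \<open>\<open>Tor\<^sup>R(R/I, R/I)\<close>, computed from the resolution \<open>(P, d)\<close> of \<open>R/I\<close>, as an algebra over
  \<open>R/I\<close>.\<close>

definition tor_algebra ::
    "('a, 'm) ring_scheme \<Rightarrow> 'a set \<Rightarrow> ('a, 'b, 'n) module_scheme \<Rightarrow> ('b \<Rightarrow> 'b)
      \<Rightarrow> ('a set, ('b \<times> 'a set \<Rightarrow> 'a) set set) module"
  where "tor_algebra R I P d =
    homology_algebra (base_change R P (residue_algebra R I))
                     (base_change_diff R P (residue_algebra R I) d)"

definition tor_class ::
    "('a, 'm) ring_scheme \<Rightarrow> 'a set \<Rightarrow> ('a, 'b, 'n) module_scheme \<Rightarrow> ('b \<Rightarrow> 'b)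
      \<Rightarrow> ('b \<times> 'a set \<Rightarrow> 'a) set \<Rightarrow> ('b \<times> 'a set \<Rightarrow> 'a) set set"
  where "tor_class R I P d =
    homology_class (base_change R P (residue_algebra R I))
                   (base_change_diff R P (residue_algebra R I) d)"

definition tor_gr ::
    "('a, 'm) ring_scheme \<Rightarrow> 'a set \<Rightarrow> ('a, 'b, 'n) module_scheme \<Rightarrow> (nat \<Rightarrow> 'b set)
      \<Rightarrow> ('b \<Rightarrow> 'b) \<Rightarrow> nat \<Rightarrow> ('b \<times> 'a set \<Rightarrow> 'a) set set set"
  where "tor_gr R I P gr d i =
    tor_class R I P d `
      (cycles (base_change R P (residue_algebra R I))
              (base_change_diff R P (residue_algebra R I) d)
        \<inter> base_change_gr R P (residue_algebra R I) gr i)"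

text \<open>The canonical isomorphism \<open>I/I\<^sup>2 \<rightarrow> Tor\<^sub>1\<close>: the class of \<open>a \<in> I\<close> corresponds to the class of
  \<open>x \<otimes> 1\<close> whenever \<open>x\<close> has degree \<open>1\<close> and \<open>d x = a\<close> (that is, \<open>a \<cdot> 1\<close> in \<open>P\<close>).\<close>

definition conormal_to_tor ::
    "('a, 'm) ring_scheme \<Rightarrow> 'a set \<Rightarrow> ('a, 'b, 'n) module_scheme \<Rightarrow> (nat \<Rightarrow> 'b set)
      \<Rightarrow> ('b \<Rightarrow> 'b) \<Rightarrow> 'a set \<Rightarrow> ('b \<times> 'a set \<Rightarrow> 'a) set set"
  where "conormal_to_tor R I P gr d c =
    (THE t. \<exists>a\<in>I. \<exists>x\<in>gr 1. c = (I \<cdot>\<^bsub>R\<^esub> I) +>\<^bsub>R\<^esub> a \<and> d x = a \<odot>\<^bsub>P\<^esub> \<one>\<^bsub>P\<^esub> \<and>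
        t = tor_class R I P d
              (pure_tensor R P (residue_algebra R I) x \<one>\<^bsub>residue_algebra R I\<^esub>))"

text \<open>The defining property of the natural map from the exterior algebra of \<open>F \<subseteq> I/I\<^sup>2\<close> to Tor;
  \<^const>\<open>extensional\<close> makes it literally unique.\<close>

definition is_natural_map ::
    "('a, 'm) ring_scheme \<Rightarrow> 'a set \<Rightarrow> 'a set set \<Rightarrow> ('a, 'b, 'n) module_scheme
      \<Rightarrow> (nat \<Rightarrow> 'b set) \<Rightarrow> ('b \<Rightarrow> 'b)
      \<Rightarrow> (('a set list \<Rightarrow> 'a set) set \<Rightarrow> ('b \<times> 'a set \<Rightarrow> 'a) set set) \<Rightarrow> bool"
  where "is_natural_map R I F P gr d h \<longleftrightarrow>
    (let S = R Quot I; M = (conormal_module R I)\<lparr>carrier := F\<rparr> in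
     h \<in> extensional (carrier (exterior_algebra S M)) \<and>
     h \<in> graded_algebra_hom S (exterior_algebra S M) (exterior_gr S M)
                              (tor_algebra R I P d) (tor_gr R I P gr d) \<and>
     (\<forall>c\<in>F. h (exterior_incl S M c) = conormal_to_tor R I P gr d c))"

end

theory Submission
  imports Defs
begin

text \<open>Every linear map \<open>\<phi> : I/I\<^sup>2 \<rightarrow> S\<close> gives a Bockstein derivation \<open>\<theta>\<close> of degree \<open>-1\<close> on Tor:
  as \<open>P\<close> is free, \<open>a p \<mapsto> \<phi> a p\<close> is a well-defined map \<open>IP \<rightarrow> P/IP\<close>, and \<open>\<theta>\<close> sends the class of a
  cycle \<open>z\<close> of \<open>P/IP\<close> to the class of the image of \<open>d z \<in> IP\<close>.  It is a derivation because \<open>d\<close> is, and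
  on \<open>Tor\<^sub>1 = I/I\<^sup>2\<close> it is \<open>\<phi>\<close>.  If \<open>g : Tor \<rightarrow> \<Lambda> F\<close> is a homomorphism of graded algebras and \<open>e \<in> F\<close>, then
  so is \<open>u \<mapsto> g u + e g (\<theta> u)\<close>.  Starting from the augmentation and running through a basis of \<open>F\<close> with
  its coordinate functionals, extended to \<open>I/I\<^sup>2\<close> by zero on a complement, one obtains a homomorphism
  that is the identity on \<open>F\<close>, hence a splitting.  The \<open>\<theta>\<close> need not anticommute.  Only
  finitely many basis elements matter since \<open>I\<close> is finitely generated.\<close>


section \<open>Images of modules and algebras\<close>

text \<open>\<open>\<theta>\<close> is the connecting homomorphism on Tor of
  \<open>0 -> I/I^2 -> R/I^2 -> R/I -> 0\<close>, followed by the map that \<open>\<phi>\<close>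
  induces on coefficients. Here it is built on elements. The tensor product
  \<open>P \<otimes> R/I\<close> is \<open>P/IP\<close>, so a class of Tor is represented by some
  \<open>z\<close> in \<open>P\<close> with \<open>d z \<in> IP\<close>, and it vanishes when
  \<open>z\<close> is a boundary up to \<open>IP\<close>. After these two facts nearly all arguments
  take place in \<open>P\<close>, away from cosets of cosets. The obstacle is that an element of
  \<open>IP\<close> has many expressions as a sum of products \<open>a p\<close>. No expression is
  chosen: the relation \<open>bockstein_rel\<close> records all possible results. Freeness of
  \<open>P\<close> enters only in showing that the partners of zero lie in \<open>IP\<close>, which
  is tested with linear functionals \<open>P -> R\<close>. The other properties of
  \<open>\<theta>\<close> reflect that every \<open>R\<close>-linear endomorphism of
  \<open>P\<close> preserves the relation.\<close>

lemma additive_finsum: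
  assumes "abelian_monoid A" "abelian_monoid B"
    and "\<And>x. x \<in> carrier A \<Longrightarrow> f x \<in> carrier B"
    and add: "\<And>x y. \<lbrakk>x \<in> carrier A; y \<in> carrier A\<rbrakk> \<Longrightarrow> f (x \<oplus>\<^bsub>A\<^esub> y) = f x \<oplus>\<^bsub>B\<^esub> f y"
    and zero: "f \<zero>\<^bsub>A\<^esub> = \<zero>\<^bsub>B\<^esub>"
    and "u \<in> X \<rightarrow> carrier A"
  shows "f (finsum A u X) = finsum B (\<lambda>x. f (u x)) X"
proof -
  interpret A: abelian_monoid A by fact
  interpret B: abelian_monoid B by fact
  show ?thesis
    using assms(6)
  proof (induction X rule: infinite_finite_induct)
    case (insert x X)
    then have "u x \<in> carrier A" "u \<in> X \<rightarrow> carrier A" by auto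
    moreover have "f (u x) \<in> carrier B" "(\<lambda>x. f (u x)) \<in> X \<rightarrow> carrier B"
      using insert.prems assms(3) by auto
    ultimately show ?case using insert by (simp add: add)
  qed (simp_all add: zero)
qed

text \<open>A transport principle: \<open>B\<close> is a bare record at first, and every module
  axiom is inherited from \<open>A\<close> through preimages. The change of scalars
  \<open>rho\<close> is the identity for quotients by ideals and \<open>R -> R/I\<close> for the
  tensor product and the conormal module.\<close>

lemma module_image:
  fixes R :: "('a, 'm) ring_scheme" and A :: "('a, 'b, 'n) module_scheme"
    and S :: "('c, 'k) ring_scheme" and B :: "('c, 'd, 'l) module_scheme"
  assumes "module R A" and "cring S"
    and rho: "rho \<in> ring_hom R S" "rho ` carrier R = carrier S"
    and f: "f ` carrier A = carrier B"
    and add: "\<And>x y. \<lbrakk>x \<in> carrier A; y \<in> carrier A\<rbrakk> \<Longrightarrow> f (x \<oplus>\<^bsub>A\<^esub> y) = f x \<oplus>\<^bsub>B\<^esub> f y"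
    and zero: "f \<zero>\<^bsub>A\<^esub> = \<zero>\<^bsub>B\<^esub>"
    and smult: "\<And>r x. \<lbrakk>r \<in> carrier R; x \<in> carrier A\<rbrakk> \<Longrightarrow> f (r \<odot>\<^bsub>A\<^esub> x) = rho r \<odot>\<^bsub>B\<^esub> f x"
  shows "module S B"
proof -
  interpret A: module R A by fact
  interpret S: cring S by fact
  have cl: "f x \<in> carrier B" if "x \<in> carrier A" for x
    using f that by blast
  have pre: "\<exists>x\<in>carrier A. y = f x" if "y \<in> carrier B" for y
    using f that by (metis imageE)
  have rpre: "\<exists>r\<in>carrier R. s = rho r" if "s \<in> carrier S" for s
    using rho(2) that by (metis imageE)
  have "abelian_group B"
  proof (rule abelian_groupI)
    fix x y assume "x \<in> carrier B" "y \<in> carrier B"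
    then obtain a b where ab: "x = f a" "y = f b" "a \<in> carrier A" "b \<in> carrier A"
      using pre by metis
    then show "x \<oplus>\<^bsub>B\<^esub> y \<in> carrier B" "x \<oplus>\<^bsub>B\<^esub> y = y \<oplus>\<^bsub>B\<^esub> x"
      by (simp_all add: add[symmetric] cl A.a_comm)
  next
    show "\<zero>\<^bsub>B\<^esub> \<in> carrier B" using cl[OF A.M.zero_closed] zero by simp
  next
    fix x y z assume "x \<in> carrier B" "y \<in> carrier B" "z \<in> carrier B"
    then obtain a b c where "x = f a" "y = f b" "z = f c"
        "a \<in> carrier A" "b \<in> carrier A" "c \<in> carrier A"
      using pre by metis
    then show "(x \<oplus>\<^bsub>B\<^esub> y) \<oplus>\<^bsub>B\<^esub> z = x \<oplus>\<^bsub>B\<^esub> (y \<oplus>\<^bsub>B\<^esub> z)"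
      by (simp add: add[symmetric] A.a_assoc)
  next
    fix x assume "x \<in> carrier B"
    then obtain a where a: "x = f a" "a \<in> carrier A" using pre by metis
    then show "\<zero>\<^bsub>B\<^esub> \<oplus>\<^bsub>B\<^esub> x = x" by (simp add: zero[symmetric] add[symmetric])
    have "f (\<ominus>\<^bsub>A\<^esub> a) \<oplus>\<^bsub>B\<^esub> x = \<zero>\<^bsub>B\<^esub>"
      using a by (simp add: zero[symmetric] add[symmetric] A.l_neg)
    then show "\<exists>y\<in>carrier B. y \<oplus>\<^bsub>B\<^esub> x = \<zero>\<^bsub>B\<^esub>" using a cl by blast
  qed
  then show ?thesis
  proof (rule moduleI[OF S.is_cring])
    fix s x assume "s \<in> carrier S" "x \<in> carrier B"
    then obtain r a where "s = rho r" "x = f a" "r \<in> carrier R" "a \<in> carrier A"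
      using pre rpre by metis
    then show "s \<odot>\<^bsub>B\<^esub> x \<in> carrier B" by (simp add: smult[symmetric] cl)
  next
    fix s t x assume "s \<in> carrier S" "t \<in> carrier S" "x \<in> carrier B"
    then obtain r u a where ru: "s = rho r" "t = rho u" "x = f a"
        "r \<in> carrier R" "u \<in> carrier R" "a \<in> carrier A"
      using pre rpre by metis
    then show "(s \<oplus>\<^bsub>S\<^esub> t) \<odot>\<^bsub>B\<^esub> x = s \<odot>\<^bsub>B\<^esub> x \<oplus>\<^bsub>B\<^esub> t \<odot>\<^bsub>B\<^esub> x"
      by (simp add: smult[symmetric] ring_hom_add[OF rho(1), symmetric] add[symmetric]
          A.smult_l_distr)
    show "s \<otimes>\<^bsub>S\<^esub> t \<odot>\<^bsub>B\<^esub> x = s \<odot>\<^bsub>B\<^esub> (t \<odot>\<^bsub>B\<^esub> x)" using ru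
      by (simp add: smult[symmetric] ring_hom_mult[OF rho(1), symmetric] A.smult_assoc1)
  next
    fix s x y assume "s \<in> carrier S" "x \<in> carrier B" "y \<in> carrier B"
    then obtain r a b where "s = rho r" "x = f a" "y = f b"
        "r \<in> carrier R" "a \<in> carrier A" "b \<in> carrier A"
      using pre rpre by metis
    then show "s \<odot>\<^bsub>B\<^esub> (x \<oplus>\<^bsub>B\<^esub> y) = s \<odot>\<^bsub>B\<^esub> x \<oplus>\<^bsub>B\<^esub> s \<odot>\<^bsub>B\<^esub> y"
      by (simp add: smult[symmetric] add[symmetric] A.smult_r_distr)
  next
    fix x assume "x \<in> carrier B"
    then obtain a where "x = f a" "a \<in> carrier A" using pre by metis
    then show "\<one>\<^bsub>S\<^esub> \<odot>\<^bsub>B\<^esub> x = x"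
      by (simp add: smult[symmetric] ring_hom_one[OF rho(1), symmetric])
  qed
qed

lemma assoc_algebra_image:
  fixes R :: "('a, 'm) ring_scheme" and A :: "('a, 'b, 'n) module_scheme"
    and S :: "('c, 'k) ring_scheme" and B :: "('c, 'd, 'l) module_scheme"
  assumes "assoc_algebra R A" and "cring S"
    and rho: "rho \<in> ring_hom R S" "rho ` carrier R = carrier S"
    and f: "f ` carrier A = carrier B"
    and add: "\<And>x y. \<lbrakk>x \<in> carrier A; y \<in> carrier A\<rbrakk> \<Longrightarrow> f (x \<oplus>\<^bsub>A\<^esub> y) = f x \<oplus>\<^bsub>B\<^esub> f y"
    and zero: "f \<zero>\<^bsub>A\<^esub> = \<zero>\<^bsub>B\<^esub>"
    and smult: "\<And>r x. \<lbrakk>r \<in> carrier R; x \<in> carrier A\<rbrakk> \<Longrightarrow> f (r \<odot>\<^bsub>A\<^esub> x) = rho r \<odot>\<^bsub>B\<^esub> f x"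
    and mult: "\<And>x y. \<lbrakk>x \<in> carrier A; y \<in> carrier A\<rbrakk> \<Longrightarrow> f (x \<otimes>\<^bsub>A\<^esub> y) = f x \<otimes>\<^bsub>B\<^esub> f y"
    and one: "f \<one>\<^bsub>A\<^esub> = \<one>\<^bsub>B\<^esub>"
  shows "assoc_algebra S B"
proof -
  interpret A: assoc_algebra R A by fact
  interpret B: module S B
    by (rule module_image[OF A.module_axioms assms(2) rho f add zero smult])
  have cl: "f x \<in> carrier B" if "x \<in> carrier A" for x
    using f that by blast
  have pre: "\<exists>x\<in>carrier A. y = f x" if "y \<in> carrier B" for y
    using f that by (metis imageE)
  have rpre: "\<exists>r\<in>carrier R. s = rho r" if "s \<in> carrier S" for s
    using rho(2) that by (metis imageE)
  have "ring B"
  proof (rule ringI[OF B.abelian_group_axioms monoidI])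
    fix x y assume "x \<in> carrier B" "y \<in> carrier B"
    then obtain a b where "x = f a" "y = f b" "a \<in> carrier A" "b \<in> carrier A"
      using pre by metis
    then show "x \<otimes>\<^bsub>B\<^esub> y \<in> carrier B" by (simp add: mult[symmetric] cl)
  next
    show "\<one>\<^bsub>B\<^esub> \<in> carrier B" using cl[OF A.one_closed] one by simp
  next
    fix x y z assume "x \<in> carrier B" "y \<in> carrier B" "z \<in> carrier B"
    then obtain a b c where abc: "x = f a" "y = f b" "z = f c"
        "a \<in> carrier A" "b \<in> carrier A" "c \<in> carrier A"
      using pre by metis
    then show "(x \<otimes>\<^bsub>B\<^esub> y) \<otimes>\<^bsub>B\<^esub> z = x \<otimes>\<^bsub>B\<^esub> (y \<otimes>\<^bsub>B\<^esub> z)"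
      by (simp add: mult[symmetric] A.m_assoc)
    from abc show "(x \<oplus>\<^bsub>B\<^esub> y) \<otimes>\<^bsub>B\<^esub> z = x \<otimes>\<^bsub>B\<^esub> z \<oplus>\<^bsub>B\<^esub> y \<otimes>\<^bsub>B\<^esub> z"
      by (simp add: mult[symmetric] add[symmetric] A.l_distr)
    from abc show "z \<otimes>\<^bsub>B\<^esub> (x \<oplus>\<^bsub>B\<^esub> y) = z \<otimes>\<^bsub>B\<^esub> x \<oplus>\<^bsub>B\<^esub> z \<otimes>\<^bsub>B\<^esub> y"
      by (simp add: mult[symmetric] add[symmetric] A.r_distr)
  next
    fix x assume "x \<in> carrier B"
    then obtain a where "x = f a" "a \<in> carrier A" using pre by metis
    then show "\<one>\<^bsub>B\<^esub> \<otimes>\<^bsub>B\<^esub> x = x" "x \<otimes>\<^bsub>B\<^esub> \<one>\<^bsub>B\<^esub> = x"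
      by (simp_all add: mult[symmetric] one[symmetric])
  qed
  moreover have "assoc_algebra_axioms S B"
  proof
    fix s x y assume "s \<in> carrier S" "x \<in> carrier B" "y \<in> carrier B"
    then obtain r a b where "s = rho r" "x = f a" "y = f b"
        "r \<in> carrier R" "a \<in> carrier A" "b \<in> carrier A"
      using pre rpre by metis
    then show "(s \<odot>\<^bsub>B\<^esub> x) \<otimes>\<^bsub>B\<^esub> y = s \<odot>\<^bsub>B\<^esub> (x \<otimes>\<^bsub>B\<^esub> y)" "x \<otimes>\<^bsub>B\<^esub> (s \<odot>\<^bsub>B\<^esub> y) = s \<odot>\<^bsub>B\<^esub> (x \<otimes>\<^bsub>B\<^esub> y)"
      by (simp_all add: smult[symmetric] mult[symmetric] A.smult_mult_left A.smult_mult_right)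
  qed
  ultimately show ?thesis
    using B.module_axioms by (simp add: assoc_algebra_def)
qed


section \<open>Quotient algebras\<close>

locale algebra_ideal = assoc_algebra R A + ideal J A
  for R :: "('a, 'm) ring_scheme" and A :: "('a, 'b, 'n) module_scheme" and J
begin

text \<open>Scalars act through multiples of the unit, so a ring ideal is a submodule. This
  justifies the scalar action of \<open>quot_algebra\<close> for ideals that are only generated as
  ring ideals by \<open>genideal\<close>.\<close>

lemma smult_ideal:
  assumes "r \<in> carrier R" "x \<in> J"
  shows "r \<odot>\<^bsub>A\<^esub> x \<in> J"
proof -
  have "r \<odot>\<^bsub>A\<^esub> x = (r \<odot>\<^bsub>A\<^esub> \<one>\<^bsub>A\<^esub>) \<otimes>\<^bsub>A\<^esub> x"
    using assms by (simp add: smult_mult_left)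
  then show ?thesis
    using assms by (simp add: I_l_closed)
qed

lemma quot_carrier: "carrier (quot_algebra A J) = (\<lambda>x. J +>\<^bsub>A\<^esub> x) ` carrier A"
  by (auto simp: quot_algebra_def with_smult_def FactRing_def A_RCOSETS_def' a_r_coset_def')

lemma quot_add:
  "\<lbrakk>x \<in> carrier A; y \<in> carrier A\<rbrakk>
    \<Longrightarrow> J +>\<^bsub>A\<^esub> (x \<oplus>\<^bsub>A\<^esub> y) = (J +>\<^bsub>A\<^esub> x) \<oplus>\<^bsub>quot_algebra A J\<^esub> (J +>\<^bsub>A\<^esub> y)"
  by (simp add: quot_algebra_def with_smult_def FactRing_def a_rcos_sum)

lemma quot_mult:
  "\<lbrakk>x \<in> carrier A; y \<in> carrier A\<rbrakk>
    \<Longrightarrow> J +>\<^bsub>A\<^esub> (x \<otimes>\<^bsub>A\<^esub> y) = (J +>\<^bsub>A\<^esub> x) \<otimes>\<^bsub>quot_algebra A J\<^esub> (J +>\<^bsub>A\<^esub> y)"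
  by (simp add: quot_algebra_def with_smult_def FactRing_def rcoset_mult_add)

lemma quot_one: "J +>\<^bsub>A\<^esub> \<one>\<^bsub>A\<^esub> = \<one>\<^bsub>quot_algebra A J\<^esub>"
  by (simp add: quot_algebra_def with_smult_def FactRing_def)

lemma quot_zero: "J +>\<^bsub>A\<^esub> \<zero>\<^bsub>A\<^esub> = \<zero>\<^bsub>quot_algebra A J\<^esub>"
  by (simp add: quot_algebra_def with_smult_def FactRing_def a_coset_add_zero[OF a_subset])

lemma quot_eq_iff:
  "\<lbrakk>x \<in> carrier A; y \<in> carrier A\<rbrakk> \<Longrightarrow> J +>\<^bsub>A\<^esub> x = J +>\<^bsub>A\<^esub> y \<longleftrightarrow> x \<ominus>\<^bsub>A\<^esub> y \<in> J"
  using a_rcos_module_minus[OF ring_axioms, of y x] a_rcos_self[of x]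
    a_repr_independence'[of x y] by auto

lemma quot_eq_zero_iff: "x \<in> carrier A \<Longrightarrow> J +>\<^bsub>A\<^esub> x = \<zero>\<^bsub>quot_algebra A J\<^esub> \<longleftrightarrow> x \<in> J"
  using quot_eq_iff[of x "\<zero>\<^bsub>A\<^esub>"] by (simp add: quot_zero a_minus_def)

lemma quot_smult:
  assumes "r \<in> carrier R" "x \<in> carrier A"
  shows "J +>\<^bsub>A\<^esub> (r \<odot>\<^bsub>A\<^esub> x) = r \<odot>\<^bsub>quot_algebra A J\<^esub> (J +>\<^bsub>A\<^esub> x)"
proof -
  \<comment> \<open>The scalar action on the quotient is a union over all representatives
    \<open>y\<close>. It collapses to a single coset once every \<open>y\<close> gives the same
    one.\<close>
  have "J +>\<^bsub>A\<^esub> (r \<odot>\<^bsub>A\<^esub> y) = J +>\<^bsub>A\<^esub> (r \<odot>\<^bsub>A\<^esub> x)" if "y \<in> J +>\<^bsub>A\<^esub> x" for y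
  proof -
    from that obtain j where j: "j \<in> J" "y = j \<oplus>\<^bsub>A\<^esub> x"
      by (auto simp: a_r_coset_def')
    then have y: "y \<in> carrier A" and "y \<ominus>\<^bsub>A\<^esub> x = j"
      using assms by (auto simp: a_minus_def a_assoc M.r_neg)
    moreover have smult_diff: "r \<odot>\<^bsub>A\<^esub> y \<ominus>\<^bsub>A\<^esub> r \<odot>\<^bsub>A\<^esub> x = r \<odot>\<^bsub>A\<^esub> (y \<ominus>\<^bsub>A\<^esub> x)"
      using y assms by (simp add: a_minus_def smult_r_distr smult_r_minus)
    ultimately show ?thesis
      using j assms by (simp add: quot_eq_iff smult_ideal smult_diff)
  qed
  moreover have "J +>\<^bsub>A\<^esub> x \<noteq> {}"
    using assms a_rcos_self by blast
  ultimately have "(\<Union>y\<in>J +>\<^bsub>A\<^esub> x. J +>\<^bsub>A\<^esub> (r \<odot>\<^bsub>A\<^esub> y)) = J +>\<^bsub>A\<^esub> (r \<odot>\<^bsub>A\<^esub> x)"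
    by (intro SUP_eq_const)
  then show ?thesis
    by (simp add: quot_algebra_def with_smult_def)
qed

lemma quot_assoc_algebra: "assoc_algebra R (quot_algebra A J)"
proof (rule assoc_algebra_image[where rho = "\<lambda>r. r" and f = "\<lambda>x. J +>\<^bsub>A\<^esub> x"])
  show "(\<lambda>r. r) \<in> ring_hom R R" by (simp add: ring_hom_memI)
qed (auto simp: assoc_algebra_axioms R.is_cring quot_carrier quot_add quot_zero quot_smult
      quot_mult quot_one)

end

text \<open>The kernel is itself an ideal. Hence, to factor a homomorphism through a presentation,
  only the generating relations have to be evaluated.\<close>

lemma (in ring) genideal_subset_kernel:
  assumes "ring B" "h \<in> ring_hom R B" "X \<subseteq> carrier R" "\<And>x. x \<in> X \<Longrightarrow> h x = \<zero>\<^bsub>B\<^esub>"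
  shows "genideal R X \<subseteq> {x \<in> carrier R. h x = \<zero>\<^bsub>B\<^esub>}"
proof -
  interpret h: ring_hom_ring R B h
    by (rule ring_hom_ringI2) (use assms ring_axioms in auto)
  have "ideal {x \<in> carrier R. h x = \<zero>\<^bsub>B\<^esub>} R"
    using h.kernel_is_ideal unfolding a_kernel_def' .
  then show ?thesis
    by (rule genideal_minimal) (use assms(3,4) in blast)
qed

section \<open>Monoid algebras\<close>

lemma (in cring) fin_supp_closed: "f \<in> fin_supp R Y \<Longrightarrow> f x \<in> carrier R"
  by (cases "x \<in> Y") (auto simp: fin_supp_def)

lemma fin_supp_finite: "f \<in> fin_supp R Y \<Longrightarrow> finite {x. f x \<noteq> \<zero>\<^bsub>R\<^esub>}"
  by (simp add: fin_supp_def)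

lemma fin_supp_subset: "f \<in> fin_supp R Y \<Longrightarrow> {x. f x \<noteq> \<zero>\<^bsub>R\<^esub>} \<subseteq> Y"
  by (auto simp: fin_supp_def)

lemma (in cring) fin_suppI:
  assumes "\<And>x. f x \<in> carrier R" "finite A" "A \<subseteq> Y" "\<And>x. x \<notin> A \<Longrightarrow> f x = \<zero>"
  shows "f \<in> fin_supp R Y"
proof -
  have "{x. f x \<noteq> \<zero>} \<subseteq> A" using assms(4) by blast
  then show ?thesis
    using assms finite_subset by (auto simp: fin_supp_def)
qed

lemma (in cring) fin_supp_zero: "(\<lambda>_. \<zero>) \<in> fin_supp R Y"
  by (simp add: fin_supp_def)

lemma (in cring) fin_supp_single:
  "\<lbrakk>y \<in> Y; r \<in> carrier R\<rbrakk> \<Longrightarrow> single R y r \<in> fin_supp R Y"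
  by (rule fin_suppI[of _ "{y}"]) (auto simp: single_def)

lemma (in cring) fin_supp_add:
  assumes "f \<in> fin_supp R Y" "g \<in> fin_supp R Y"
  shows "(\<lambda>x. f x \<oplus> g x) \<in> fin_supp R Y"
proof (rule fin_suppI[of _ "{x. f x \<noteq> \<zero>} \<union> {x. g x \<noteq> \<zero>}"])
  show "f x \<oplus> g x \<in> carrier R" for x
    using assms by (simp add: fin_supp_closed)
qed (use assms in \<open>auto simp: fin_supp_def\<close>)

lemma (in cring) fin_supp_smult:
  assumes "f \<in> fin_supp R Y" "r \<in> carrier R"
  shows "(\<lambda>x. r \<otimes> f x) \<in> fin_supp R Y"
proof (rule fin_suppI[of _ "{x. f x \<noteq> \<zero>}"])
  show "r \<otimes> f x \<in> carrier R" for x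
    using assms by (simp add: fin_supp_closed)
qed (use assms in \<open>auto simp: fin_supp_def\<close>)

lemma (in cring) fin_supp_induct [consumes 1, case_names zero single add]:
  assumes f: "f \<in> fin_supp R Y"
    and zero: "P (\<lambda>_. \<zero>)"
    and single: "\<And>y r. \<lbrakk>y \<in> Y; r \<in> carrier R\<rbrakk> \<Longrightarrow> P (single R y r)"
    and add: "\<And>f g. \<lbrakk>f \<in> fin_supp R Y; g \<in> fin_supp R Y; P f; P g\<rbrakk> \<Longrightarrow> P (\<lambda>x. f x \<oplus> g x)"
  shows "P f"
proof -
  \<comment> \<open>The induction is on a finite set containing the support, not on the support
    itself, so a point where \<open>f\<close> vanishes is simply dropped.\<close>
  have "P f" if "finite A" "f \<in> fin_supp R Y" "{x. f x \<noteq> \<zero>} \<subseteq> A" for A f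
    using that
  proof (induction A arbitrary: f rule: finite_induct)
    case empty
    then have "f = (\<lambda>_. \<zero>)" by auto
    then show ?case using zero by simp
  next
    case (insert a A)
    show ?case
    proof (cases "f a = \<zero>")
      case True
      then show ?thesis using insert by (intro insert.IH) auto
    next
      case False
      then have a: "a \<in> Y" "f a \<in> carrier R"
        using insert.prems by (auto simp: fin_supp_def)
      let ?g = "f(a := \<zero>)"
      have g: "?g \<in> fin_supp R Y"
        by (rule fin_suppI[of _ "{x. f x \<noteq> \<zero>}"])
          (use insert.prems fin_supp_closed in \<open>auto simp: fin_supp_def\<close>)
      have "f = (\<lambda>x. single R a (f a) x \<oplus> ?g x)"
        using fin_supp_closed[OF insert.prems(1)] by (auto simp: single_def)
      moreover have "P ?g"
        by (rule insert.IH[OF g]) (use insert.prems in auto)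
      ultimately show ?thesis
        using add[OF fin_supp_single[OF a] g single[OF a]] by simp
    qed
  qed
  then show ?thesis using f fin_supp_finite by blast
qed

text \<open>\<open>fin_supp R Y\<close> is the free module on \<open>Y\<close>, and this is the
  linear map out of it with values \<open>m\<close> on the basis. For \<open>m\<close> the identity
  it is the expansion that occurs in \<open>is_basis\<close>.\<close>

definition lin_ext ::
    "('a, 'm) ring_scheme \<Rightarrow> ('a, 'b, 'n) module_scheme \<Rightarrow> ('g \<Rightarrow> 'b) \<Rightarrow> ('g \<Rightarrow> 'a) \<Rightarrow> 'b"
  where "lin_ext R B m f = (\<Oplus>\<^bsub>B\<^esub>g\<in>{g. f g \<noteq> \<zero>\<^bsub>R\<^esub>}. f g \<odot>\<^bsub>B\<^esub> m g)"

context module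
begin

text \<open>The sum defining \<open>lin_ext\<close> runs over the support, which changes with
  \<open>f\<close>. Padding it to a common finite set turns additivity into a termwise
  statement.\<close>

lemma lin_ext_superset:
  assumes "m \<in> Y \<rightarrow> carrier M" "f \<in> fin_supp R Y" "finite A" "{g. f g \<noteq> \<zero>} \<subseteq> A" "A \<subseteq> Y"
  shows "lin_ext R M m f = (\<Oplus>\<^bsub>M\<^esub>g\<in>A. f g \<odot>\<^bsub>M\<^esub> m g)"
  unfolding lin_ext_def
proof (rule M.add.finprod_mono_neutral_cong_left)
  show "(\<lambda>g. f g \<odot>\<^bsub>M\<^esub> m g) \<in> A \<rightarrow> carrier M"
    using assms R.fin_supp_closed[OF assms(2)] by blast
  show "f g \<odot>\<^bsub>M\<^esub> m g = \<zero>\<^bsub>M\<^esub>" if "g \<in> A - {g. f g \<noteq> \<zero>}" for g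
    using that assms by (auto simp: Pi_iff)
qed (use assms in auto)

lemma lin_ext_closed:
  "\<lbrakk>m \<in> Y \<rightarrow> carrier M; f \<in> fin_supp R Y\<rbrakk> \<Longrightarrow> lin_ext R M m f \<in> carrier M"
  unfolding lin_ext_def
  by (rule M.finsum_closed) (use fin_supp_subset[of f R Y] in \<open>auto simp: Pi_iff R.fin_supp_closed\<close>)

lemma lin_ext_zero: "lin_ext R M m (\<lambda>_. \<zero>) = \<zero>\<^bsub>M\<^esub>"
  by (simp add: lin_ext_def)

lemma lin_ext_single:
  assumes "m \<in> Y \<rightarrow> carrier M" "y \<in> Y" "r \<in> carrier R"
  shows "lin_ext R M m (single R y r) = r \<odot>\<^bsub>M\<^esub> m y"
proof -
  have "lin_ext R M m (single R y r) = (\<Oplus>\<^bsub>M\<^esub>g\<in>{y}. single R y r g \<odot>\<^bsub>M\<^esub> m g)"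
    by (rule lin_ext_superset[of m Y])
      (use assms R.fin_supp_single in \<open>auto simp: single_def\<close>)
  also have "\<dots> = r \<odot>\<^bsub>M\<^esub> m y"
    using assms by (subst M.finsum_insert) (auto simp: single_def Pi_iff)
  finally show ?thesis .
qed

lemma lin_ext_add:
  assumes m: "m \<in> Y \<rightarrow> carrier M" and f: "f \<in> fin_supp R Y" and g: "g \<in> fin_supp R Y"
  shows "lin_ext R M m (\<lambda>x. f x \<oplus> g x) = lin_ext R M m f \<oplus>\<^bsub>M\<^esub> lin_ext R M m g"
proof -
  let ?A = "{x. f x \<noteq> \<zero>} \<union> {x. g x \<noteq> \<zero>}"
  have A: "finite ?A" "?A \<subseteq> Y"
    using f g by (auto simp: fin_supp_def)
  have cl: "f x \<in> carrier R" "g x \<in> carrier R" for x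
    using R.fin_supp_closed[OF f] R.fin_supp_closed[OF g] by auto
  have "lin_ext R M m (\<lambda>x. f x \<oplus> g x) = (\<Oplus>\<^bsub>M\<^esub>x\<in>?A. (f x \<oplus> g x) \<odot>\<^bsub>M\<^esub> m x)"
    by (rule lin_ext_superset[OF m R.fin_supp_add[OF f g]]) (use A in auto)
  also have "\<dots> = (\<Oplus>\<^bsub>M\<^esub>x\<in>?A. f x \<odot>\<^bsub>M\<^esub> m x \<oplus>\<^bsub>M\<^esub> g x \<odot>\<^bsub>M\<^esub> m x)"
    by (rule M.finsum_cong') (use A m cl in \<open>auto simp: smult_l_distr Pi_iff\<close>)
  also have "\<dots> = (\<Oplus>\<^bsub>M\<^esub>x\<in>?A. f x \<odot>\<^bsub>M\<^esub> m x) \<oplus>\<^bsub>M\<^esub> (\<Oplus>\<^bsub>M\<^esub>x\<in>?A. g x \<odot>\<^bsub>M\<^esub> m x)"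
    by (rule M.finsum_addf) (use A m cl in blast)+
  also have "\<dots> = lin_ext R M m f \<oplus>\<^bsub>M\<^esub> lin_ext R M m g"
    using lin_ext_superset[OF m f, of ?A] lin_ext_superset[OF m g, of ?A] A by simp
  finally show ?thesis .
qed

lemma lin_ext_smult:
  assumes m: "m \<in> Y \<rightarrow> carrier M" and f: "f \<in> fin_supp R Y" and r: "r \<in> carrier R"
  shows "lin_ext R M m (\<lambda>x. r \<otimes> f x) = r \<odot>\<^bsub>M\<^esub> lin_ext R M m f"
proof -
  let ?A = "{x. f x \<noteq> \<zero>}"
  have A: "finite ?A" "?A \<subseteq> Y"
    using f by (auto simp: fin_supp_def)
  have cl: "f x \<in> carrier R" for x
    using R.fin_supp_closed[OF f] .
  have "lin_ext R M m (\<lambda>x. r \<otimes> f x) = (\<Oplus>\<^bsub>M\<^esub>x\<in>?A. (r \<otimes> f x) \<odot>\<^bsub>M\<^esub> m x)"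
    by (rule lin_ext_superset[OF m R.fin_supp_smult[OF f r]]) (use A r in auto)
  also have "\<dots> = (\<Oplus>\<^bsub>M\<^esub>x\<in>?A. r \<odot>\<^bsub>M\<^esub> (f x \<odot>\<^bsub>M\<^esub> m x))"
    by (rule M.finsum_cong') (use A m cl r in \<open>auto simp: smult_assoc1 Pi_iff\<close>)
  also have "\<dots> = r \<odot>\<^bsub>M\<^esub> (\<Oplus>\<^bsub>M\<^esub>x\<in>?A. f x \<odot>\<^bsub>M\<^esub> m x)"
    by (rule finsum_smult_ldistr[symmetric]) (use A m cl r in blast)+
  finally show ?thesis by (simp add: lin_ext_def)
qed

end

section \<open>The convolution product\<close>

locale monoid_alg = R?: cring R + G?: monoid G
  for R :: "('a, 'm) ring_scheme" (structure) and G :: "('g, 'k) monoid_scheme"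
begin

abbreviation "K \<equiv> monoid_algebra R G"

lemma K_simps:
  "carrier K = fin_supp R (carrier G)" "\<one>\<^bsub>K\<^esub> = single R \<one>\<^bsub>G\<^esub> \<one>" "\<zero>\<^bsub>K\<^esub> = (\<lambda>_. \<zero>)"
  "f \<oplus>\<^bsub>K\<^esub> g = (\<lambda>x. f x \<oplus> g x)" "a \<odot>\<^bsub>K\<^esub> f = (\<lambda>x. a \<otimes> f x)"
  by (simp_all add: monoid_algebra_def)

text \<open>On the rectangle \<open>A \<times> B\<close> the index set depends neither on
  \<open>x\<close> nor on the exact supports, so distributivity can be checked summand by
  summand.\<close>

lemma K_mult_superset:
  assumes f: "f \<in> carrier K" and g: "g \<in> carrier K"
    and A: "finite A" "{x. f x \<noteq> \<zero>} \<subseteq> A" and B: "finite B" "{x. g x \<noteq> \<zero>} \<subseteq> B"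
  shows "(f \<otimes>\<^bsub>K\<^esub> g) x =
    (\<Oplus>p\<in>A \<times> B. if fst p \<otimes>\<^bsub>G\<^esub> snd p = x then f (fst p) \<otimes> g (snd p) else \<zero>)"
proof -
  have cl: "f y \<in> carrier R" "g y \<in> carrier R" for y
    using f g fin_supp_closed by (auto simp: K_simps)
  have "(f \<otimes>\<^bsub>K\<^esub> g) x = (\<Oplus>p\<in>{p. f (fst p) \<noteq> \<zero> \<and> g (snd p) \<noteq> \<zero> \<and> fst p \<otimes>\<^bsub>G\<^esub> snd p = x}.
      f (fst p) \<otimes> g (snd p))"
    by (simp add: monoid_algebra_def)
  also have "\<dots> =
    (\<Oplus>p\<in>A \<times> B. if fst p \<otimes>\<^bsub>G\<^esub> snd p = x then f (fst p) \<otimes> g (snd p) else \<zero>)"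
    by (rule R.add.finprod_mono_neutral_cong_left) (use A B cl in auto)
  finally show ?thesis .
qed

lemma K_mult_closed:
  assumes f: "f \<in> carrier K" and g: "g \<in> carrier K"
  shows "f \<otimes>\<^bsub>K\<^esub> g \<in> carrier K"
proof -
  let ?A = "{x. f x \<noteq> \<zero>}" and ?B = "{x. g x \<noteq> \<zero>}"
  let ?X = "(\<lambda>p. fst p \<otimes>\<^bsub>G\<^esub> snd p) ` (?A \<times> ?B)"
  have A: "finite ?A" "?A \<subseteq> carrier G" and B: "finite ?B" "?B \<subseteq> carrier G"
    using f g by (auto simp: fin_supp_def K_simps)
  have cl: "f y \<in> carrier R" "g y \<in> carrier R" for y
    using f g fin_supp_closed by (auto simp: K_simps)
  note eq = K_mult_superset[OF f g A(1) order_refl B(1) order_refl]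
  have "f \<otimes>\<^bsub>K\<^esub> g \<in> fin_supp R (carrier G)"
  proof (rule fin_suppI[of _ ?X])
    show "(f \<otimes>\<^bsub>K\<^esub> g) x \<in> carrier R" for x
      unfolding eq by (rule finsum_closed) (use cl in auto)
    show "(f \<otimes>\<^bsub>K\<^esub> g) x = \<zero>" if "x \<notin> ?X" for x
      unfolding eq by (rule R.add.finprod_one_eqI) (use that in auto)
  qed (use A B in \<open>auto simp: subset_iff\<close>)
  then show ?thesis by (simp add: K_simps)
qed

lemma K_add_closed: "\<lbrakk>f \<in> carrier K; g \<in> carrier K\<rbrakk> \<Longrightarrow> f \<oplus>\<^bsub>K\<^esub> g \<in> carrier K"
  by (simp add: K_simps fin_supp_add)

lemma K_mult_add_left:
  assumes f: "f \<in> carrier K" and f': "f' \<in> carrier K" and g: "g \<in> carrier K"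
  shows "(f \<oplus>\<^bsub>K\<^esub> f') \<otimes>\<^bsub>K\<^esub> g = (f \<otimes>\<^bsub>K\<^esub> g) \<oplus>\<^bsub>K\<^esub> (f' \<otimes>\<^bsub>K\<^esub> g)"
proof
  fix x
  let ?A = "{x. f x \<noteq> \<zero>} \<union> {x. f' x \<noteq> \<zero>}" and ?B = "{x. g x \<noteq> \<zero>}"
  have A: "finite ?A" and B: "finite ?B"
    using f f' g by (auto simp: fin_supp_def K_simps)
  have cl: "f y \<in> carrier R" "f' y \<in> carrier R" "g y \<in> carrier R" for y
    using f f' g fin_supp_closed by (auto simp: K_simps)
  have "((f \<oplus>\<^bsub>K\<^esub> f') \<otimes>\<^bsub>K\<^esub> g) x =
    (\<Oplus>p\<in>?A \<times> ?B. if fst p \<otimes>\<^bsub>G\<^esub> snd p = x then (f \<oplus>\<^bsub>K\<^esub> f') (fst p) \<otimes> g (snd p) else \<zero>)"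
    by (rule K_mult_superset) (use A B f f' g K_add_closed in \<open>auto simp: K_simps\<close>)
  also have "\<dots> = (\<Oplus>p\<in>?A \<times> ?B. (if fst p \<otimes>\<^bsub>G\<^esub> snd p = x then f (fst p) \<otimes> g (snd p) else \<zero>)
      \<oplus> (if fst p \<otimes>\<^bsub>G\<^esub> snd p = x then f' (fst p) \<otimes> g (snd p) else \<zero>))"
    by (rule finsum_cong') (use cl in \<open>auto simp: K_simps l_distr\<close>)
  also have "\<dots> = (f \<otimes>\<^bsub>K\<^esub> g) x \<oplus> (f' \<otimes>\<^bsub>K\<^esub> g) x"
    using K_mult_superset[OF f g A _ B] K_mult_superset[OF f' g A _ B] cl
    by (subst finsum_addf) auto
  finally show "((f \<oplus>\<^bsub>K\<^esub> f') \<otimes>\<^bsub>K\<^esub> g) x = ((f \<otimes>\<^bsub>K\<^esub> g) \<oplus>\<^bsub>K\<^esub> (f' \<otimes>\<^bsub>K\<^esub> g)) x"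
    by (simp add: K_simps)
qed

lemma K_mult_add_right:
  assumes f: "f \<in> carrier K" and f': "f' \<in> carrier K" and g: "g \<in> carrier K"
  shows "g \<otimes>\<^bsub>K\<^esub> (f \<oplus>\<^bsub>K\<^esub> f') = (g \<otimes>\<^bsub>K\<^esub> f) \<oplus>\<^bsub>K\<^esub> (g \<otimes>\<^bsub>K\<^esub> f')"
proof
  fix x
  let ?A = "{x. f x \<noteq> \<zero>} \<union> {x. f' x \<noteq> \<zero>}" and ?B = "{x. g x \<noteq> \<zero>}"
  have A: "finite ?A" and B: "finite ?B"
    using f f' g by (auto simp: fin_supp_def K_simps)
  have cl: "f y \<in> carrier R" "f' y \<in> carrier R" "g y \<in> carrier R" for y
    using f f' g fin_supp_closed by (auto simp: K_simps)
  have "(g \<otimes>\<^bsub>K\<^esub> (f \<oplus>\<^bsub>K\<^esub> f')) x =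
    (\<Oplus>p\<in>?B \<times> ?A. if fst p \<otimes>\<^bsub>G\<^esub> snd p = x then g (fst p) \<otimes> (f \<oplus>\<^bsub>K\<^esub> f') (snd p) else \<zero>)"
    by (rule K_mult_superset) (use A B f f' g K_add_closed in \<open>auto simp: K_simps\<close>)
  also have "\<dots> = (\<Oplus>p\<in>?B \<times> ?A. (if fst p \<otimes>\<^bsub>G\<^esub> snd p = x then g (fst p) \<otimes> f (snd p) else \<zero>)
      \<oplus> (if fst p \<otimes>\<^bsub>G\<^esub> snd p = x then g (fst p) \<otimes> f' (snd p) else \<zero>))"
    by (rule finsum_cong') (use cl in \<open>auto simp: K_simps r_distr\<close>)
  also have "\<dots> = (g \<otimes>\<^bsub>K\<^esub> f) x \<oplus> (g \<otimes>\<^bsub>K\<^esub> f') x"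
    using K_mult_superset[OF g f B _ A] K_mult_superset[OF g f' B _ A] cl
    by (subst finsum_addf) auto
  finally show "(g \<otimes>\<^bsub>K\<^esub> (f \<oplus>\<^bsub>K\<^esub> f')) x = ((g \<otimes>\<^bsub>K\<^esub> f) \<oplus>\<^bsub>K\<^esub> (g \<otimes>\<^bsub>K\<^esub> f')) x"
    by (simp add: K_simps)
qed

lemma K_mult_single:
  assumes "a \<in> carrier G" "b \<in> carrier G" "r \<in> carrier R" "s \<in> carrier R"
  shows "single R a r \<otimes>\<^bsub>K\<^esub> single R b s = single R (a \<otimes>\<^bsub>G\<^esub> b) (r \<otimes> s)"
proof
  fix x
  have "(single R a r \<otimes>\<^bsub>K\<^esub> single R b s) x =
    (\<Oplus>p\<in>{a} \<times> {b}. if fst p \<otimes>\<^bsub>G\<^esub> snd p = x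
      then single R a r (fst p) \<otimes> single R b s (snd p) else \<zero>)"
    by (rule K_mult_superset) (use assms fin_supp_single in \<open>auto simp: single_def K_simps\<close>)
  also have "\<dots> = single R (a \<otimes>\<^bsub>G\<^esub> b) (r \<otimes> s) x"
    using assms by (auto simp: single_def finsum_insert)
  finally show "(single R a r \<otimes>\<^bsub>K\<^esub> single R b s) x = single R (a \<otimes>\<^bsub>G\<^esub> b) (r \<otimes> s) x" .
qed

lemma K_zero_mult:
  assumes "f \<in> carrier K"
  shows "\<zero>\<^bsub>K\<^esub> \<otimes>\<^bsub>K\<^esub> f = \<zero>\<^bsub>K\<^esub>" "f \<otimes>\<^bsub>K\<^esub> \<zero>\<^bsub>K\<^esub> = \<zero>\<^bsub>K\<^esub>"
  by (auto simp: monoid_algebra_def)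

lemma K_module: "module R K"
proof (rule moduleI[OF R.is_cring])
  show "abelian_group K"
  proof (rule abelian_groupI)
    fix f assume f: "f \<in> carrier K"
    have "(\<lambda>x. \<ominus> \<one> \<otimes> f x) \<oplus>\<^bsub>K\<^esub> f = \<zero>\<^bsub>K\<^esub>"
      using fin_supp_closed[of f] f by (simp add: K_simps l_minus l_neg)
    moreover have "(\<lambda>x. \<ominus> \<one> \<otimes> f x) \<in> carrier K"
      using f fin_supp_smult[of f "carrier G" "\<ominus> \<one>"] by (simp add: K_simps)
    ultimately show "\<exists>g\<in>carrier K. g \<oplus>\<^bsub>K\<^esub> f = \<zero>\<^bsub>K\<^esub>" by blast
  qed (auto simp: K_simps fin_supp_add fin_supp_zero fin_supp_closed R.a_ac)
qed (auto simp: K_simps fin_supp_smult fin_supp_closed R.l_distr R.r_distr R.m_assoc)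

lemma K_induct [consumes 1, case_names zero single add]:
  assumes "f \<in> carrier K" "P \<zero>\<^bsub>K\<^esub>"
    and "\<And>y r. \<lbrakk>y \<in> carrier G; r \<in> carrier R\<rbrakk> \<Longrightarrow> P (single R y r)"
    and "\<And>f g. \<lbrakk>f \<in> carrier K; g \<in> carrier K; P f; P g\<rbrakk> \<Longrightarrow> P (f \<oplus>\<^bsub>K\<^esub> g)"
  shows "P f"
  using assms(1) unfolding K_simps(1)
  by (induction rule: fin_supp_induct) (use assms(2-4) in \<open>auto simp: K_simps\<close>)

lemma K_single_closed: "\<lbrakk>y \<in> carrier G; r \<in> carrier R\<rbrakk> \<Longrightarrow> single R y r \<in> carrier K"
  by (simp add: K_simps fin_supp_single)

lemma K_smult_single: "\<lbrakk>r \<in> carrier R; s \<in> carrier R\<rbrakk> \<Longrightarrow> r \<odot>\<^bsub>K\<^esub> single R y s = single R y (r \<otimes> s)"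
  by (auto simp: K_simps single_def)

sublocale K: module R K by (rule K_module)

text \<open>Both sides are additive in each of the three arguments. This leaves functions supported
  at one point, where the claim is associativity in \<open>G\<close> and in
  \<open>R\<close>.\<close>

lemma K_mult_assoc:
  assumes "f \<in> carrier K" "g \<in> carrier K" "h \<in> carrier K"
  shows "(f \<otimes>\<^bsub>K\<^esub> g) \<otimes>\<^bsub>K\<^esub> h = f \<otimes>\<^bsub>K\<^esub> (g \<otimes>\<^bsub>K\<^esub> h)"
  using assms(1)
proof (induction rule: K_induct)
  case zero then show ?case using assms by (simp add: K_zero_mult K_mult_closed)
next
  case (add f f')
  then show ?case using assms by (simp add: K_mult_add_left K_mult_closed)
next
  case (single a r)
  note a = K_single_closed[OF single]
  show ?case using assms(2)
  proof (induction rule: K_induct)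
    case zero then show ?case using assms a by (simp add: K_zero_mult K_mult_closed)
  next
    case (add g g')
    then show ?case using assms a by (simp add: K_mult_add_left K_mult_add_right K_mult_closed)
  next
    case (single b s)
    note b = K_single_closed[OF single]
    show ?case using assms(3)
    proof (induction rule: K_induct)
      case zero then show ?case using a b by (simp add: K_zero_mult K_mult_closed)
    next
      case (add h h')
      then show ?case using a b by (simp add: K_mult_add_right K_mult_closed)
    next
      case (single c t)
      then show ?case using \<open>a \<in> carrier G\<close> \<open>b \<in> carrier G\<close> \<open>r \<in> carrier R\<close> \<open>s \<in> carrier R\<close>
        by (simp add: K_mult_single G.m_assoc R.m_assoc)
    qed
  qed
qed

lemma K_smult_mult:
  assumes "r \<in> carrier R" "f \<in> carrier K" "g \<in> carrier K"
  shows "(r \<odot>\<^bsub>K\<^esub> f) \<otimes>\<^bsub>K\<^esub> g = r \<odot>\<^bsub>K\<^esub> (f \<otimes>\<^bsub>K\<^esub> g)" "f \<otimes>\<^bsub>K\<^esub> (r \<odot>\<^bsub>K\<^esub> g) = r \<odot>\<^bsub>K\<^esub> (f \<otimes>\<^bsub>K\<^esub> g)"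
proof -
  have "(r \<odot>\<^bsub>K\<^esub> f) \<otimes>\<^bsub>K\<^esub> g = r \<odot>\<^bsub>K\<^esub> (f \<otimes>\<^bsub>K\<^esub> g) \<and> f \<otimes>\<^bsub>K\<^esub> (r \<odot>\<^bsub>K\<^esub> g) = r \<odot>\<^bsub>K\<^esub> (f \<otimes>\<^bsub>K\<^esub> g)"
    using assms(2)
  proof (induction rule: K_induct)
    case zero then show ?case using assms by (simp add: K_zero_mult K.smult_closed)
  next
    case (add f f')
    then show ?case using assms
      by (simp add: K_mult_add_left K.smult_r_distr K_mult_closed K.smult_closed)
  next
    case (single a s)
    note a = K_single_closed[OF single]
    show ?case using assms(3)
    proof (induction rule: K_induct)
      case zero then show ?case using assms a by (simp add: K_zero_mult K.smult_closed)
    next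
      case (add g g')
      then show ?case using assms a
        by (simp add: K_mult_add_right K.smult_r_distr K_mult_closed K.smult_closed)
    next
      case (single b t)
      then show ?case using \<open>a \<in> carrier G\<close> \<open>s \<in> carrier R\<close> assms(1)
        by (simp add: K_mult_single K_smult_single R.m_assoc R.m_lcomm)
    qed
  qed
  then show "(r \<odot>\<^bsub>K\<^esub> f) \<otimes>\<^bsub>K\<^esub> g = r \<odot>\<^bsub>K\<^esub> (f \<otimes>\<^bsub>K\<^esub> g)" "f \<otimes>\<^bsub>K\<^esub> (r \<odot>\<^bsub>K\<^esub> g) = r \<odot>\<^bsub>K\<^esub> (f \<otimes>\<^bsub>K\<^esub> g)"
    by auto
qed

lemma K_mult_one:
  assumes "f \<in> carrier K"
  shows "\<one>\<^bsub>K\<^esub> \<otimes>\<^bsub>K\<^esub> f = f" "f \<otimes>\<^bsub>K\<^esub> \<one>\<^bsub>K\<^esub> = f"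
proof -
  have one: "\<one>\<^bsub>K\<^esub> \<in> carrier K" by (simp add: K_simps fin_supp_single)
  have "\<one>\<^bsub>K\<^esub> \<otimes>\<^bsub>K\<^esub> f = f \<and> f \<otimes>\<^bsub>K\<^esub> \<one>\<^bsub>K\<^esub> = f" using assms
  proof (induction rule: K_induct)
    case zero then show ?case using one by (simp add: K_zero_mult)
  next
    case (add f f')
    then show ?case using one by (simp add: K_mult_add_left K_mult_add_right)
  next
    case (single a s)
    then show ?case by (simp add: K_simps(2) K_mult_single)
  qed
  then show "\<one>\<^bsub>K\<^esub> \<otimes>\<^bsub>K\<^esub> f = f" "f \<otimes>\<^bsub>K\<^esub> \<one>\<^bsub>K\<^esub> = f" by auto
qed

sublocale K: assoc_algebra R K
proof -
  have "ring K"
  proof (rule ringI[OF K.abelian_group_axioms monoidI])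
    show "\<one>\<^bsub>K\<^esub> \<in> carrier K" by (simp add: K_simps fin_supp_single)
  qed (simp_all add: K_mult_closed K_mult_assoc K_mult_one K_mult_add_left K_mult_add_right)
  then show "assoc_algebra R K"
    by (simp add: assoc_algebra_def K.module_axioms assoc_algebra_axioms_def K_smult_mult)
qed

text \<open>The multiplicative half of the universal property of the monoid algebra. Biadditivity
  reduces it to functions supported at one point, where scalars have to be moved past products in
  \<open>B\<close>.\<close>

lemma lin_ext_mult:
  fixes B :: "('a, 'b, 'n) module_scheme"
  assumes "assoc_algebra R B" and m: "m \<in> carrier G \<rightarrow> carrier B"
    and mm: "\<And>x y. \<lbrakk>x \<in> carrier G; y \<in> carrier G\<rbrakk> \<Longrightarrow> m (x \<otimes>\<^bsub>G\<^esub> y) = m x \<otimes>\<^bsub>B\<^esub> m y"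
    and f: "f \<in> carrier K" and g: "g \<in> carrier K"
  shows "lin_ext R B m (f \<otimes>\<^bsub>K\<^esub> g) = lin_ext R B m f \<otimes>\<^bsub>B\<^esub> lin_ext R B m g"
proof -
  interpret B: assoc_algebra R B by fact
  have ad: "lin_ext R B m (f \<oplus>\<^bsub>K\<^esub> g) = lin_ext R B m f \<oplus>\<^bsub>B\<^esub> lin_ext R B m g"
    if "f \<in> carrier K" "g \<in> carrier K" for f g
    using that by (simp add: K_simps B.lin_ext_add[OF m])
  have ze: "lin_ext R B m \<zero>\<^bsub>K\<^esub> = \<zero>\<^bsub>B\<^esub>"
    by (simp add: K_simps B.lin_ext_zero)
  have cl: "lin_ext R B m f \<in> carrier B" if "f \<in> carrier K" for f
    using that by (simp add: K_simps B.lin_ext_closed[OF m])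
  show ?thesis using f
  proof (induction rule: K_induct)
    case zero then show ?case using g cl by (simp add: K_zero_mult ze)
  next
    case (add f f')
    then show ?case using g cl by (simp add: K_mult_add_left ad K_mult_closed B.l_distr)
  next
    case (single a r)
    note a = K_single_closed[OF single]
    show ?case using g
    proof (induction rule: K_induct)
      case zero then show ?case using a cl by (simp add: K_zero_mult ze)
    next
      case (add g g')
      then show ?case using a cl by (simp add: K_mult_add_right ad K_mult_closed B.r_distr)
    next
      case (single b s)
      moreover have "m a \<in> carrier B" "m b \<in> carrier B"
        using m single \<open>a \<in> carrier G\<close> by auto
      ultimately show ?case using \<open>a \<in> carrier G\<close> \<open>r \<in> carrier R\<close>
        by (simp add: K_mult_single B.lin_ext_single[OF m] mm B.smult_assoc1[symmetric]
            B.smult_mult_left B.smult_mult_right R.m_comm)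
    qed
  qed
qed

lemma lin_ext_ring_hom:
  fixes B :: "('a, 'b, 'n) module_scheme"
  assumes "assoc_algebra R B" and m: "m \<in> carrier G \<rightarrow> carrier B"
    and mm: "\<And>x y. \<lbrakk>x \<in> carrier G; y \<in> carrier G\<rbrakk> \<Longrightarrow> m (x \<otimes>\<^bsub>G\<^esub> y) = m x \<otimes>\<^bsub>B\<^esub> m y"
    and one: "m \<one>\<^bsub>G\<^esub> = \<one>\<^bsub>B\<^esub>"
  shows "lin_ext R B m \<in> ring_hom K B"
proof -
  interpret B: assoc_algebra R B by fact
  show ?thesis
  proof (rule ring_hom_memI)
    show "lin_ext R B m \<one>\<^bsub>K\<^esub> = \<one>\<^bsub>B\<^esub>"
      by (simp add: K_simps B.lin_ext_single[OF m] one)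
  next
    fix f g assume "f \<in> carrier K" "g \<in> carrier K"
    then show "lin_ext R B m (f \<otimes>\<^bsub>K\<^esub> g) = lin_ext R B m f \<otimes>\<^bsub>B\<^esub> lin_ext R B m g"
      by (intro lin_ext_mult[OF assms(1) m mm])
  qed (simp_all add: K_simps B.lin_ext_add[OF m] B.lin_ext_closed[OF m])
qed

end

section \<open>Homomorphisms out of a quotient algebra\<close>

context algebra_ideal
begin

lemma quot_lift:
  assumes "ring B" "H \<in> ring_hom A B" "\<And>x. x \<in> J \<Longrightarrow> H x = \<zero>\<^bsub>B\<^esub>"
  obtains h where "h \<in> ring_hom (quot_algebra A J) B"
    "\<And>x. x \<in> carrier A \<Longrightarrow> h (J +>\<^bsub>A\<^esub> x) = H x"
proof -
  interpret h: ring_hom_ring A B H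
    by (rule ring_hom_ringI2) (use assms ring_axioms in auto)
  have wd: "H x = H y" if "x \<in> carrier A" "y \<in> carrier A" "J +>\<^bsub>A\<^esub> x = J +>\<^bsub>A\<^esub> y" for x y
  proof -
    have "H (x \<ominus>\<^bsub>A\<^esub> y) = \<zero>\<^bsub>B\<^esub>"
      using that assms(3) quot_eq_iff by blast
    then have "H x \<ominus>\<^bsub>B\<^esub> H y = \<zero>\<^bsub>B\<^esub>"
      using that by (simp add: a_minus_def)
    then show ?thesis
      using that by (simp add: h.S.r_right_minus_eq)
  qed
  define h where "h Y = H (SOME x. x \<in> carrier A \<and> Y = J +>\<^bsub>A\<^esub> x)" for Y
  have h: "h (J +>\<^bsub>A\<^esub> x) = H x" if "x \<in> carrier A" for x
  proof -
    have "(SOME y. y \<in> carrier A \<and> J +>\<^bsub>A\<^esub> x = J +>\<^bsub>A\<^esub> y) \<in> carrier A \<and>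
        J +>\<^bsub>A\<^esub> x = J +>\<^bsub>A\<^esub> (SOME y. y \<in> carrier A \<and> J +>\<^bsub>A\<^esub> x = J +>\<^bsub>A\<^esub> y)"
      by (rule someI[of _ x]) (use that in simp)
    then show ?thesis
      unfolding h_def using that wd by metis
  qed
  have "h \<in> ring_hom (quot_algebra A J) B"
  proof (rule ring_hom_memI)
    show "h \<one>\<^bsub>quot_algebra A J\<^esub> = \<one>\<^bsub>B\<^esub>"
      by (simp add: quot_one[symmetric] h)
  qed (auto simp: quot_carrier h quot_mult[symmetric] quot_add[symmetric])
  with h that show ?thesis by blast
qed

end


section \<open>Exterior algebras\<close>

locale exterior = module S M
  for S :: "('a, 'm) ring_scheme" (structure) and M :: "('a, 'b, 'n) module_scheme"
begin

abbreviation "words \<equiv> \<lparr>carrier = lists (carrier M), monoid.mult = (@), monoid.one = []\<rparr>"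
abbreviation "W \<equiv> monoid_algebra S words"
abbreviation "X \<equiv> exterior_ideal S M"
abbreviation "E \<equiv> exterior_algebra S M"
abbreviation "incl \<equiv> exterior_incl S M"
abbreviation "Egr \<equiv> exterior_gr S M"

definition "word w = X +>\<^bsub>W\<^esub> single S w \<one>"

sublocale MA: monoid_alg S words
  by (intro monoid_alg.intro R.is_cring monoidI) auto

lemmas W_assoc_algebra = MA.K.assoc_algebra_axioms

lemma E_eq: "E = quot_algebra W X"
  by (simp add: exterior_algebra_def word_algebra_def)

definition "relations =
  {single S [x \<oplus>\<^bsub>M\<^esub> y] \<one> \<ominus>\<^bsub>W\<^esub> (single S [x] \<one> \<oplus>\<^bsub>W\<^esub> single S [y] \<one>) | x y.
      x \<in> carrier M \<and> y \<in> carrier M} \<union>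
  {single S [s \<odot>\<^bsub>M\<^esub> x] \<one> \<ominus>\<^bsub>W\<^esub> (s \<odot>\<^bsub>W\<^esub> single S [x] \<one>) | s x. s \<in> carrier S \<and> x \<in> carrier M} \<union>
  {single S [x, x] \<one> | x. x \<in> carrier M}"

lemma X_eq: "X = genideal W relations"
  by (simp add: exterior_ideal_def word_algebra_def Let_def relations_def)

lemma single_word_closed: "set w \<subseteq> carrier M \<Longrightarrow> s \<in> carrier S \<Longrightarrow> single S w s \<in> carrier W"
  by (intro MA.K_single_closed) auto

lemma relations_closed: "relations \<subseteq> carrier W"
  unfolding relations_def
  by (auto intro!: MA.K.minus_closed MA.K.a_closed MA.K.smult_closed single_word_closed)

sublocale X: algebra_ideal S W X
  unfolding X_eq
  by (intro algebra_ideal.intro W_assoc_algebra MA.K.genideal_ideal relations_closed)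

lemma E_assoc_algebra: "assoc_algebra S E"
  using X.quot_assoc_algebra by (simp add: E_eq)

sublocale E: assoc_algebra S E
  by (rule E_assoc_algebra)

lemma incl_eq: "incl x = word [x]"
  by (simp add: exterior_incl_def word_def word_algebra_def)

lemma coset_closed: "f \<in> carrier W \<Longrightarrow> X +>\<^bsub>W\<^esub> f \<in> carrier E"
  by (simp add: E_eq X.quot_carrier)

lemma word_closed: "set w \<subseteq> carrier M \<Longrightarrow> word w \<in> carrier E"
  by (simp add: word_def coset_closed single_word_closed)

lemma incl_closed: "x \<in> carrier M \<Longrightarrow> incl x \<in> carrier E"
  by (simp add: incl_eq word_closed)

lemma word_Nil: "word [] = \<one>\<^bsub>E\<^esub>"
  by (simp add: word_def E_eq X.quot_one[symmetric] MA.K_simps)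

lemma word_Cons:
  assumes "x \<in> carrier M" "set w \<subseteq> carrier M"
  shows "word (x # w) = incl x \<otimes>\<^bsub>E\<^esub> word w"
proof -
  have "[x] \<in> carrier words" "w \<in> carrier words"
    using assms by auto
  from MA.K_mult_single[OF this, of \<one> \<one>]
  have "single S (x # w) \<one> = single S [x] \<one> \<otimes>\<^bsub>W\<^esub> single S w \<one>" by simp
  then show ?thesis
    using assms single_word_closed
    by (simp add: word_def incl_eq E_eq X.quot_mult)
qed

lemma coset_single:
  assumes "set w \<subseteq> carrier M" "s \<in> carrier S"
  shows "X +>\<^bsub>W\<^esub> single S w s = s \<odot>\<^bsub>E\<^esub> word w"
proof -
  have "single S w s = s \<odot>\<^bsub>W\<^esub> single S w \<one>"
    using assms by (simp add: MA.K_smult_single)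
  then show ?thesis
    using assms single_word_closed by (simp add: word_def E_eq X.quot_smult)
qed

lemma relation_in_X: "r \<in> relations \<Longrightarrow> r \<in> X"
  using MA.K.genideal_self[OF relations_closed] X_eq by blast

lemma incl_add:
  assumes "x \<in> carrier M" "y \<in> carrier M"
  shows "incl (x \<oplus>\<^bsub>M\<^esub> y) = incl x \<oplus>\<^bsub>E\<^esub> incl y"
proof -
  have "single S [x \<oplus>\<^bsub>M\<^esub> y] \<one> \<ominus>\<^bsub>W\<^esub> (single S [x] \<one> \<oplus>\<^bsub>W\<^esub> single S [y] \<one>) \<in> X"
    by (rule relation_in_X) (use assms in \<open>auto simp: relations_def\<close>)
  then show ?thesis
    using assms single_word_closed
    by (simp add: incl_eq word_def E_eq X.quot_add[symmetric] X.quot_eq_iff)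
qed

lemma incl_smult:
  assumes "s \<in> carrier S" "x \<in> carrier M"
  shows "incl (s \<odot>\<^bsub>M\<^esub> x) = s \<odot>\<^bsub>E\<^esub> incl x"
proof -
  have "single S [s \<odot>\<^bsub>M\<^esub> x] \<one> \<ominus>\<^bsub>W\<^esub> (s \<odot>\<^bsub>W\<^esub> single S [x] \<one>) \<in> X"
    by (rule relation_in_X) (use assms in \<open>auto simp: relations_def\<close>)
  then show ?thesis
    using assms single_word_closed
    by (simp add: incl_eq word_def E_eq X.quot_smult[symmetric] X.quot_eq_iff)
qed

lemma incl_square:
  assumes "x \<in> carrier M"
  shows "incl x \<otimes>\<^bsub>E\<^esub> incl x = \<zero>\<^bsub>E\<^esub>"
proof -
  have "single S [x, x] \<one> \<in> X"
    by (rule relation_in_X) (use assms in \<open>auto simp: relations_def\<close>)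
  then have "word [x, x] = \<zero>\<^bsub>E\<^esub>"
    using assms single_word_closed by (simp add: word_def E_eq X.quot_eq_zero_iff)
  then show ?thesis
    using assms by (simp add: word_Cons[of x "[x]"] incl_eq[symmetric])
qed

text \<open>Polarization: in the square of \<open>incl (x \<oplus> y)\<close> only the two mixed
  products survive.\<close>

lemma incl_anticomm:
  assumes "x \<in> carrier M" "y \<in> carrier M"
  shows "incl y \<otimes>\<^bsub>E\<^esub> incl x = \<ominus>\<^bsub>E\<^esub> (incl x \<otimes>\<^bsub>E\<^esub> incl y)"
proof -
  note [simp] = assms incl_closed incl_square
  have "\<zero>\<^bsub>E\<^esub> = incl (x \<oplus>\<^bsub>M\<^esub> y) \<otimes>\<^bsub>E\<^esub> incl (x \<oplus>\<^bsub>M\<^esub> y)" by simp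
  also have "\<dots> = incl y \<otimes>\<^bsub>E\<^esub> incl x \<oplus>\<^bsub>E\<^esub> incl x \<otimes>\<^bsub>E\<^esub> incl y"
    by (simp add: incl_add E.l_distr E.r_distr E.a_comm)
  finally show ?thesis
    by (intro E.minus_equality[symmetric]) simp_all
qed

lemma carrier_W: "carrier W = fin_supp S (lists (carrier M))"
  by (simp add: MA.K_simps)

lemma E_induct [consumes 1, case_names zero word add]:
  assumes u: "u \<in> carrier E" and "P \<zero>\<^bsub>E\<^esub>"
    and "\<And>s w. \<lbrakk>s \<in> carrier S; set w \<subseteq> carrier M\<rbrakk> \<Longrightarrow> P (s \<odot>\<^bsub>E\<^esub> word w)"
    and "\<And>u v. \<lbrakk>u \<in> carrier E; v \<in> carrier E; P u; P v\<rbrakk> \<Longrightarrow> P (u \<oplus>\<^bsub>E\<^esub> v)"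
  shows "P u"
proof -
  from u obtain f where u: "u = X +>\<^bsub>W\<^esub> f" and f: "f \<in> carrier W"
    by (auto simp: E_eq X.quot_carrier)
  from f have "P (X +>\<^bsub>W\<^esub> f)"
  proof (induction rule: MA.K_induct)
    case zero
    then show ?case using assms(2) by (simp add: X.quot_zero E_eq)
  next
    case (single w s)
    then have "set w \<subseteq> carrier M" by auto
    with single assms(3) show ?case by (metis coset_single)
  next
    case (add f g)
    then show ?case using assms(4) coset_closed by (simp add: X.quot_add E_eq)
  qed
  with u show ?thesis by simp
qed

section \<open>The grading of the exterior algebra\<close>

lemma fin_supp_length:
  "fin_supp S {w. set w \<subseteq> carrier M \<and> length w = n} =
    {f \<in> carrier W. \<forall>w. f w \<noteq> \<zero> \<longrightarrow> length w = n}" (is "?L = ?R")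
proof
  show "?L \<subseteq> ?R"
  proof
    fix f assume f: "f \<in> ?L"
    then have "f \<in> fin_supp S (lists (carrier M))"
      by (intro R.fin_suppI[of f "{w. f w \<noteq> \<zero>}"])
        (use fin_supp_subset[OF f] in \<open>auto simp: R.fin_supp_closed fin_supp_finite\<close>)
    then show "f \<in> ?R"
      using fin_supp_subset[OF f] by (auto simp: carrier_W)
  qed
  show "?R \<subseteq> ?L"
  proof
    fix f assume f: "f \<in> ?R"
    then have f': "f \<in> fin_supp S (lists (carrier M))" by (simp add: carrier_W)
    then show "f \<in> ?L"
      by (intro R.fin_suppI[of f "{w. f w \<noteq> \<zero>}"])
        (use f fin_supp_subset[OF f'] in \<open>auto simp: R.fin_supp_closed fin_supp_finite\<close>)
  qed
qed

lemma fin_supp_length_carrier: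
  "f \<in> fin_supp S {w. set w \<subseteq> carrier M \<and> length w = n} \<Longrightarrow> f \<in> carrier W"
  by (simp add: fin_supp_length)

text \<open>With degree \<open>n\<close> described as finite support on the words of length
  \<open>n\<close>, \<open>fin_supp_induct\<close> applies within one degree and yields
  \<open>Egr_induct\<close>.\<close>

lemma Egr_eq: "Egr n = (\<lambda>f. X +>\<^bsub>W\<^esub> f) ` fin_supp S {w. set w \<subseteq> carrier M \<and> length w = n}"
  unfolding fin_supp_length exterior_gr_def word_algebra_def by blast

lemma Egr_closed: "u \<in> Egr n \<Longrightarrow> u \<in> carrier E"
  using fin_supp_length_carrier coset_closed by (auto simp: Egr_eq)

lemma Egr_zero: "\<zero>\<^bsub>E\<^esub> \<in> Egr n"
  unfolding Egr_eq
  by (rule image_eqI[OF _ R.fin_supp_zero]) (simp add: E_eq X.quot_zero[symmetric] MA.K_simps)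

lemma Egr_add:
  assumes "u \<in> Egr n" "v \<in> Egr n"
  shows "u \<oplus>\<^bsub>E\<^esub> v \<in> Egr n"
proof -
  obtain f g where fg: "u = X +>\<^bsub>W\<^esub> f" "v = X +>\<^bsub>W\<^esub> g"
      "f \<in> fin_supp S {w. set w \<subseteq> carrier M \<and> length w = n}"
      "g \<in> fin_supp S {w. set w \<subseteq> carrier M \<and> length w = n}"
    using assms by (auto simp: Egr_eq)
  show ?thesis
    unfolding Egr_eq
    using X.quot_add[of f g] fg fin_supp_length_carrier
    by (intro image_eqI[OF _ R.fin_supp_add[OF fg(3,4)]]) (simp add: E_eq MA.K_simps(4))
qed

lemma word_Egr:
  assumes "set w \<subseteq> carrier M" "s \<in> carrier S"
  shows "s \<odot>\<^bsub>E\<^esub> word w \<in> Egr (length w)"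
  unfolding Egr_eq
  by (rule image_eqI[where x = "single S w s"])
    (use assms in \<open>auto simp: coset_single intro!: R.fin_supp_single\<close>)

lemma Egr_induct [consumes 1, case_names zero word add]:
  assumes u: "u \<in> Egr n" and "P \<zero>\<^bsub>E\<^esub>"
    and "\<And>s w. \<lbrakk>s \<in> carrier S; set w \<subseteq> carrier M; length w = n\<rbrakk> \<Longrightarrow> P (s \<odot>\<^bsub>E\<^esub> word w)"
    and "\<And>u v. \<lbrakk>u \<in> Egr n; v \<in> Egr n; P u; P v\<rbrakk> \<Longrightarrow> P (u \<oplus>\<^bsub>E\<^esub> v)"
  shows "P u"
proof -
  from u obtain f where u: "u = X +>\<^bsub>W\<^esub> f"
      and f: "f \<in> fin_supp S {w. set w \<subseteq> carrier M \<and> length w = n}"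
    by (auto simp: Egr_eq)
  from f have "P (X +>\<^bsub>W\<^esub> f)"
  proof (induction rule: R.fin_supp_induct)
    case zero
    have "X +>\<^bsub>W\<^esub> (\<lambda>_. \<zero>) = \<zero>\<^bsub>E\<^esub>"
      by (simp add: X.quot_zero[symmetric] E_eq MA.K_simps)
    then show ?case using assms(2) by simp
  next
    case (single w s)
    then show ?case using assms(3) by (simp add: coset_single)
  next
    case (add f g)
    then have "X +>\<^bsub>W\<^esub> (\<lambda>x. f x \<oplus> g x) = (X +>\<^bsub>W\<^esub> f) \<oplus>\<^bsub>E\<^esub> (X +>\<^bsub>W\<^esub> g)"
      using X.quot_add[of f g] fin_supp_length_carrier by (simp add: E_eq MA.K_simps(4))
    then show ?case using assms(4) add by (auto simp: Egr_eq)
  qed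
  with u show ?thesis by simp
qed

lemma Egr_smult:
  assumes "u \<in> Egr n" "s \<in> carrier S"
  shows "s \<odot>\<^bsub>E\<^esub> u \<in> Egr n"
  using assms(1)
proof (induction rule: Egr_induct)
  case zero then show ?case using assms Egr_zero by simp
next
  case (word t w)
  then show ?case
    using assms word_Egr[of w "s \<otimes> t"] by (simp add: E.smult_assoc1 word_closed)
next
  case (add u v)
  then show ?case using assms by (simp add: E.smult_r_distr Egr_add Egr_closed)
qed

lemma one_Egr: "\<one>\<^bsub>E\<^esub> \<in> Egr 0"
  using word_Egr[of "[]" \<one>] by (simp add: word_Nil)

lemma incl_Egr:
  assumes "u \<in> Egr n" "x \<in> carrier M"
  shows "incl x \<otimes>\<^bsub>E\<^esub> u \<in> Egr (Suc n)"
  using assms(1)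
proof (induction rule: Egr_induct)
  case zero then show ?case using assms Egr_zero incl_closed by simp
next
  case (word s w)
  then have "incl x \<otimes>\<^bsub>E\<^esub> (s \<odot>\<^bsub>E\<^esub> word w) = s \<odot>\<^bsub>E\<^esub> word (x # w)"
    using assms by (simp add: word_Cons E.smult_mult_right incl_closed word_closed)
  then show ?case
    using assms word word_Egr[of "x # w" s] by simp
next
  case (add u v)
  then show ?case using assms by (simp add: E.r_distr Egr_add Egr_closed incl_closed)
qed

text \<open>\<open>incl x\<close> passes each of the \<open>n\<close> letters of a word once, and
  each passage costs one sign by \<open>incl_anticomm\<close>.\<close>

lemma incl_comm:
  assumes "u \<in> Egr n" "x \<in> carrier M"
  shows "u \<otimes>\<^bsub>E\<^esub> incl x = koszul_sign E n (incl x \<otimes>\<^bsub>E\<^esub> u)"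
  using assms(1)
proof (induction rule: Egr_induct)
  case zero then show ?case using assms incl_closed by (simp add: koszul_sign_def)
next
  case (word s w)
  note [simp] = incl_closed[OF assms(2)] word_closed incl_closed E.smult_mult_left
    E.smult_mult_right E.smult_r_minus
  have "word w \<otimes>\<^bsub>E\<^esub> incl x = koszul_sign E (length w) (incl x \<otimes>\<^bsub>E\<^esub> word w)"
    using word(2)
  proof (induction w)
    case Nil then show ?case by (simp add: word_Nil koszul_sign_def)
  next
    case (Cons y w)
    then have yw: "y \<in> carrier M" "set w \<subseteq> carrier M" by auto
    have "word (y # w) \<otimes>\<^bsub>E\<^esub> incl x = incl y \<otimes>\<^bsub>E\<^esub> (word w \<otimes>\<^bsub>E\<^esub> incl x)"
      using yw by (simp add: word_Cons E.m_assoc)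
    also have "\<dots> = koszul_sign E (length w) ((incl y \<otimes>\<^bsub>E\<^esub> incl x) \<otimes>\<^bsub>E\<^esub> word w)"
      using Cons yw by (simp add: koszul_sign_def E.m_assoc E.r_minus)
    also have "\<dots> = koszul_sign E (length (y # w)) (incl x \<otimes>\<^bsub>E\<^esub> word (y # w))"
      using yw assms(2)
      by (simp add: koszul_sign_def word_Cons incl_anticomm[OF assms(2) yw(1)] E.l_minus
          E.m_assoc)
    finally show ?case .
  qed
  then show ?case using word by (auto simp: koszul_sign_def)
next
  case (add u v)
  then show ?case using assms
    by (simp add: koszul_sign_def E.r_distr E.l_distr Egr_closed incl_closed E.minus_add E.a_comm)
qed

section \<open>Universal property of the exterior algebra\<close>

lemma hom_determined:
  assumes "ring B" "h \<in> ring_hom E B" "k \<in> ring_hom E B"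
    and "\<And>s u. \<lbrakk>s \<in> carrier S; u \<in> carrier E\<rbrakk> \<Longrightarrow> h (s \<odot>\<^bsub>E\<^esub> u) = s \<odot>\<^bsub>B\<^esub> h u"
    and "\<And>s u. \<lbrakk>s \<in> carrier S; u \<in> carrier E\<rbrakk> \<Longrightarrow> k (s \<odot>\<^bsub>E\<^esub> u) = s \<odot>\<^bsub>B\<^esub> k u"
    and "\<And>x. x \<in> carrier M \<Longrightarrow> h (incl x) = k (incl x)"
    and "u \<in> carrier E"
  shows "h u = k u"
proof -
  interpret h: ring_hom_ring E B h
    by (rule ring_hom_ringI2) (use assms E.ring_axioms in auto)
  interpret k: ring_hom_ring E B k
    by (rule ring_hom_ringI2) (use assms E.ring_axioms in auto)
  have word: "h (word w) = k (word w)" if "set w \<subseteq> carrier M" for w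
    using that
  proof (induction w)
    case Nil then show ?case by (simp add: word_Nil)
  next
    case (Cons y w)
    then show ?case by (simp add: word_Cons incl_closed word_closed assms(6))
  qed
  from assms(7) show ?thesis
  proof (induction rule: E_induct)
    case zero then show ?case by simp
  next
    case (word s w)
    then show ?case by (simp add: assms(4,5) \<open>set w \<subseteq> carrier M \<Longrightarrow> h (word w) = k (word w)\<close> word_closed)
  next
    case (add u v)
    then show ?case by simp
  qed
qed

text \<open>On words \<open>j\<close> extends by multiplying out the letters, hence linearly to the
  free algebra \<open>W\<close>. The three families of relations die because \<open>j\<close> is
  additive, is linear over scalars and has vanishing squares.\<close>

lemma hom_exists:
  fixes B :: "('a, 'c, 'l) module_scheme"
  assumes B: "assoc_algebra S B"
    and j: "\<And>x. x \<in> carrier M \<Longrightarrow> j x \<in> carrier B"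
    and j_add: "\<And>x y. \<lbrakk>x \<in> carrier M; y \<in> carrier M\<rbrakk> \<Longrightarrow> j (x \<oplus>\<^bsub>M\<^esub> y) = j x \<oplus>\<^bsub>B\<^esub> j y"
    and j_smult: "\<And>s x. \<lbrakk>s \<in> carrier S; x \<in> carrier M\<rbrakk> \<Longrightarrow> j (s \<odot>\<^bsub>M\<^esub> x) = s \<odot>\<^bsub>B\<^esub> j x"
    and j_square: "\<And>x. x \<in> carrier M \<Longrightarrow> j x \<otimes>\<^bsub>B\<^esub> j x = \<zero>\<^bsub>B\<^esub>"
  obtains h where "h \<in> ring_hom E B"
    "\<And>s u. \<lbrakk>s \<in> carrier S; u \<in> carrier E\<rbrakk> \<Longrightarrow> h (s \<odot>\<^bsub>E\<^esub> u) = s \<odot>\<^bsub>B\<^esub> h u"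
    "\<And>x. x \<in> carrier M \<Longrightarrow> h (incl x) = j x"
proof -
  interpret B: assoc_algebra S B by fact
  define m where "m w = foldr (\<lambda>x b. j x \<otimes>\<^bsub>B\<^esub> b) w \<one>\<^bsub>B\<^esub>" for w
  have m_closed: "m w \<in> carrier B" if "set w \<subseteq> carrier M" for w
    using that by (induction w) (auto simp: m_def j)
  have m_append: "m (v @ w) = m v \<otimes>\<^bsub>B\<^esub> m w" if "set v \<subseteq> carrier M" "set w \<subseteq> carrier M" for v w
    using that(1)
  proof (induction v)
    case Nil then show ?case using m_closed[OF that(2)] by (simp add: m_def)
  next
    case (Cons x v)
    then have "m ((x # v) @ w) = j x \<otimes>\<^bsub>B\<^esub> m (v @ w)" "m (x # v) = j x \<otimes>\<^bsub>B\<^esub> m v"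
      by (simp_all add: m_def)
    then show ?case using Cons m_closed that(2) by (simp add: j B.m_assoc)
  qed
  have m: "m \<in> carrier words \<rightarrow> carrier B"
    using m_closed by (auto simp: lists_eq_set)
  let ?H = "lin_ext S B m"
  have H: "?H \<in> ring_hom W B"
    by (rule MA.lin_ext_ring_hom[OF B m]) (auto simp: m_append lists_eq_set m_def[of "[]"])
  interpret H: ring_hom_ring W B ?H
    by (rule ring_hom_ringI2) (use H MA.K.ring_axioms B.ring_axioms in auto)
  have H_smult: "?H (s \<odot>\<^bsub>W\<^esub> f) = s \<odot>\<^bsub>B\<^esub> ?H f" if "s \<in> carrier S" "f \<in> carrier W" for s f
    using that B.lin_ext_smult[OF m] by (simp add: MA.K_simps)
  have H_single: "?H (single S w \<one>) = m w" if "set w \<subseteq> carrier M" for w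
    using that m_closed B.lin_ext_single[OF m, of w \<one>] by (auto simp: lists_eq_set)
  have m1: "m [x] = j x" if "x \<in> carrier M" for x
    using that by (simp add: m_def j)
  have "?H r = \<zero>\<^bsub>B\<^esub>" if "r \<in> relations" for r
    using that unfolding relations_def
  proof (elim UnE CollectE exE conjE)
    fix x y assume r: "r = single S [x \<oplus>\<^bsub>M\<^esub> y] \<one> \<ominus>\<^bsub>W\<^esub> (single S [x] \<one> \<oplus>\<^bsub>W\<^esub> single S [y] \<one>)"
      and xy: "x \<in> carrier M" "y \<in> carrier M"
    then show ?thesis
      using single_word_closed
      by (simp add: a_minus_def H_single m1 j_add j B.r_neg)
  next
    fix s x assume r: "r = single S [s \<odot>\<^bsub>M\<^esub> x] \<one> \<ominus>\<^bsub>W\<^esub> (s \<odot>\<^bsub>W\<^esub> single S [x] \<one>)"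
      and xy: "s \<in> carrier S" "x \<in> carrier M"
    then show ?thesis
      using single_word_closed
      by (simp add: a_minus_def H_single H_smult m1 j_smult j B.r_neg)
  next
    fix x assume "r = single S [x, x] \<one>" "x \<in> carrier M"
    then show ?thesis by (simp add: H_single, simp add: m_def j j_square)
  qed
  then have "?H r = \<zero>\<^bsub>B\<^esub>" if "r \<in> X" for r
    using that MA.K.genideal_subset_kernel[OF B.ring_axioms H relations_closed]
    unfolding X_eq by blast
  then obtain h where h: "h \<in> ring_hom (quot_algebra W X) B"
      "\<And>f. f \<in> carrier W \<Longrightarrow> h (X +>\<^bsub>W\<^esub> f) = ?H f"
    using X.quot_lift[OF B.ring_axioms H] by blast
  show ?thesis
  proof
    show "h \<in> ring_hom E B" using h by (simp add: E_eq)
    show "h (s \<odot>\<^bsub>E\<^esub> u) = s \<odot>\<^bsub>B\<^esub> h u" if "s \<in> carrier S" "u \<in> carrier E" for s u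
      using that by (auto simp: E_eq X.quot_carrier X.quot_smult[symmetric] h H_smult)
    show "h (incl x) = j x" if "x \<in> carrier M" for x
      using that single_word_closed by (simp add: incl_eq word_def h H_single m1)
  qed
qed

text \<open>The algebra \<open>E\<close> is generated by the image of \<open>incl\<close>, so the
  degree of the image of a word adds up letter by letter.\<close>

lemma hom_graded:
  fixes B :: "('a, 'c, 'l) module_scheme"
  assumes "assoc_algebra S B" and h: "h \<in> ring_hom E B"
    and smult: "\<And>s u. \<lbrakk>s \<in> carrier S; u \<in> carrier E\<rbrakk> \<Longrightarrow> h (s \<odot>\<^bsub>E\<^esub> u) = s \<odot>\<^bsub>B\<^esub> h u"
    and gr: "\<And>i. submodule (Bgr i) S B" "\<one>\<^bsub>B\<^esub> \<in> Bgr 0"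
      "\<And>i j x y. \<lbrakk>x \<in> Bgr i; y \<in> Bgr j\<rbrakk> \<Longrightarrow> x \<otimes>\<^bsub>B\<^esub> y \<in> Bgr (i + j)"
    and incl: "\<And>x. x \<in> carrier M \<Longrightarrow> h (incl x) \<in> Bgr 1"
    and u: "u \<in> Egr n"
  shows "h u \<in> Bgr n"
proof -
  interpret B: assoc_algebra S B by fact
  interpret h: ring_hom_ring E B h
    by (rule ring_hom_ringI2) (use h E.ring_axioms B.ring_axioms in auto)
  have word: "h (word w) \<in> Bgr (length w)" if "set w \<subseteq> carrier M" for w
    using that
  proof (induction w)
    case Nil then show ?case using gr by (simp add: word_Nil)
  next
    case (Cons x w)
    then show ?case using gr(3)[of "h (incl x)" 1 "h (word w)"] incl
      by (simp add: word_Cons incl_closed word_closed)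
  qed
  note gr = B.submoduleE[OF gr(1)]
  have zero: "\<zero>\<^bsub>B\<^esub> \<in> Bgr n"
    using gr(2) gr(4)[OF R.zero_closed] gr(1) by (metis B.smult_l_null all_not_in_conv subsetD)
  from u show ?thesis
  proof (induction rule: Egr_induct)
    case zero then show ?case using \<open>\<zero>\<^bsub>B\<^esub> \<in> Bgr n\<close> by simp
  next
    case (word s w)
    then show ?case
      using \<open>set w \<subseteq> carrier M \<Longrightarrow> h (word w) \<in> Bgr (length w)\<close> gr(4) by (auto simp: smult word_closed)
  next
    case (add u v) then show ?case using gr(5) by (simp add: Egr_closed)
  qed
qed

end

section \<open>Homogeneous components\<close>

lemma (in abelian_monoid) finsum_induct:
  assumes "\<And>i. i \<in> A \<Longrightarrow> u i \<in> carrier G" "\<And>i. i \<in> A \<Longrightarrow> P (u i)" "P \<zero>"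
    and "\<And>x y. \<lbrakk>x \<in> carrier G; y \<in> carrier G; P x; P y\<rbrakk> \<Longrightarrow> P (x \<oplus> y)"
  shows "P (finsum G u A)"
  using assms(1,2)
proof (induction A rule: infinite_finite_induct)
  case (insert i A)
  then have "u \<in> A \<rightarrow> carrier G" by auto
  then show ?case using insert assms(4) by (simp add: finsum_insert)
qed (simp_all add: assms(3))

context graded_algebra
begin

definition "hcomp x = (THE c. (\<forall>i. c i \<in> gr i) \<and> finite {i. c i \<noteq> \<zero>\<^bsub>A\<^esub>} \<and>
  (\<Oplus>\<^bsub>A\<^esub>i\<in>{i. c i \<noteq> \<zero>\<^bsub>A\<^esub>}. c i) = x)"

lemma gr_facts:
  shows gr_carrier: "x \<in> gr i \<Longrightarrow> x \<in> carrier A"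
    and gr_add: "\<lbrakk>x \<in> gr i; y \<in> gr i\<rbrakk> \<Longrightarrow> x \<oplus>\<^bsub>A\<^esub> y \<in> gr i"
    and gr_smult: "\<lbrakk>r \<in> carrier R; x \<in> gr i\<rbrakk> \<Longrightarrow> r \<odot>\<^bsub>A\<^esub> x \<in> gr i"
    and gr_zero: "\<zero>\<^bsub>A\<^esub> \<in> gr i"
    and gr_inv: "x \<in> gr i \<Longrightarrow> \<ominus>\<^bsub>A\<^esub> x \<in> gr i"
proof -
  note E = submoduleE[OF gr_submodule]
  show "x \<in> gr i \<Longrightarrow> x \<in> carrier A" using E(1) by auto
  show "\<lbrakk>x \<in> gr i; y \<in> gr i\<rbrakk> \<Longrightarrow> x \<oplus>\<^bsub>A\<^esub> y \<in> gr i" using E(5) .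
  show "\<lbrakk>r \<in> carrier R; x \<in> gr i\<rbrakk> \<Longrightarrow> r \<odot>\<^bsub>A\<^esub> x \<in> gr i" using E(4) .
  show "x \<in> gr i \<Longrightarrow> \<ominus>\<^bsub>A\<^esub> x \<in> gr i" using E(3) .
  show "\<zero>\<^bsub>A\<^esub> \<in> gr i"
    using subgroup.one_closed[OF submodule.axioms(1)[OF gr_submodule]] by simp
qed

lemma hcomp_props:
  assumes "x \<in> carrier A"
  shows "hcomp x i \<in> gr i" "finite {i. hcomp x i \<noteq> \<zero>\<^bsub>A\<^esub>}"
    "(\<Oplus>\<^bsub>A\<^esub>i\<in>{i. hcomp x i \<noteq> \<zero>\<^bsub>A\<^esub>}. hcomp x i) = x"
  using theI'[OF gr_direct_sum[OF assms]] unfolding hcomp_def by blast+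

lemma hcomp_closed: "x \<in> carrier A \<Longrightarrow> hcomp x i \<in> carrier A"
  using hcomp_props(1) gr_carrier by blast

text \<open>\<open>N\<close> may exceed the support of \<open>c\<close>. This matters for sums and
  scalar multiples, whose components can cancel, so that only a bound on the support is at
  hand.\<close>

lemma hcomp_unique:
  assumes c: "\<And>i. c i \<in> gr i" and N: "finite N" "\<And>i. i \<notin> N \<Longrightarrow> c i = \<zero>\<^bsub>A\<^esub>"
    and sum: "(\<Oplus>\<^bsub>A\<^esub>i\<in>N. c i) = x"
  shows "hcomp x = c"
proof -
  have x: "x \<in> carrier A"
    unfolding sum[symmetric] using c gr_carrier by (intro M.finsum_closed) auto
  have sub: "{i. c i \<noteq> \<zero>\<^bsub>A\<^esub>} \<subseteq> N" using N by auto
  have "(\<Oplus>\<^bsub>A\<^esub>i\<in>{i. c i \<noteq> \<zero>\<^bsub>A\<^esub>}. c i) = x"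
    unfolding sum[symmetric] using N sub gr_carrier[OF c]
    by (intro M.add.finprod_mono_neutral_cong_left) auto
  then show ?thesis
    unfolding hcomp_def using finite_subset[OF sub N(1)] c
    by (intro the1_equality gr_direct_sum x) auto
qed

lemma hcomp_sum:
  assumes "x \<in> carrier A" "finite N" "{i. hcomp x i \<noteq> \<zero>\<^bsub>A\<^esub>} \<subseteq> N"
  shows "(\<Oplus>\<^bsub>A\<^esub>i\<in>N. hcomp x i) = x"
  using hcomp_props[OF assms(1)] assms hcomp_closed
  by (subst (2) hcomp_props(3)[OF assms(1), symmetric],
      intro M.add.finprod_mono_neutral_cong_right) auto

lemma hcomp_add:
  assumes "x \<in> carrier A" "y \<in> carrier A"
  shows "hcomp (x \<oplus>\<^bsub>A\<^esub> y) = (\<lambda>i. hcomp x i \<oplus>\<^bsub>A\<^esub> hcomp y i)"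
proof (rule hcomp_unique)
  let ?N = "{i. hcomp x i \<noteq> \<zero>\<^bsub>A\<^esub>} \<union> {i. hcomp y i \<noteq> \<zero>\<^bsub>A\<^esub>}"
  show fin: "finite ?N" using assms hcomp_props(2) by simp
  show "(\<Oplus>\<^bsub>A\<^esub>i\<in>?N. hcomp x i \<oplus>\<^bsub>A\<^esub> hcomp y i) = x \<oplus>\<^bsub>A\<^esub> y"
    using assms hcomp_closed
    by (subst M.finsum_addf) (auto simp: hcomp_sum[OF assms(1) fin] hcomp_sum[OF assms(2) fin])
qed (use assms hcomp_props(1) gr_add in auto)

lemma hcomp_smult:
  assumes "r \<in> carrier R" "x \<in> carrier A"
  shows "hcomp (r \<odot>\<^bsub>A\<^esub> x) = (\<lambda>i. r \<odot>\<^bsub>A\<^esub> hcomp x i)"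
proof (rule hcomp_unique)
  let ?N = "{i. hcomp x i \<noteq> \<zero>\<^bsub>A\<^esub>}"
  show fin: "finite ?N" using assms hcomp_props(2) by simp
  show "(\<Oplus>\<^bsub>A\<^esub>i\<in>?N. r \<odot>\<^bsub>A\<^esub> hcomp x i) = r \<odot>\<^bsub>A\<^esub> x"
    using assms hcomp_closed
    by (subst finsum_smult_ldistr[symmetric]) (auto simp: fin hcomp_sum[OF assms(2) fin])
qed (use assms hcomp_props(1) gr_smult in auto)

lemma hcomp_homogeneous:
  assumes "x \<in> gr i"
  shows "hcomp x = (\<lambda>j. if j = i then x else \<zero>\<^bsub>A\<^esub>)"
  by (rule hcomp_unique[where N = "{i}"])
    (use assms gr_zero gr_carrier in \<open>auto simp: M.finsum_insert\<close>)

lemma hcomp_zero: "hcomp \<zero>\<^bsub>A\<^esub> = (\<lambda>i. \<zero>\<^bsub>A\<^esub>)"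
  using hcomp_homogeneous[OF gr_zero] by (auto simp: fun_eq_iff)

text \<open>The set \<open>Z\<close> carries a property of the components through the induction. For
  a graded subset it gives induction on the homogeneous elements of that subset, and for
  \<open>UNIV\<close> ordinary induction on homogeneous elements.\<close>

lemma homogeneous_induct [consumes 1, case_names homogeneous add zero]:
  assumes x: "x \<in> carrier A" "\<And>i. hcomp x i \<in> Z"
    and hom: "\<And>i x. \<lbrakk>x \<in> gr i; x \<in> Z\<rbrakk> \<Longrightarrow> P x"
    and add: "\<And>x y. \<lbrakk>x \<in> carrier A; y \<in> carrier A; P x; P y\<rbrakk> \<Longrightarrow> P (x \<oplus>\<^bsub>A\<^esub> y)"
    and zero: "P \<zero>\<^bsub>A\<^esub>"
  shows "P x"
proof -
  have "P (\<Oplus>\<^bsub>A\<^esub>i\<in>{i. hcomp x i \<noteq> \<zero>\<^bsub>A\<^esub>}. hcomp x i)"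
    by (rule M.finsum_induct)
      (use add zero hcomp_closed[OF x(1)] hom[OF hcomp_props(1)[OF x(1)] x(2)] in auto)
  then show ?thesis using hcomp_props(3)[OF x(1)] by simp
qed

lemma carrier_induct [consumes 1, case_names homogeneous add]:
  assumes "x \<in> carrier A" "\<And>i x. x \<in> gr i \<Longrightarrow> P x"
    and "\<And>x y. \<lbrakk>x \<in> carrier A; y \<in> carrier A; P x; P y\<rbrakk> \<Longrightarrow> P (x \<oplus>\<^bsub>A\<^esub> y)"
  shows "P x"
  by (rule homogeneous_induct[where Z = UNIV]) (use assms gr_zero in auto)

end


section \<open>The tensor product with a residue ring\<close>

text \<open>The submodule \<open>I M\<close>. Zero and negatives are already of the form
  \<open>a \<odot> x\<close> or sums of such, so closure under addition gives the whole
  submodule.\<close>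

inductive_set ideal_smult ::
    "('a, 'm) ring_scheme \<Rightarrow> 'a set \<Rightarrow> ('a, 'b, 'n) module_scheme \<Rightarrow> 'b set"
  for R I M where
    smult: "\<lbrakk>a \<in> I; x \<in> carrier M\<rbrakk> \<Longrightarrow> a \<odot>\<^bsub>M\<^esub> x \<in> ideal_smult R I M"
  | add: "\<lbrakk>x \<in> ideal_smult R I M; y \<in> ideal_smult R I M\<rbrakk> \<Longrightarrow> x \<oplus>\<^bsub>M\<^esub> y \<in> ideal_smult R I M"

locale residue_tensor = P: assoc_algebra R P + I: ideal I R
  for R :: "('a, 'm) ring_scheme" (structure) and P :: "('a, 'b, 'n) module_scheme" (structure)
    and I :: "'a set"
begin

abbreviation "IP \<equiv> ideal_smult R I P"
abbreviation "S \<equiv> R Quot I"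
abbreviation "S' \<equiv> residue_algebra R I"
abbreviation "K \<equiv> monoid_algebra R (P \<times>\<times> S')"
abbreviation "J \<equiv> tensor_ideal R P S'"
abbreviation "TR \<equiv> tensor_algebra R P S'"
abbreviation "t \<equiv> pure_tensor R P S'"
abbreviation "T \<equiv> base_change R P S'"

text \<open>Scalars move across the tensor sign, so \<open>x \<otimes> (r + I)\<close> is
  \<open>iota\<close> of \<open>r x\<close>. Thus \<open>iota\<close> is onto, and with kernel
  \<open>IP\<close> it identifies \<open>P/IP\<close> with \<open>T\<close>.\<close>

definition "iota x = t x \<one>\<^bsub>S'\<^esub>"

lemma IP_closed: "x \<in> IP \<Longrightarrow> x \<in> carrier P"
  by (induction rule: ideal_smult.induct) (use I.Icarr in auto)

lemma IP_zero: "\<zero>\<^bsub>P\<^esub> \<in> IP"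
  using ideal_smult.smult[of "\<zero>\<^bsub>R\<^esub>" I "\<zero>\<^bsub>P\<^esub>" P R] by simp

lemma IP_inv: "x \<in> IP \<Longrightarrow> \<ominus>\<^bsub>P\<^esub> x \<in> IP"
proof (induction rule: ideal_smult.induct)
  case (smult a x)
  then have "\<ominus>\<^bsub>P\<^esub> (a \<odot>\<^bsub>P\<^esub> x) = a \<odot>\<^bsub>P\<^esub> (\<ominus>\<^bsub>P\<^esub> x)"
    using I.Icarr P.smult_r_minus by simp
  then show ?case using smult ideal_smult.smult[of a I "\<ominus>\<^bsub>P\<^esub> x" P R] by simp
next
  case (add x y)
  then show ?case by (simp add: P.minus_add IP_closed ideal_smult.add)
qed

lemma IP_mult:
  assumes "x \<in> IP" "y \<in> carrier P"
  shows "x \<otimes>\<^bsub>P\<^esub> y \<in> IP" "y \<otimes>\<^bsub>P\<^esub> x \<in> IP"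
proof -
  have "x \<otimes>\<^bsub>P\<^esub> y \<in> IP \<and> y \<otimes>\<^bsub>P\<^esub> x \<in> IP"
    using assms(1)
  proof (induction rule: ideal_smult.induct)
    case (smult a x)
    then show ?case using assms(2) I.Icarr
      by (simp add: P.smult_mult_left P.smult_mult_right ideal_smult.smult)
  next
    case (add x x')
    then show ?case using assms(2)
      by (simp add: IP_closed P.l_distr P.r_distr ideal_smult.add)
  qed
  then show "x \<otimes>\<^bsub>P\<^esub> y \<in> IP" "y \<otimes>\<^bsub>P\<^esub> x \<in> IP" by auto
qed

sublocale IP: algebra_ideal R P IP
proof (intro algebra_ideal.intro P.assoc_algebra_axioms idealI)
  show "subgroup IP (add_monoid P)"
    by (rule P.M.add.subgroupI)
      (use IP_zero IP_closed IP_inv ideal_smult.add in \<open>auto simp: a_inv_def[symmetric]\<close>)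
qed (use IP_mult P.ring_axioms in auto)


section \<open>The residue ring and pure tensors\<close>

lemma S_cring: "cring S"
  by (rule I.quotient_is_cring) (rule P.R.is_cring)

sublocale S: cring S
  by (rule S_cring)

lemma S_carrier: "carrier S = (\<lambda>r. I +> r) ` carrier R"
  by (auto simp: FactRing_def A_RCOSETS_def' a_r_coset_def')

lemmas rcos_hom = I.rcos_ring_hom

lemma rcos_closed: "r \<in> carrier R \<Longrightarrow> I +> r \<in> carrier S"
  by (simp add: S_carrier)

lemma rcos_mult: "\<lbrakk>r \<in> carrier R; s \<in> carrier R\<rbrakk> \<Longrightarrow> (I +> r) \<otimes>\<^bsub>S\<^esub> (I +> s) = I +> (r \<otimes> s)"
  using ring_hom_mult[OF rcos_hom] by simp

lemma rcos_eq_iff: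
  "\<lbrakk>r \<in> carrier R; s \<in> carrier R\<rbrakk> \<Longrightarrow> I +> r = I +> s \<longleftrightarrow> r \<ominus> s \<in> I"
  using I.a_rcos_module_minus[OF P.R.ring_axioms, of s r] I.a_rcos_self[of r]
    I.a_repr_independence'[of r s] by auto

lemma S'_simps:
  "carrier S' = carrier S" "(\<otimes>\<^bsub>S'\<^esub>) = (\<otimes>\<^bsub>S\<^esub>)" "\<one>\<^bsub>S'\<^esub> = I +> \<one>" "(\<oplus>\<^bsub>S'\<^esub>) = (\<oplus>\<^bsub>S\<^esub>)"
  "r \<odot>\<^bsub>S'\<^esub> s = (I +> r) \<otimes>\<^bsub>S\<^esub> s"
  by (simp_all add: residue_algebra_def with_smult_def) (simp add: FactRing_def)

lemma S_one: "\<one>\<^bsub>S\<^esub> = I +> \<one>"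
  by (simp add: FactRing_def)

sublocale KA: monoid_alg R "P \<times>\<times> S'"
proof (intro monoid_alg.intro P.R.is_cring DirProd_monoid P.monoid_axioms)
  show "monoid S'"
    by (rule monoidI) (auto simp: S'_simps S_one[symmetric] S.m_assoc)
qed

abbreviation "gens \<equiv>
  {single R (a \<oplus>\<^bsub>P\<^esub> a', b) \<one> \<ominus>\<^bsub>K\<^esub> (single R (a, b) \<one> \<oplus>\<^bsub>K\<^esub> single R (a', b) \<one>) | a a' b.
     a \<in> carrier P \<and> a' \<in> carrier P \<and> b \<in> carrier S'} \<union>
  {single R (a, b \<oplus>\<^bsub>S'\<^esub> b') \<one> \<ominus>\<^bsub>K\<^esub> (single R (a, b) \<one> \<oplus>\<^bsub>K\<^esub> single R (a, b') \<one>) | a b b'.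
     a \<in> carrier P \<and> b \<in> carrier S' \<and> b' \<in> carrier S'} \<union>
  {single R (r \<odot>\<^bsub>P\<^esub> a, b) \<one> \<ominus>\<^bsub>K\<^esub> (r \<odot>\<^bsub>K\<^esub> single R (a, b) \<one>) | r a b.
     r \<in> carrier R \<and> a \<in> carrier P \<and> b \<in> carrier S'} \<union>
  {single R (a, r \<odot>\<^bsub>S'\<^esub> b) \<one> \<ominus>\<^bsub>K\<^esub> (r \<odot>\<^bsub>K\<^esub> single R (a, b) \<one>) | r a b.
     r \<in> carrier R \<and> a \<in> carrier P \<and> b \<in> carrier S'}"

lemma J_eq: "J = genideal K gens"
  by (simp add: tensor_ideal_def pair_algebra_def Let_def)

lemma S'_smult_closed: "\<lbrakk>r \<in> carrier R; s \<in> carrier S\<rbrakk> \<Longrightarrow> r \<odot>\<^bsub>S'\<^esub> s \<in> carrier S"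
  by (simp add: S'_simps rcos_closed)

lemma single_closed: "\<lbrakk>x \<in> carrier P; s \<in> carrier S; r \<in> carrier R\<rbrakk> \<Longrightarrow> single R (x, s) r \<in> carrier K"
  by (intro KA.K_single_closed) (auto simp: S'_simps)

lemma gens_closed: "gens \<subseteq> carrier K"
  by (auto simp: S'_simps(1,4) S'_smult_closed
      intro!: KA.K.minus_closed KA.K.a_closed KA.K.smult_closed single_closed)

lemma gens_in_J: "g \<in> gens \<Longrightarrow> g \<in> J"
  using KA.K.genideal_self[OF gens_closed] J_eq by blast

sublocale J: algebra_ideal R K J
  unfolding J_eq
  by (intro algebra_ideal.intro KA.K.assoc_algebra_axioms KA.K.genideal_ideal gens_closed)

lemma TR_eq: "TR = quot_algebra K J"
  by (simp add: tensor_algebra_def pair_algebra_def)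

sublocale TR: assoc_algebra R "TR"
  unfolding TR_eq by (rule J.quot_assoc_algebra)

lemma t_eq: "t x s = J +>\<^bsub>K\<^esub> single R (x, s) \<one>"
  by (simp add: pure_tensor_def pair_algebra_def)

lemma coset_closed: "f \<in> carrier K \<Longrightarrow> J +>\<^bsub>K\<^esub> f \<in> carrier TR"
  by (simp add: TR_eq J.quot_carrier)

lemma t_closed: "\<lbrakk>x \<in> carrier P; s \<in> carrier S\<rbrakk> \<Longrightarrow> t x s \<in> carrier TR"
  by (simp add: t_eq coset_closed single_closed)

lemma t_add:
  assumes "x \<in> carrier P" "y \<in> carrier P" "s \<in> carrier S"
  shows "t (x \<oplus>\<^bsub>P\<^esub> y) s = t x s \<oplus>\<^bsub>TR\<^esub> t y s"
proof -
  have "single R (x \<oplus>\<^bsub>P\<^esub> y, s) \<one> \<ominus>\<^bsub>K\<^esub> (single R (x, s) \<one> \<oplus>\<^bsub>K\<^esub> single R (y, s) \<one>) \<in> J"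
    by (rule gens_in_J) (use assms S'_simps(1) in blast)
  then show ?thesis
    using assms single_closed by (simp add: t_eq TR_eq J.quot_add[symmetric] J.quot_eq_iff)
qed

lemma t_smult:
  assumes "r \<in> carrier R" "x \<in> carrier P" "s \<in> carrier S"
  shows "t (r \<odot>\<^bsub>P\<^esub> x) s = r \<odot>\<^bsub>TR\<^esub> t x s" "t x (r \<odot>\<^bsub>S'\<^esub> s) = r \<odot>\<^bsub>TR\<^esub> t x s"
proof -
  have "single R (r \<odot>\<^bsub>P\<^esub> x, s) \<one> \<ominus>\<^bsub>K\<^esub> (r \<odot>\<^bsub>K\<^esub> single R (x, s) \<one>) \<in> J"
    by (rule gens_in_J) (use assms S'_simps(1) in blast)
  then show "t (r \<odot>\<^bsub>P\<^esub> x) s = r \<odot>\<^bsub>TR\<^esub> t x s"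
    using assms single_closed by (simp add: t_eq TR_eq J.quot_smult[symmetric] J.quot_eq_iff)
  have "single R (x, r \<odot>\<^bsub>S'\<^esub> s) \<one> \<ominus>\<^bsub>K\<^esub> (r \<odot>\<^bsub>K\<^esub> single R (x, s) \<one>) \<in> J"
    by (rule gens_in_J) (use assms S'_simps(1) in blast)
  then show "t x (r \<odot>\<^bsub>S'\<^esub> s) = r \<odot>\<^bsub>TR\<^esub> t x s"
    using assms single_closed S'_smult_closed
    by (simp add: t_eq TR_eq J.quot_smult[symmetric] J.quot_eq_iff)
qed

lemma t_mult:
  assumes "x \<in> carrier P" "y \<in> carrier P" "s \<in> carrier S" "s' \<in> carrier S"
  shows "t (x \<otimes>\<^bsub>P\<^esub> y) (s \<otimes>\<^bsub>S\<^esub> s') = t x s \<otimes>\<^bsub>TR\<^esub> t y s'"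
proof -
  have "single R (x \<otimes>\<^bsub>P\<^esub> y, s \<otimes>\<^bsub>S\<^esub> s') \<one> = single R (x, s) \<one> \<otimes>\<^bsub>K\<^esub> single R (y, s') \<one>"
    using KA.K_mult_single[of "(x, s)" "(y, s')" \<one> \<one>] assms by (simp add: S'_simps)
  then show ?thesis
    using assms single_closed by (simp add: t_eq TR_eq J.quot_mult)
qed

lemma t_rcos:
  assumes "x \<in> carrier P" "r \<in> carrier R"
  shows "t x (I +> r) = iota (r \<odot>\<^bsub>P\<^esub> x)"
proof -
  have "I +> r = r \<odot>\<^bsub>S'\<^esub> (I +> \<one>)"
    using assms by (simp add: S'_simps rcos_mult)
  then show ?thesis
    using assms t_smult[of r x "I +> \<one>"] rcos_closed[of \<one>] by (simp add: iota_def S'_simps(3))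
qed

lemma coset_single:
  assumes "x \<in> carrier P" "r \<in> carrier R" "a \<in> carrier R"
  shows "J +>\<^bsub>K\<^esub> single R (x, I +> r) a = iota (a \<odot>\<^bsub>P\<^esub> (r \<odot>\<^bsub>P\<^esub> x))"
proof -
  have "single R (x, I +> r) a = a \<odot>\<^bsub>K\<^esub> single R (x, I +> r) \<one>"
    using assms by (simp add: KA.K_smult_single)
  then have "J +>\<^bsub>K\<^esub> single R (x, I +> r) a = a \<odot>\<^bsub>TR\<^esub> t x (I +> r)"
    using assms single_closed rcos_closed by (simp add: t_eq TR_eq J.quot_smult)
  also have "\<dots> = a \<odot>\<^bsub>TR\<^esub> iota (r \<odot>\<^bsub>P\<^esub> x)"
    using assms by (simp add: t_rcos)
  also have "\<dots> = iota (a \<odot>\<^bsub>P\<^esub> (r \<odot>\<^bsub>P\<^esub> x))"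
    using assms t_smult(1)[of a "r \<odot>\<^bsub>P\<^esub> x" "I +> \<one>"] rcos_closed[of \<one>]
    by (simp add: iota_def S'_simps(3))
  finally show ?thesis .
qed

lemma T_simps:
  "carrier T = carrier TR" "(\<otimes>\<^bsub>T\<^esub>) = (\<otimes>\<^bsub>TR\<^esub>)" "\<one>\<^bsub>T\<^esub> = \<one>\<^bsub>TR\<^esub>" "(\<oplus>\<^bsub>T\<^esub>) = (\<oplus>\<^bsub>TR\<^esub>)" "\<zero>\<^bsub>T\<^esub> = \<zero>\<^bsub>TR\<^esub>"
  "s \<odot>\<^bsub>T\<^esub> Y = t \<one>\<^bsub>P\<^esub> s \<otimes>\<^bsub>TR\<^esub> Y"
  by (simp_all add: base_change_def with_smult_def)

section \<open>The surjection from the resolution onto its base change\<close>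

lemma iota_closed: "x \<in> carrier P \<Longrightarrow> iota x \<in> carrier T"
  using rcos_closed[of \<one>] by (simp add: iota_def t_closed T_simps S'_simps(3))

lemma iota_add:
  "\<lbrakk>x \<in> carrier P; y \<in> carrier P\<rbrakk> \<Longrightarrow> iota (x \<oplus>\<^bsub>P\<^esub> y) = iota x \<oplus>\<^bsub>T\<^esub> iota y"
  using rcos_closed[of \<one>] by (simp add: iota_def t_add T_simps S'_simps(3))

lemma iota_mult:
  "\<lbrakk>x \<in> carrier P; y \<in> carrier P\<rbrakk> \<Longrightarrow> iota (x \<otimes>\<^bsub>P\<^esub> y) = iota x \<otimes>\<^bsub>T\<^esub> iota y"
  using t_mult[of x y "I +> \<one>" "I +> \<one>"] rcos_closed[of \<one>] rcos_mult[of \<one> \<one>]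
  by (simp add: iota_def T_simps S'_simps(3))

lemma iota_smult:
  assumes "r \<in> carrier R" "x \<in> carrier P"
  shows "iota (r \<odot>\<^bsub>P\<^esub> x) = (I +> r) \<odot>\<^bsub>T\<^esub> iota x"
proof -
  have "t \<one>\<^bsub>P\<^esub> (I +> r) \<otimes>\<^bsub>TR\<^esub> iota x = t x (I +> r)"
    using assms t_mult[of "\<one>\<^bsub>P\<^esub>" x "I +> r" "I +> \<one>"] rcos_closed rcos_mult[of r \<one>]
    by (simp add: iota_def S'_simps(3))
  then show ?thesis
    using assms by (simp add: T_simps t_rcos)
qed

lemma iota_one: "iota \<one>\<^bsub>P\<^esub> = \<one>\<^bsub>T\<^esub>"
proof -
  have "\<one>\<^bsub>K\<^esub> = single R (\<one>\<^bsub>P\<^esub>, I +> \<one>) \<one>"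
    by (simp add: KA.K_simps S'_simps)
  then show ?thesis
    by (simp add: iota_def t_eq T_simps S'_simps(3) TR_eq J.quot_one[symmetric])
qed

lemma iota_zero: "iota \<zero>\<^bsub>P\<^esub> = \<zero>\<^bsub>T\<^esub>"
  using iota_smult[of \<zero> "\<zero>\<^bsub>P\<^esub>"] iota_add[of "\<zero>\<^bsub>P\<^esub>" "\<zero>\<^bsub>P\<^esub>"] iota_closed[of "\<zero>\<^bsub>P\<^esub>"]
  by (simp add: T_simps)

text \<open>One induction serves two purposes: with \<open>Y\<close> all of \<open>P\<close> it
  gives surjectivity of \<open>iota\<close>, and with \<open>Y\<close> a graded piece it identifies
  the grading of the tensor product.\<close>

lemma coset_eq_iota:
  assumes f: "f \<in> fin_supp R (Y \<times> carrier S)" and Y: "Y \<subseteq> carrier P" "\<zero>\<^bsub>P\<^esub> \<in> Y"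
    "\<And>x y. \<lbrakk>x \<in> Y; y \<in> Y\<rbrakk> \<Longrightarrow> x \<oplus>\<^bsub>P\<^esub> y \<in> Y" "\<And>r x. \<lbrakk>r \<in> carrier R; x \<in> Y\<rbrakk> \<Longrightarrow> r \<odot>\<^bsub>P\<^esub> x \<in> Y"
  shows "J +>\<^bsub>K\<^esub> f \<in> iota ` Y"
proof -
  have sub: "fin_supp R (Y \<times> carrier S) \<subseteq> carrier K"
  proof
    fix f assume f: "f \<in> fin_supp R (Y \<times> carrier S)"
    have "f \<in> fin_supp R (carrier P \<times> carrier S)"
      by (rule P.R.fin_suppI[of f "{w. f w \<noteq> \<zero>}"])
        (use fin_supp_subset[OF f] Y(1) f in \<open>auto simp: P.R.fin_supp_closed fin_supp_finite\<close>)
    then show "f \<in> carrier K" by (simp add: KA.K_simps S'_simps)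
  qed
  from f show ?thesis
  proof (induction rule: P.R.fin_supp_induct)
    case zero
    have "J +>\<^bsub>K\<^esub> (\<lambda>_. \<zero>) = iota \<zero>\<^bsub>P\<^esub>"
      by (simp add: iota_zero T_simps TR_eq J.quot_zero[symmetric] KA.K_simps)
    then show ?case using Y by simp
  next
    case (single y a)
    then obtain x r where "y = (x, I +> r)" "x \<in> Y" "r \<in> carrier R"
      by (auto simp: S_carrier)
    then show ?case using single Y coset_single[of x r a] by auto
  next
    case (add f g)
    then obtain x y where xy: "J +>\<^bsub>K\<^esub> f = iota x" "J +>\<^bsub>K\<^esub> g = iota y" "x \<in> Y" "y \<in> Y"
      by auto
    moreover have "f \<in> carrier K" "g \<in> carrier K" "x \<in> carrier P" "y \<in> carrier P"
      using add sub Y(1) xy by blast+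
    ultimately have "J +>\<^bsub>K\<^esub> (\<lambda>x. f x \<oplus> g x) = iota (x \<oplus>\<^bsub>P\<^esub> y)"
      using J.quot_add[of f g] iota_add[of x y] by (simp add: KA.K_simps(4) T_simps TR_eq)
    then show ?case using xy Y by simp
  qed
qed

lemma iota_surj: "iota ` carrier P = carrier T"
proof
  show "carrier T \<subseteq> iota ` carrier P"
    using coset_eq_iota[of _ "carrier P"]
    by (auto simp: T_simps TR_eq J.quot_carrier KA.K_simps S'_simps)
qed (use iota_closed in auto)

lemma T_assoc_algebra: "assoc_algebra S T"
  by (rule assoc_algebra_image[OF P.assoc_algebra_axioms S_cring rcos_hom _ iota_surj])
    (simp_all add: S_carrier iota_add iota_zero iota_smult iota_mult iota_one)

sublocale T: assoc_algebra S T
  by (rule T_assoc_algebra)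

sublocale iota: ring_hom_ring P T iota
  by (rule ring_hom_ringI2)
    (auto simp: P.ring_axioms T.ring_axioms iota_closed iota_add iota_mult iota_one
      intro!: ring_hom_memI)

lemma iota_IP: "x \<in> IP \<Longrightarrow> iota x = \<zero>\<^bsub>T\<^esub>"
proof (induction rule: ideal_smult.induct)
  case (smult a x)
  then have "I +> a = I +> \<zero>"
    using rcos_eq_iff[of a \<zero>] by (simp add: I.Icarr a_minus_def)
  then show ?case
    using smult I.Icarr t_rcos[of x a] t_rcos[of x \<zero>] by (simp add: iota_zero)
next
  case (add x y)
  then show ?case by (simp add: IP_closed)
qed

text \<open>This makes \<open>(x, r + I) \<mapsto> r x + IP\<close> independent of the choice of
  \<open>r\<close>.\<close>

lemma IP_coset_eq:
  assumes "r \<in> carrier R" "s \<in> carrier R" "I +> r = I +> s" "x \<in> carrier P"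
  shows "IP +>\<^bsub>P\<^esub> (r \<odot>\<^bsub>P\<^esub> x) = IP +>\<^bsub>P\<^esub> (s \<odot>\<^bsub>P\<^esub> x)"
proof -
  have "(r \<ominus> s) \<odot>\<^bsub>P\<^esub> x \<in> IP"
    using assms by (intro ideal_smult.smult) (simp_all add: rcos_eq_iff)
  then show ?thesis
    using assms
    by (simp add: IP.quot_eq_iff a_minus_def P.smult_l_distr P.smult_l_minus)
qed

text \<open>The linear map \<open>P \<otimes> R/I \<rightarrow> P/IP\<close> shows that \<open>iota\<close> kills nothing but \<open>IP\<close>.\<close>

lemma iota_eq_zero_imp:
  assumes x: "x \<in> carrier P" "iota x = \<zero>\<^bsub>T\<^esub>"
  shows "x \<in> IP"
proof -
  let ?Q = "quot_algebra P IP"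
  interpret Q: assoc_algebra R ?Q by (rule IP.quot_assoc_algebra)
  \<comment> \<open>A bilinear map that is also multiplicative. Its linear extension is therefore a
    ring homomorphism, and since \<open>J\<close> is generated as a ring ideal, it suffices that
    this extension kills the bilinearity relations.\<close>
  define m where "m = (\<lambda>(x, s). IP +>\<^bsub>P\<^esub> ((SOME r. r \<in> carrier R \<and> s = I +> r) \<odot>\<^bsub>P\<^esub> x))"
  have m: "m (x, I +> r) = IP +>\<^bsub>P\<^esub> (r \<odot>\<^bsub>P\<^esub> x)" if "x \<in> carrier P" "r \<in> carrier R" for x r
  proof -
    let ?r = "SOME r'. r' \<in> carrier R \<and> I +> r = I +> r'"
    have "?r \<in> carrier R \<and> I +> r = I +> ?r"
      by (rule someI[of _ r]) (use that in simp)
    then show ?thesis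
      unfolding m_def using that IP_coset_eq[of r ?r x] by simp
  qed
  have q: "IP +>\<^bsub>P\<^esub> y \<in> carrier ?Q" if "y \<in> carrier P" for y
    using that by (simp add: IP.quot_carrier)
  have m_closed: "m \<in> carrier (P \<times>\<times> S') \<rightarrow> carrier ?Q"
    by (auto simp: S'_simps S_carrier m q)
  let ?H = "lin_ext R ?Q m"
  have H: "?H \<in> ring_hom K ?Q"
  proof (rule KA.lin_ext_ring_hom[OF IP.quot_assoc_algebra m_closed])
    show "m \<one>\<^bsub>P \<times>\<times> S'\<^esub> = \<one>\<^bsub>?Q\<^esub>"
      using m[of "\<one>\<^bsub>P\<^esub>" \<one>] by (simp add: S'_simps IP.quot_one)
    show "m (y \<otimes>\<^bsub>P \<times>\<times> S'\<^esub> z) = m y \<otimes>\<^bsub>?Q\<^esub> m z"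
      if yz: "y \<in> carrier (P \<times>\<times> S')" "z \<in> carrier (P \<times>\<times> S')" for y z
    proof -
      obtain x r x' r' where yz: "y = (x, I +> r)" "z = (x', I +> r')"
          "x \<in> carrier P" "r \<in> carrier R" "x' \<in> carrier P" "r' \<in> carrier R"
        using yz by (cases y; cases z) (auto simp: S'_simps S_carrier)
      have "(r \<otimes> r') \<odot>\<^bsub>P\<^esub> (x \<otimes>\<^bsub>P\<^esub> x') = (r \<odot>\<^bsub>P\<^esub> x) \<otimes>\<^bsub>P\<^esub> (r' \<odot>\<^bsub>P\<^esub> x')"
        using yz
        by (simp add: P.smult_mult_left P.smult_mult_right P.smult_assoc1[symmetric] P.R.m_comm)
      then show ?thesis
        using yz by (simp add: S'_simps rcos_mult m IP.quot_mult[symmetric])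
    qed
  qed
  interpret H: ring_hom_ring K ?Q ?H
    by (rule ring_hom_ringI2) (use H KA.K.ring_axioms Q.ring_axioms in auto)
  have H_smult: "?H (s \<odot>\<^bsub>K\<^esub> f) = s \<odot>\<^bsub>?Q\<^esub> ?H f" if "s \<in> carrier R" "f \<in> carrier K" for s f
    using that Q.lin_ext_smult[OF m_closed] by (simp add: KA.K_simps)
  have H_single: "?H (single R (x, I +> r) \<one>) = IP +>\<^bsub>P\<^esub> (r \<odot>\<^bsub>P\<^esub> x)"
    if "x \<in> carrier P" "r \<in> carrier R" for x r
    using that Q.lin_ext_single[OF m_closed, of "(x, I +> r)" \<one>] m q
    by (simp add: S'_simps rcos_closed)
  have "?H g = \<zero>\<^bsub>?Q\<^esub>" if "g \<in> gens" for g
    using that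
  proof (elim UnE CollectE exE conjE)
    fix a a' b
    assume g: "g = single R (a \<oplus>\<^bsub>P\<^esub> a', b) \<one> \<ominus>\<^bsub>K\<^esub> (single R (a, b) \<one> \<oplus>\<^bsub>K\<^esub> single R (a', b) \<one>)"
      and ab: "a \<in> carrier P" "a' \<in> carrier P" "b \<in> carrier S'"
    then obtain r where r: "b = I +> r" "r \<in> carrier R"
      by (auto simp: S'_simps S_carrier)
    show ?thesis
      using g ab r single_closed rcos_closed q
      by (simp add: a_minus_def H_single P.smult_r_distr IP.quot_add[symmetric] Q.r_neg)
  next
    fix a b b'
    assume g: "g = single R (a, b \<oplus>\<^bsub>S'\<^esub> b') \<one> \<ominus>\<^bsub>K\<^esub> (single R (a, b) \<one> \<oplus>\<^bsub>K\<^esub> single R (a, b') \<one>)"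
      and ab: "a \<in> carrier P" "b \<in> carrier S'" "b' \<in> carrier S'"
    then obtain r r' where r: "b = I +> r" "r \<in> carrier R" "b' = I +> r'" "r' \<in> carrier R"
      by (auto simp: S'_simps S_carrier)
    then have "b \<oplus>\<^bsub>S'\<^esub> b' = I +> (r \<oplus> r')"
      using ring_hom_add[OF rcos_hom, of r r'] by (simp add: S'_simps(4))
    then show ?thesis
      using g ab r single_closed rcos_closed q
      by (simp add: a_minus_def H_single P.smult_l_distr IP.quot_add[symmetric] Q.r_neg)
  next
    fix s a b
    assume g: "g = single R (s \<odot>\<^bsub>P\<^esub> a, b) \<one> \<ominus>\<^bsub>K\<^esub> (s \<odot>\<^bsub>K\<^esub> single R (a, b) \<one>)"
      and ab: "s \<in> carrier R" "a \<in> carrier P" "b \<in> carrier S'"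
    then obtain r where r: "b = I +> r" "r \<in> carrier R"
      by (auto simp: S'_simps S_carrier)
    have "r \<odot>\<^bsub>P\<^esub> (s \<odot>\<^bsub>P\<^esub> a) = s \<odot>\<^bsub>P\<^esub> (r \<odot>\<^bsub>P\<^esub> a)"
      using ab r by (simp add: P.smult_assoc1[symmetric] P.R.m_comm)
    then show ?thesis
      using g ab r single_closed rcos_closed q
      by (simp add: a_minus_def H_single H_smult IP.quot_smult[symmetric] Q.r_neg)
  next
    fix s a b
    assume g: "g = single R (a, s \<odot>\<^bsub>S'\<^esub> b) \<one> \<ominus>\<^bsub>K\<^esub> (s \<odot>\<^bsub>K\<^esub> single R (a, b) \<one>)"
      and ab: "s \<in> carrier R" "a \<in> carrier P" "b \<in> carrier S'"
    then obtain r where r: "b = I +> r" "r \<in> carrier R"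
      by (auto simp: S'_simps S_carrier)
    then have "s \<odot>\<^bsub>S'\<^esub> b = I +> (s \<otimes> r)"
      using ab by (simp add: S'_simps rcos_mult)
    then show ?thesis
      using g ab r single_closed rcos_closed q
      by (simp add: a_minus_def H_single H_smult IP.quot_smult[symmetric] Q.r_neg P.smult_assoc1)
  qed
  then have "?H f = \<zero>\<^bsub>?Q\<^esub>" if "f \<in> J" for f
    using that KA.K.genideal_subset_kernel[OF Q.ring_axioms H gens_closed]
    unfolding J_eq by blast
  moreover have "single R (x, I +> \<one>) \<one> \<in> J"
    using x single_closed[of x "I +> \<one>" \<one>] rcos_closed[of \<one>]
    by (simp add: iota_def t_eq S'_simps(3) T_simps TR_eq J.quot_eq_zero_iff)
  ultimately have "IP +>\<^bsub>P\<^esub> (\<one> \<odot>\<^bsub>P\<^esub> x) = \<zero>\<^bsub>?Q\<^esub>"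
    using H_single[of x \<one>] x by simp
  then show ?thesis using x by (simp add: IP.quot_eq_zero_iff)
qed

lemma iota_eq_zero_iff: "x \<in> carrier P \<Longrightarrow> iota x = \<zero>\<^bsub>T\<^esub> \<longleftrightarrow> x \<in> IP"
  using iota_IP iota_eq_zero_imp by blast

lemma base_change_gr_eq:
  assumes "submodule (gr i) R P"
  shows "base_change_gr R P S' gr i = iota ` gr i"
proof -
  note E = P.submoduleE[OF assms]
  have zero: "\<zero>\<^bsub>P\<^esub> \<in> gr i"
    using subgroup.one_closed[OF submodule.axioms(1)[OF assms]] by simp
  show ?thesis
  proof
    show "base_change_gr R P S' gr i \<subseteq> iota ` gr i"
    proof
      fix Y assume "Y \<in> base_change_gr R P S' gr i"
      then obtain f where Y: "Y = J +>\<^bsub>K\<^esub> f" and f: "f \<in> carrier K"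
          and fgr: "\<And>a b. f (a, b) \<noteq> \<zero> \<Longrightarrow> a \<in> gr i"
        by (auto simp: base_change_gr_def pair_algebra_def)
      have f': "f \<in> fin_supp R (carrier P \<times> carrier S)"
        using f by (simp add: KA.K_simps S'_simps)
      have "f \<in> fin_supp R (gr i \<times> carrier S)"
        by (rule P.R.fin_suppI[of f "{w. f w \<noteq> \<zero>}"])
          (use fin_supp_subset[OF f'] f' fgr in \<open>auto simp: P.R.fin_supp_closed fin_supp_finite\<close>)
      then show "Y \<in> iota ` gr i"
        unfolding Y by (rule coset_eq_iota) (use E zero in auto)
    qed
    show "iota ` gr i \<subseteq> base_change_gr R P S' gr i"
    proof
      fix Y assume "Y \<in> iota ` gr i"
      then obtain x where x: "Y = iota x" "x \<in> gr i" by blast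
      then have "Y = J +>\<^bsub>K\<^esub> single R (x, I +> \<one>) \<one>" "single R (x, I +> \<one>) \<one> \<in> carrier K"
        using E(1) rcos_closed single_closed by (auto simp: iota_def t_eq S'_simps(3))
      moreover have "a \<in> gr i" if "single R (x, I +> \<one>) \<one> (a, b) \<noteq> \<zero>" for a b
        using that x by (auto simp: single_def split: if_splits)
      ultimately show "Y \<in> base_change_gr R P S' gr i"
        unfolding base_change_gr_def pair_algebra_def by blast
    qed
  qed
qed

text \<open>The left side is a union over all representatives \<open>f\<close> of the class
  \<open>iota x\<close>, so they must all give the same coset. Each \<open>f\<close> represents some
  \<open>iota y\<close> in such a way that its differential represents \<open>iota (d y)\<close>.
  Then \<open>y\<close> and \<open>x\<close> differ by an element of \<open>IP\<close>, and
  \<open>d\<close> maps \<open>IP\<close> into itself.\<close>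

lemma base_change_diff_iota:
  assumes d: "\<And>x. x \<in> carrier P \<Longrightarrow> d x \<in> carrier P"
    and d_add: "\<And>x y. \<lbrakk>x \<in> carrier P; y \<in> carrier P\<rbrakk> \<Longrightarrow> d (x \<oplus>\<^bsub>P\<^esub> y) = d x \<oplus>\<^bsub>P\<^esub> d y"
    and d_smult: "\<And>r x. \<lbrakk>r \<in> carrier R; x \<in> carrier P\<rbrakk> \<Longrightarrow> d (r \<odot>\<^bsub>P\<^esub> x) = r \<odot>\<^bsub>P\<^esub> d x"
    and x: "x \<in> carrier P"
  shows "base_change_diff R P S' d (iota x) = iota (d x)"
proof -
  define m :: "'b \<times> 'a set \<Rightarrow> 'b \<times> 'a set \<Rightarrow> 'a"
    where "m = (\<lambda>p. single R (d (fst p), snd p) \<one>)"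
  have m: "m \<in> carrier (P \<times>\<times> S') \<rightarrow> carrier K"
    by (auto simp: m_def S'_simps intro!: single_closed d)
  let ?\<delta> = "lin_ext R K m"
  have \<delta>_eq: "(\<Oplus>\<^bsub>K\<^esub>p\<in>{p. f p \<noteq> \<zero>}. single R (d (fst p), snd p) (f p)) = ?\<delta> f"
    if "f \<in> carrier K" for f
  proof -
    have "f p \<odot>\<^bsub>K\<^esub> m p = single R (d (fst p), snd p) (f p)" for p
      using that P.R.fin_supp_closed[of f] by (simp add: m_def KA.K_smult_single KA.K_simps(1))
    then show ?thesis by (simp add: lin_ext_def)
  qed
  have \<delta>_closed: "?\<delta> f \<in> carrier K" if "f \<in> carrier K" for f
    using KA.K.lin_ext_closed[OF m] that by (simp add: KA.K_simps(1))
  have d_IP: "d u \<in> IP" if "u \<in> IP" for u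
    using that by (induction rule: ideal_smult.induct)
      (auto simp: d_smult d_add I.Icarr IP_closed d intro: ideal_smult.intros)
  \<comment> \<open>One \<open>y\<close> is produced for \<open>f\<close> and for
    \<open>?\<delta> f\<close> simultaneously. Together with the kernel of \<open>iota\<close> this
    replaces a check that \<open>?\<delta>\<close> maps \<open>J\<close> into
    \<open>J\<close>.\<close>
  have "\<exists>y\<in>carrier P. J +>\<^bsub>K\<^esub> f = iota y \<and> J +>\<^bsub>K\<^esub> ?\<delta> f = iota (d y)" if "f \<in> carrier K" for f
    using that
  proof (induction rule: KA.K_induct)
    case zero
    have "d \<zero>\<^bsub>P\<^esub> = \<zero>\<^bsub>P\<^esub>"
      using d_smult[of \<zero> "\<zero>\<^bsub>P\<^esub>"] d[of "\<zero>\<^bsub>P\<^esub>"] by simp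
    moreover have "?\<delta> \<zero>\<^bsub>K\<^esub> = \<zero>\<^bsub>K\<^esub>"
      using KA.K.lin_ext_zero by (simp add: KA.K_simps(3))
    ultimately show ?case
      by (intro bexI[of _ "\<zero>\<^bsub>P\<^esub>"]) (simp_all add: J.quot_zero iota_zero T_simps TR_eq)
  next
    case (single p a)
    then obtain x r where p: "p = (x, I +> r)" "x \<in> carrier P" "r \<in> carrier R"
      by (auto simp: S'_simps S_carrier)
    have "?\<delta> (single R p a) = a \<odot>\<^bsub>K\<^esub> m p"
      by (rule KA.K.lin_ext_single[OF m single])
    also have "\<dots> = single R (d x, I +> r) a"
      using p single by (simp add: m_def KA.K_smult_single)
    finally have "J +>\<^bsub>K\<^esub> ?\<delta> (single R p a) = iota (d (a \<odot>\<^bsub>P\<^esub> (r \<odot>\<^bsub>P\<^esub> x)))"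
      using p single by (simp add: coset_single d d_smult)
    then show ?case using p single coset_single[of x r a] by auto
  next
    case (add f g)
    then obtain y z where y: "y \<in> carrier P" "J +>\<^bsub>K\<^esub> f = iota y" "J +>\<^bsub>K\<^esub> ?\<delta> f = iota (d y)"
      and z: "z \<in> carrier P" "J +>\<^bsub>K\<^esub> g = iota z" "J +>\<^bsub>K\<^esub> ?\<delta> g = iota (d z)"
      by blast
    have "?\<delta> (f \<oplus>\<^bsub>K\<^esub> g) = ?\<delta> f \<oplus>\<^bsub>K\<^esub> ?\<delta> g"
      using KA.K.lin_ext_add[OF m, of f g] add by (simp add: KA.K_simps(1,4))
    then have "J +>\<^bsub>K\<^esub> ?\<delta> (f \<oplus>\<^bsub>K\<^esub> g) = iota (d (y \<oplus>\<^bsub>P\<^esub> z))"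
      using J.quot_add[OF \<delta>_closed[OF add(1)] \<delta>_closed[OF add(2)]] y z d
      by (simp add: d_add T_simps TR_eq)
    moreover have "J +>\<^bsub>K\<^esub> (f \<oplus>\<^bsub>K\<^esub> g) = iota (y \<oplus>\<^bsub>P\<^esub> z)"
      using J.quot_add[OF add(1,2)] y z by (simp add: T_simps TR_eq)
    ultimately show ?case using y z by blast
  qed
  note \<delta>_iota = this
  have "J +>\<^bsub>K\<^esub> ?\<delta> f = iota (d x)" if "f \<in> iota x" for f
  proof -
    have single: "single R (x, \<one>\<^bsub>S'\<^esub>) \<one> \<in> carrier K"
      using x rcos_closed single_closed by (simp add: S'_simps(3))
    then have f: "f \<in> carrier K" "J +>\<^bsub>K\<^esub> f = iota x"
      using that J.a_repr_independence'[of f "single R (x, \<one>\<^bsub>S'\<^esub>) \<one>"] J.a_elemrcos_carrier[of "single R (x, \<one>\<^bsub>S'\<^esub>) \<one>" f]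
      by (simp_all add: iota_def t_eq)
    then obtain y where y: "y \<in> carrier P" "iota x = iota y" "J +>\<^bsub>K\<^esub> ?\<delta> f = iota (d y)"
      using \<delta>_iota[OF f(1)] by auto
    then have "iota (y \<ominus>\<^bsub>P\<^esub> x) = \<zero>\<^bsub>T\<^esub>"
      using x by (simp add: a_minus_def T.r_neg)
    then have "d (y \<ominus>\<^bsub>P\<^esub> x) \<in> IP"
      using x y by (simp add: iota_eq_zero_iff d_IP)
    moreover have "d y = d (y \<ominus>\<^bsub>P\<^esub> x) \<oplus>\<^bsub>P\<^esub> d x"
      using x y by (simp flip: d_add) (simp add: a_minus_def P.a_assoc P.l_neg)
    ultimately have "iota (d y) = iota (d x)"
      using x y d by (simp add: iota_IP)
    then show ?thesis using y by simp
  qed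
  moreover have "iota x \<noteq> {}"
    using x rcos_closed single_closed J.a_rcos_self[of "single R (x, \<one>\<^bsub>S'\<^esub>) \<one>"]
    by (auto simp: iota_def t_eq S'_simps(3))
  moreover have "f \<in> carrier K" if "f \<in> iota x" for f
    using that x rcos_closed single_closed J.a_elemrcos_carrier[of "single R (x, \<one>\<^bsub>S'\<^esub>) \<one>" f]
    by (simp add: iota_def t_eq S'_simps(3))
  ultimately show ?thesis
    unfolding base_change_diff_def pair_algebra_def by (intro SUP_eq_const) (simp_all add: \<delta>_eq)
qed

end

section \<open>The Tor algebra\<close>

lemma (in assoc_algebra) subalgebra:
  assumes "submodule H R A" "\<one>\<^bsub>A\<^esub> \<in> H" "\<And>x y. \<lbrakk>x \<in> H; y \<in> H\<rbrakk> \<Longrightarrow> x \<otimes>\<^bsub>A\<^esub> y \<in> H"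
  shows "assoc_algebra R (A\<lparr>carrier := H\<rparr>)"
proof -
  interpret H: module R "A\<lparr>carrier := H\<rparr>"
    by (rule submodule.submodule_is_module[OF assms(1) module_axioms])
  have sub: "x \<in> carrier A" if "x \<in> H" for x
    using submoduleE(1)[OF assms(1)] that by blast
  have "ring (A\<lparr>carrier := H\<rparr>)"
    by (rule ringI[OF H.abelian_group_axioms monoidI])
      (use assms in \<open>simp_all add: sub m_assoc l_distr r_distr\<close>)
  moreover have "assoc_algebra_axioms R (A\<lparr>carrier := H\<rparr>)"
    by unfold_locales (simp_all add: sub smult_mult_left smult_mult_right)
  ultimately show ?thesis
    by (simp add: assoc_algebra_def H.module_axioms)
qed

locale tor_setting = residue_tensor R P I + dg: free_comm_dg_resolution R I P gr d aug
  for R :: "('a, 'm) ring_scheme" (structure) and I :: "'a set"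
    and P :: "('a, 'b, 'n) module_scheme" (structure)
    and gr :: "nat \<Rightarrow> 'b set" and d :: "'b \<Rightarrow> 'b" and aug :: "'b \<Rightarrow> 'a set"
begin

abbreviation "D \<equiv> base_change_diff R P S' d"
abbreviation "Tor \<equiv> tor_algebra R I P d"
abbreviation "Tgr \<equiv> tor_gr R I P gr d"
abbreviation "hcomp \<equiv> dg.hcomp"

text \<open>The preimage under \<open>iota\<close> of the cycles of \<open>T\<close>:
  \<open>iota\<close> commutes with the differentials and has kernel \<open>IP\<close>.\<close>

definition "Z = {x \<in> carrier P. d x \<in> IP}"
definition "cls z = tor_class R I P d (iota z)"

lemma d_zero: "d \<zero>\<^bsub>P\<^esub> = \<zero>\<^bsub>P\<^esub>"
  using dg.d_degree_0[OF dg.gr_zero] .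

lemma d_minus: "x \<in> carrier P \<Longrightarrow> d (\<ominus>\<^bsub>P\<^esub> x) = \<ominus>\<^bsub>P\<^esub> d x"
  using dg.d_add[of "\<ominus>\<^bsub>P\<^esub> x" x] d_zero
  by (intro P.minus_equality[symmetric]) (simp_all add: P.l_neg dg.d_closed)

lemma hcomp_d: "x \<in> carrier P \<Longrightarrow> hcomp (d x) i = d (hcomp x (Suc i))"
proof (induction rule: dg.carrier_induct)
  case (homogeneous k x)
  show ?case
  proof (cases k)
    case 0
    then show ?thesis using homogeneous
      by (simp add: dg.hcomp_homogeneous[OF homogeneous] dg.d_degree_0 dg.hcomp_zero d_zero)
  next
    case (Suc m)
    then have "d x \<in> gr m" using homogeneous dg.d_degree_Suc by simp
    then show ?thesis
      using Suc by (simp add: dg.hcomp_homogeneous[OF homogeneous] dg.hcomp_homogeneous d_zero)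
  qed
next
  case (add x y)
  then show ?case by (simp add: dg.hcomp_add dg.d_add dg.d_closed dg.hcomp_closed)
qed

lemma hcomp_IP: "u \<in> IP \<Longrightarrow> hcomp u i \<in> IP"
proof (induction rule: ideal_smult.induct)
  case (smult a x)
  then show ?case
    by (simp add: I.Icarr dg.hcomp_smult dg.hcomp_closed ideal_smult.smult)
next
  case (add x y)
  then show ?case by (simp add: IP_closed dg.hcomp_add ideal_smult.add)
qed

lemma d_IP: "u \<in> IP \<Longrightarrow> d u \<in> IP"
  by (induction rule: ideal_smult.induct)
    (auto simp: dg.d_smult dg.d_add I.Icarr IP_closed dg.d_closed intro: ideal_smult.intros)

lemma IP_sign: "x \<in> IP \<Longrightarrow> koszul_sign P i x \<in> IP"
  by (simp add: koszul_sign_def IP_inv)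

lemma sign_closed: "x \<in> carrier P \<Longrightarrow> koszul_sign P i x \<in> carrier P"
  by (simp add: koszul_sign_def)

lemma Z_closed: "z \<in> Z \<Longrightarrow> z \<in> carrier P"
  by (simp add: Z_def)

lemma Z_d: "z \<in> Z \<Longrightarrow> d z \<in> IP"
  by (simp add: Z_def)

lemma IP_Z: "u \<in> IP \<Longrightarrow> u \<in> Z"
  by (simp add: Z_def IP_closed d_IP)

lemma d_Z: "y \<in> carrier P \<Longrightarrow> d y \<in> Z"
  by (simp add: Z_def dg.d_closed dg.d_d IP_zero)

lemma Z_zero: "\<zero>\<^bsub>P\<^esub> \<in> Z"
  by (simp add: IP_Z IP_zero)

lemma Z_add: "\<lbrakk>x \<in> Z; y \<in> Z\<rbrakk> \<Longrightarrow> x \<oplus>\<^bsub>P\<^esub> y \<in> Z"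
  by (simp add: Z_def dg.d_add ideal_smult.add)

lemma Z_minus: "x \<in> Z \<Longrightarrow> \<ominus>\<^bsub>P\<^esub> x \<in> Z"
  by (simp add: Z_def d_minus IP_inv)

lemma Z_smult: "\<lbrakk>r \<in> carrier R; x \<in> Z\<rbrakk> \<Longrightarrow> r \<odot>\<^bsub>P\<^esub> x \<in> Z"
  by (simp add: Z_def dg.d_smult IP.smult_ideal)

lemma Z_one: "\<one>\<^bsub>P\<^esub> \<in> Z"
  using dg.d_degree_0[OF dg.gr_one] by (simp add: Z_def IP_zero)

lemma Z_hcomp: "z \<in> Z \<Longrightarrow> hcomp z i \<in> Z"
proof -
  assume z: "z \<in> Z"
  show ?thesis
  proof (cases i)
    case 0
    then show ?thesis
      using z dg.hcomp_props(1)[of z 0] dg.d_degree_0[of "hcomp z 0"]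
      by (simp add: Z_def IP_zero dg.hcomp_closed)
  next
    case (Suc j)
    then show ?thesis
      using z hcomp_d[of z j] hcomp_IP[of "d z" j] by (simp add: Z_def dg.hcomp_closed)
  qed
qed

text \<open>The Leibniz rule is available for a homogeneous left factor only. The components of an
  element of \<open>Z\<close> lie in \<open>Z\<close>, so one can restrict to homogeneous elements
  without leaving \<open>Z\<close>.\<close>

lemma Z_induct [consumes 1, case_names homogeneous add]:
  assumes z: "z \<in> Z" and "\<And>i z. \<lbrakk>z \<in> gr i; z \<in> Z\<rbrakk> \<Longrightarrow> Q z"
    and "\<And>x y. \<lbrakk>x \<in> Z; y \<in> Z; Q x; Q y\<rbrakk> \<Longrightarrow> Q (x \<oplus>\<^bsub>P\<^esub> y)"
  shows "Q z"
proof -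
  \<comment> \<open>Membership is carried along because the hypothesis on sums asks for both
    summands to be in \<open>Z\<close>.\<close>
  have "z \<in> Z \<and> Q z"
    by (rule dg.homogeneous_induct[where Z = Z and P = "\<lambda>z. z \<in> Z \<and> Q z"])
      (use assms Z_closed Z_hcomp Z_add Z_zero dg.gr_zero[of 0] in auto)
  then show ?thesis by simp
qed

lemma Z_mult: "\<lbrakk>x \<in> Z; y \<in> Z\<rbrakk> \<Longrightarrow> x \<otimes>\<^bsub>P\<^esub> y \<in> Z"
proof (induction x rule: Z_induct)
  case (homogeneous i x)
  then show ?case
    using dg.leibniz[of x i y]
    by (auto simp: Z_def IP_mult IP_sign intro!: ideal_smult.add)
next
  case (add x x')
  then show ?case by (simp add: P.l_distr Z_closed Z_add)
qed

lemma D_iota: "x \<in> carrier P \<Longrightarrow> D (iota x) = iota (d x)"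
  by (rule base_change_diff_iota) (simp_all add: dg.d_closed dg.d_add dg.d_smult)

lemma cycles_eq: "cycles T D = iota ` Z"
  unfolding cycles_def iota_surj[symmetric] Z_def
  using D_iota iota_eq_zero_iff dg.d_closed by auto

section \<open>Boundaries and the homology algebra\<close>

abbreviation "B \<equiv> D ` carrier T"
abbreviation "C \<equiv> T\<lparr>carrier := iota ` Z\<rparr>"

lemma B_eq: "B = iota ` d ` carrier P"
  unfolding iota_surj[symmetric] using D_iota by force

lemma Tor_eq: "Tor = quot_algebra C B"
  by (simp add: tor_algebra_def homology_algebra_def cycles_eq)

lemma cls_eq: "cls z = B +>\<^bsub>C\<^esub> iota z"
  by (simp add: cls_def tor_class_def homology_class_def a_r_coset_def')

lemma C_assoc_algebra: "assoc_algebra S C"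
proof (rule T.subalgebra)
  show "submodule (iota ` Z) S T"
  proof (rule T.submoduleI)
    show "\<zero>\<^bsub>T\<^esub> \<in> iota ` Z" using Z_zero iota_zero by force
    show "\<ominus>\<^bsub>T\<^esub> a \<in> iota ` Z" if "a \<in> iota ` Z" for a
      using that Z_minus Z_closed by (auto simp flip: iota.hom_a_inv)
    show "a \<oplus>\<^bsub>T\<^esub> b \<in> iota ` Z" if "a \<in> iota ` Z" "b \<in> iota ` Z" for a b
      using that Z_add Z_closed by (auto simp flip: iota_add)
    show "s \<odot>\<^bsub>T\<^esub> x \<in> iota ` Z" if "s \<in> carrier S" "x \<in> iota ` Z" for s x
      using that Z_smult Z_closed by (auto simp: S_carrier simp flip: iota_smult)
  qed (use iota_closed Z_closed in auto)
  show "\<one>\<^bsub>T\<^esub> \<in> iota ` Z" using Z_one iota_one by force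
  show "x \<otimes>\<^bsub>T\<^esub> y \<in> iota ` Z" if "x \<in> iota ` Z" "y \<in> iota ` Z" for x y
    using that Z_mult Z_closed by (auto simp flip: iota_mult)
qed

sublocale C: assoc_algebra S C
  by (rule C_assoc_algebra)

text \<open>Since \<open>d z \<in> IP\<close>, modulo \<open>IP\<close> the product
  \<open>z \<otimes> d y\<close> is the differential of \<open>z \<otimes> y\<close> up to the sign
  given by the degree of \<open>z\<close>. This sign differs between the components of
  \<open>z\<close>, hence the existential statement.\<close>

lemma cycle_times_boundary:
  assumes "z \<in> Z" "y \<in> carrier P"
  shows "\<exists>w\<in>carrier P. iota (z \<otimes>\<^bsub>P\<^esub> d y) = iota (d w)"
  using assms(1)
proof (induction rule: Z_induct)
  case (homogeneous i z)
  note cl = Z_closed[OF homogeneous(2)] assms(2) dg.d_closed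
  have "d (koszul_sign P i (z \<otimes>\<^bsub>P\<^esub> y)) = koszul_sign P i (d (z \<otimes>\<^bsub>P\<^esub> y))"
    using cl by (simp add: koszul_sign_def d_minus)
  also have "\<dots> = koszul_sign P i (d z \<otimes>\<^bsub>P\<^esub> y) \<oplus>\<^bsub>P\<^esub> z \<otimes>\<^bsub>P\<^esub> d y"
    using cl dg.leibniz[OF homogeneous(1) assms(2)]
    by (simp add: koszul_sign_def P.minus_add P.a_comm)
  finally have "iota (d (koszul_sign P i (z \<otimes>\<^bsub>P\<^esub> y))) =
      iota (koszul_sign P i (d z \<otimes>\<^bsub>P\<^esub> y)) \<oplus>\<^bsub>T\<^esub> iota (z \<otimes>\<^bsub>P\<^esub> d y)"
    using cl by (simp add: sign_closed)
  moreover have "iota (koszul_sign P i (d z \<otimes>\<^bsub>P\<^esub> y)) = \<zero>\<^bsub>T\<^esub>"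
    by (intro iota_IP IP_sign IP_mult Z_d homogeneous assms(2))
  ultimately show ?case
    using cl by (intro bexI[of _ "koszul_sign P i (z \<otimes>\<^bsub>P\<^esub> y)"]) (simp_all add: sign_closed)
next
  case (add x x')
  then obtain w w' where "w \<in> carrier P" "iota (x \<otimes>\<^bsub>P\<^esub> d y) = iota (d w)"
      "w' \<in> carrier P" "iota (x' \<otimes>\<^bsub>P\<^esub> d y) = iota (d w')" by blast
  then show ?case
    using add assms(2)
    by (intro bexI[of _ "w \<oplus>\<^bsub>P\<^esub> w'"]) (simp_all add: P.l_distr Z_closed dg.d_closed dg.d_add
        iota_add del: iota.hom_mult)
qed

text \<open>In this order the sign falls on \<open>y \<otimes> d z\<close>, which lies in
  \<open>IP\<close>, so the same witness \<open>y \<otimes> z\<close> works for every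
  \<open>y\<close>.\<close>

lemma boundary_times_cycle:
  assumes "z \<in> Z" "y \<in> carrier P"
  shows "iota (d y \<otimes>\<^bsub>P\<^esub> z) = iota (d (y \<otimes>\<^bsub>P\<^esub> z))"
  using assms(2)
proof (induction rule: dg.carrier_induct)
  case (homogeneous i y)
  note cl = Z_closed[OF assms(1)] dg.gr_carrier[OF homogeneous] dg.d_closed
  have "iota (koszul_sign P i (y \<otimes>\<^bsub>P\<^esub> d z)) = \<zero>\<^bsub>T\<^esub>"
    by (intro iota_IP IP_sign IP_mult Z_d assms cl)
  then show ?case
    using cl by (simp add: dg.leibniz[OF homogeneous] sign_closed)
next
  case (add x y)
  note cl = Z_closed[OF assms(1)] add dg.d_closed
  then show ?case
    by (simp add: dg.d_add P.l_distr iota_add del: iota.hom_mult)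
qed

sublocale B: algebra_ideal S C B
proof (intro algebra_ideal.intro C_assoc_algebra idealI C.ring_axioms)
  have sub: "B \<subseteq> carrier C"
    using d_Z by (auto simp: B_eq)
  show "subgroup B (add_monoid C)"
  proof (rule C.M.add.subgroupI)
    show "B \<subseteq> carrier C" by fact
    show "B \<noteq> {}" using B_eq d_zero by auto
    show "\<ominus>\<^bsub>C\<^esub> b \<in> B" if b: "b \<in> B" for b
    proof -
      obtain y where y: "y \<in> carrier P" "b = iota (d y)" using b B_eq by auto
      have "\<ominus>\<^bsub>C\<^esub> b = iota (d (\<ominus>\<^bsub>P\<^esub> y))"
      proof (rule C.minus_equality)
        show "iota (d (\<ominus>\<^bsub>P\<^esub> y)) \<oplus>\<^bsub>C\<^esub> b = \<zero>\<^bsub>C\<^esub>"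
          using y dg.d_closed by (simp add: d_minus T.l_neg)
        show "b \<in> carrier C" "iota (d (\<ominus>\<^bsub>P\<^esub> y)) \<in> carrier C"
          using y sub b d_Z[of "\<ominus>\<^bsub>P\<^esub> y"] by auto
      qed
      then show ?thesis using y B_eq by blast
    qed
    show "a \<oplus>\<^bsub>C\<^esub> b \<in> B" if ab: "a \<in> B" "b \<in> B" for a b
    proof -
      obtain x y where "x \<in> carrier P" "a = iota (d x)" "y \<in> carrier P" "b = iota (d y)"
        using ab B_eq by auto
      then have "a \<oplus>\<^bsub>C\<^esub> b = iota (d (x \<oplus>\<^bsub>P\<^esub> y))" "x \<oplus>\<^bsub>P\<^esub> y \<in> carrier P"
        using dg.d_closed by (simp_all add: dg.d_add)
      then show ?thesis unfolding B_eq by blast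
    qed
  qed
  show "c \<otimes>\<^bsub>C\<^esub> b \<in> B" "b \<otimes>\<^bsub>C\<^esub> c \<in> B" if bc: "b \<in> B" "c \<in> carrier C" for b c
  proof -
    obtain y z where yz: "y \<in> carrier P" "b = iota (d y)" "z \<in> Z" "c = iota z"
      using bc B_eq by auto
    have "c \<otimes>\<^bsub>C\<^esub> b = iota (z \<otimes>\<^bsub>P\<^esub> d y)" "b \<otimes>\<^bsub>C\<^esub> c = iota (d y \<otimes>\<^bsub>P\<^esub> z)"
      using yz Z_closed dg.d_closed by simp_all
    then show "c \<otimes>\<^bsub>C\<^esub> b \<in> B" "b \<otimes>\<^bsub>C\<^esub> c \<in> B"
      using cycle_times_boundary[OF yz(3,1)] boundary_times_cycle[OF yz(3,1)] yz Z_closed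
      unfolding B_eq by auto
  qed
qed

lemma Tor_assoc_algebra: "assoc_algebra S Tor"
  unfolding Tor_eq by (rule B.quot_assoc_algebra)

sublocale Tor: assoc_algebra S Tor
  by (rule Tor_assoc_algebra)

lemma cls_surj: "cls ` Z = carrier Tor"
  by (auto simp: cls_eq Tor_eq B.quot_carrier)

lemma cls_closed: "z \<in> Z \<Longrightarrow> cls z \<in> carrier Tor"
  using cls_surj by blast

lemma cls_add: "\<lbrakk>x \<in> Z; y \<in> Z\<rbrakk> \<Longrightarrow> cls (x \<oplus>\<^bsub>P\<^esub> y) = cls x \<oplus>\<^bsub>Tor\<^esub> cls y"
  using B.quot_add[of "iota x" "iota y"] by (simp add: cls_eq Tor_eq Z_closed)

lemma cls_mult: "\<lbrakk>x \<in> Z; y \<in> Z\<rbrakk> \<Longrightarrow> cls (x \<otimes>\<^bsub>P\<^esub> y) = cls x \<otimes>\<^bsub>Tor\<^esub> cls y"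
  using B.quot_mult[of "iota x" "iota y"] by (simp add: cls_eq Tor_eq Z_closed)

lemma cls_smult: "\<lbrakk>r \<in> carrier R; x \<in> Z\<rbrakk> \<Longrightarrow> cls (r \<odot>\<^bsub>P\<^esub> x) = (I +> r) \<odot>\<^bsub>Tor\<^esub> cls x"
  using B.quot_smult[of "I +> r" "iota x"] by (simp add: cls_eq Tor_eq Z_closed iota_smult rcos_closed)

lemma cls_one: "cls \<one>\<^bsub>P\<^esub> = \<one>\<^bsub>Tor\<^esub>"
  using B.quot_one by (simp add: cls_eq Tor_eq)

lemma cls_zero: "cls \<zero>\<^bsub>P\<^esub> = \<zero>\<^bsub>Tor\<^esub>"
  using B.quot_zero by (simp add: cls_eq Tor_eq iota_zero)

lemma cls_minus: "x \<in> Z \<Longrightarrow> cls (\<ominus>\<^bsub>P\<^esub> x) = \<ominus>\<^bsub>Tor\<^esub> cls x"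
  using cls_add[of "\<ominus>\<^bsub>P\<^esub> x" x] cls_closed Z_minus
  by (intro Tor.minus_equality[symmetric]) (simp_all add: P.l_neg Z_closed cls_zero)

lemma cls_sign: "x \<in> Z \<Longrightarrow> cls (koszul_sign P i x) = koszul_sign Tor i (cls x)"
  by (simp add: koszul_sign_def cls_minus)

lemma cls_eq_zero_iff:
  assumes "z \<in> Z"
  shows "cls z = \<zero>\<^bsub>Tor\<^esub> \<longleftrightarrow> (\<exists>y\<in>carrier P. z \<ominus>\<^bsub>P\<^esub> d y \<in> IP)"
proof -
  have "cls z = \<zero>\<^bsub>Tor\<^esub> \<longleftrightarrow> iota z \<in> B"
    using assms B.quot_eq_zero_iff[of "iota z"] by (simp add: cls_eq Tor_eq)
  also have "\<dots> \<longleftrightarrow> (\<exists>y\<in>carrier P. iota z = iota (d y))"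
    by (auto simp: B_eq)
  also have "\<dots> \<longleftrightarrow> (\<exists>y\<in>carrier P. z \<ominus>\<^bsub>P\<^esub> d y \<in> IP)"
  proof (rule bex_cong[OF refl])
    fix y assume y: "y \<in> carrier P"
    have "iota z = iota (d y) \<longleftrightarrow> iota (z \<ominus>\<^bsub>P\<^esub> d y) = \<zero>\<^bsub>T\<^esub>"
      using y assms Z_closed dg.d_closed T.r_right_minus_eq[of "iota z" "iota (d y)"]
      by (simp add: a_minus_def)
    then show "iota z = iota (d y) \<longleftrightarrow> z \<ominus>\<^bsub>P\<^esub> d y \<in> IP"
      using y assms Z_closed dg.d_closed by (simp add: iota_eq_zero_iff)
  qed
  finally show ?thesis .
qed

lemma cls_IP: "u \<in> IP \<Longrightarrow> cls u = \<zero>\<^bsub>Tor\<^esub>"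
  using cls_eq_zero_iff[OF IP_Z, of u] by (auto simp: d_zero a_minus_def IP_closed intro!: bexI[of _ "\<zero>\<^bsub>P\<^esub>"])

lemma cls_eq_iff:
  assumes "x \<in> Z" "y \<in> Z"
  shows "cls x = cls y \<longleftrightarrow> cls (x \<ominus>\<^bsub>P\<^esub> y) = \<zero>\<^bsub>Tor\<^esub>"
  using assms cls_closed Tor.r_right_minus_eq[of "cls x" "cls y"]
  by (simp add: a_minus_def cls_add Z_minus cls_minus)

text \<open>A cycle of degree \<open>i\<close> in \<open>T\<close> has one lift in \<open>Z\<close>
  and one in \<open>gr i\<close>. The two differ by an element of \<open>IP\<close>, which is
  contained in \<open>Z\<close>, so the homogeneous lift lies in \<open>Z\<close> as well.\<close>

lemma Tgr_eq: "Tgr i = cls ` (Z \<inter> gr i)"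
proof -
  have "iota ` Z \<inter> iota ` gr i = iota ` (Z \<inter> gr i)"
  proof -
    have "x \<in> Z" if x: "x \<in> gr i" "iota x = iota z" "z \<in> Z" for x z
    proof -
      have "iota (x \<ominus>\<^bsub>P\<^esub> z) = \<zero>\<^bsub>T\<^esub>"
        using x Z_closed dg.gr_carrier[OF x(1)] by (simp add: a_minus_def T.r_neg)
      then have "x \<ominus>\<^bsub>P\<^esub> z \<in> Z"
        using x Z_closed dg.gr_carrier[OF x(1)] by (simp add: iota_eq_zero_iff IP_Z)
      then have "(x \<ominus>\<^bsub>P\<^esub> z) \<oplus>\<^bsub>P\<^esub> z \<in> Z" using x Z_add by blast
      then show ?thesis
        using x Z_closed dg.gr_carrier[OF x(1)] by (simp add: a_minus_def P.a_assoc P.l_neg)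
    qed
    then show ?thesis by (auto simp: image_iff)
  qed
  then show ?thesis
    unfolding tor_gr_def cycles_eq base_change_gr_eq[OF dg.gr_submodule] cls_def
    by (simp add: image_image)
qed

lemma Tgr_closed: "u \<in> Tgr i \<Longrightarrow> u \<in> carrier Tor"
  using cls_closed by (auto simp: Tgr_eq)

lemma Tgr_submodule: "submodule (Tgr i) S Tor"
proof (rule Tor.submoduleI)
  show "\<zero>\<^bsub>Tor\<^esub> \<in> Tgr i" using Z_zero dg.gr_zero cls_zero by (force simp: Tgr_eq)
  show "\<ominus>\<^bsub>Tor\<^esub> a \<in> Tgr i" if "a \<in> Tgr i" for a
    using that Z_minus dg.gr_inv by (auto simp: Tgr_eq simp flip: cls_minus)
  show "a \<oplus>\<^bsub>Tor\<^esub> b \<in> Tgr i" if "a \<in> Tgr i" "b \<in> Tgr i" for a b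
    using that Z_add dg.gr_add by (auto simp: Tgr_eq simp flip: cls_add)
  show "s \<odot>\<^bsub>Tor\<^esub> x \<in> Tgr i" if "s \<in> carrier S" "x \<in> Tgr i" for s x
    using that Z_smult dg.gr_smult by (auto simp: Tgr_eq S_carrier simp flip: cls_smult)
qed (use Tgr_closed in auto)

lemma Tgr_one: "\<one>\<^bsub>Tor\<^esub> \<in> Tgr 0"
  using Z_one dg.gr_one cls_one by (force simp: Tgr_eq)

lemma Tgr_mult: "\<lbrakk>x \<in> Tgr i; y \<in> Tgr j\<rbrakk> \<Longrightarrow> x \<otimes>\<^bsub>Tor\<^esub> y \<in> Tgr (i + j)"
  using Z_mult dg.gr_mult by (auto simp: Tgr_eq simp flip: cls_mult)

lemma Tor_induct [consumes 1, case_names homogeneous add]: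
  assumes "u \<in> carrier Tor" "\<And>i u. u \<in> Tgr i \<Longrightarrow> Q u"
    and "\<And>x y. \<lbrakk>x \<in> carrier Tor; y \<in> carrier Tor; Q x; Q y\<rbrakk> \<Longrightarrow> Q (x \<oplus>\<^bsub>Tor\<^esub> y)"
  shows "Q u"
proof -
  obtain z where z: "u = cls z" "z \<in> Z" using assms(1) cls_surj by blast
  from z(2) have "Q (cls z)"
  proof (induction rule: Z_induct)
    case (homogeneous i z) then show ?case using assms(2) Tgr_eq by blast
  next
    case (add x y) then show ?case using assms(3) cls_closed by (simp add: cls_add)
  qed
  with z show ?thesis by simp
qed

text \<open>This is the relation that lets the inclusion of \<open>F\<close> extend to the exterior
  algebra. Anticommutativity alone would only show that twice the square is zero.\<close>

lemma odd_square:
  assumes "u \<in> Tgr 1"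
  shows "u \<otimes>\<^bsub>Tor\<^esub> u = \<zero>\<^bsub>Tor\<^esub>"
proof -
  obtain z where "u = cls z" "z \<in> Z" "z \<in> gr 1" using assms by (auto simp: Tgr_eq)
  then show ?thesis
    using dg.odd_square_zero[of z 1] by (simp add: cls_zero flip: cls_mult)
qed

end

section \<open>Bockstein derivations\<close>

context module
begin

text \<open>Linearity of the coordinates follows from uniqueness: the sum of two coordinate
  functions is a coordinate function of the sum, and likewise for scalar multiples.\<close>

lemma basis_coordinates:
  assumes "is_basis R M B"
  obtains c where
    "\<And>x. x \<in> carrier M \<Longrightarrow> c x \<in> fin_supp R B"
    "\<And>x. x \<in> carrier M \<Longrightarrow> (\<Oplus>\<^bsub>M\<^esub>b\<in>{b. c x b \<noteq> \<zero>}. c x b \<odot>\<^bsub>M\<^esub> b) = x"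
    "\<And>x y b. \<lbrakk>x \<in> carrier M; y \<in> carrier M\<rbrakk> \<Longrightarrow> c (x \<oplus>\<^bsub>M\<^esub> y) b = c x b \<oplus> c y b"
    "\<And>r x b. \<lbrakk>r \<in> carrier R; x \<in> carrier M\<rbrakk> \<Longrightarrow> c (r \<odot>\<^bsub>M\<^esub> x) b = r \<otimes> c x b"
proof -
  have B: "(\<lambda>b. b) \<in> B \<rightarrow> carrier M"
    using assms by (auto simp: is_basis_def)
  have ex1: "\<exists>!c. c \<in> fin_supp R B \<and> lin_ext R M (\<lambda>b. b) c = x" if "x \<in> carrier M" for x
    using assms that by (simp add: is_basis_def lin_ext_def)
  define c where "c x = (THE c. c \<in> fin_supp R B \<and> lin_ext R M (\<lambda>b. b) c = x)" for x
  have c: "c x \<in> fin_supp R B" "lin_ext R M (\<lambda>b. b) (c x) = x" if "x \<in> carrier M" for x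
    using theI'[OF ex1[OF that]] by (simp_all add: c_def)
  have c_eq: "c x = f" if "f \<in> fin_supp R B" "lin_ext R M (\<lambda>b. b) f = x" for x f
    using ex1[of x] that c[of x] lin_ext_closed[OF B that(1)] by metis
  show ?thesis
  proof
    fix x assume "x \<in> carrier M"
    then show "c x \<in> fin_supp R B" "(\<Oplus>\<^bsub>M\<^esub>b\<in>{b. c x b \<noteq> \<zero>}. c x b \<odot>\<^bsub>M\<^esub> b) = x"
      using c by (simp_all add: lin_ext_def)
  next
    fix x y b assume "x \<in> carrier M" "y \<in> carrier M"
    then have "c (x \<oplus>\<^bsub>M\<^esub> y) = (\<lambda>b. c x b \<oplus> c y b)"
      using c by (intro c_eq) (simp_all add: R.fin_supp_add lin_ext_add[OF B])
    then show "c (x \<oplus>\<^bsub>M\<^esub> y) b = c x b \<oplus> c y b" by simp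
  next
    fix r x b assume "r \<in> carrier R" "x \<in> carrier M"
    then have "c (r \<odot>\<^bsub>M\<^esub> x) = (\<lambda>b. r \<otimes> c x b)"
      using c by (intro c_eq) (simp_all add: R.fin_supp_smult lin_ext_smult[OF B])
    then show "c (r \<odot>\<^bsub>M\<^esub> x) b = r \<otimes> c x b" by simp
  qed
qed

end

text \<open>For \<open>\<phi> : I \<rightarrow> R/I\<close> linear, the pairs \<open>(u, w)\<close> where \<open>w\<close> lifts the image of \<open>u\<close> under
  \<open>IP = I \<otimes> P \<rightarrow> P/IP\<close>, \<open>a p \<mapsto> \<phi> a p\<close>.\<close>

inductive_set bockstein_rel ::
    "('a, 'm) ring_scheme \<Rightarrow> 'a set \<Rightarrow> ('a, 'b, 'n) module_scheme \<Rightarrow> ('a \<Rightarrow> 'a set) \<Rightarrow> ('b \<times> 'b) set"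
  for R I P \<phi> where
    smult: "\<lbrakk>a \<in> I; r \<in> carrier R; \<phi> a = I +>\<^bsub>R\<^esub> r; p \<in> carrier P\<rbrakk>
      \<Longrightarrow> (a \<odot>\<^bsub>P\<^esub> p, r \<odot>\<^bsub>P\<^esub> p) \<in> bockstein_rel R I P \<phi>"
  | add: "\<lbrakk>(u, w) \<in> bockstein_rel R I P \<phi>; (u', w') \<in> bockstein_rel R I P \<phi>\<rbrakk>
      \<Longrightarrow> (u \<oplus>\<^bsub>P\<^esub> u', w \<oplus>\<^bsub>P\<^esub> w') \<in> bockstein_rel R I P \<phi>"

context tor_setting
begin

text \<open>Coordinates in a basis are functionals, so the hypothesis puts all coordinates of
  \<open>w\<close> into \<open>I\<close>. Bases are given for the graded pieces, hence the
  functionals used are coordinates composed with \<open>hcomp\<close>.\<close>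

lemma free_separates:
  assumes w: "w \<in> carrier P"
    and l: "\<And>l. \<lbrakk>\<And>x. x \<in> carrier P \<Longrightarrow> l x \<in> carrier R;
      \<And>x y. \<lbrakk>x \<in> carrier P; y \<in> carrier P\<rbrakk> \<Longrightarrow> l (x \<oplus>\<^bsub>P\<^esub> y) = l x \<oplus> l y;
      \<And>r x. \<lbrakk>r \<in> carrier R; x \<in> carrier P\<rbrakk> \<Longrightarrow> l (r \<odot>\<^bsub>P\<^esub> x) = r \<otimes> l x\<rbrakk> \<Longrightarrow> l w \<in> I"
  shows "w \<in> IP"
proof -
  have "hcomp w i \<in> IP" for i
  proof -
    let ?G = "P\<lparr>carrier := gr i\<rparr>"
    obtain B where B: "is_basis R ?G B" and "module R ?G"
      using dg.gr_free[of i] by (auto simp: free_module_def)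
    then interpret G: module R ?G by simp
    obtain c where c: "\<And>x. x \<in> carrier ?G \<Longrightarrow> c x \<in> fin_supp R B"
      "\<And>x. x \<in> carrier ?G \<Longrightarrow> (\<Oplus>\<^bsub>?G\<^esub>b\<in>{b. c x b \<noteq> \<zero>}. c x b \<odot>\<^bsub>?G\<^esub> b) = x"
      "\<And>x y b. \<lbrakk>x \<in> carrier ?G; y \<in> carrier ?G\<rbrakk> \<Longrightarrow> c (x \<oplus>\<^bsub>?G\<^esub> y) b = c x b \<oplus> c y b"
      "\<And>r x b. \<lbrakk>r \<in> carrier R; x \<in> carrier ?G\<rbrakk> \<Longrightarrow> c (r \<odot>\<^bsub>?G\<^esub> x) b = r \<otimes> c x b"
      by (rule G.basis_coordinates[OF B], rule that) assumption+
    have h: "hcomp x i \<in> carrier ?G" if "x \<in> carrier P" for x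
      using dg.hcomp_props(1)[OF that] by simp
    have cI: "c (hcomp w i) b \<in> I" for b
    proof (rule l[of "\<lambda>x. c (hcomp x i) b"])
      fix x y assume xy: "x \<in> carrier P" "y \<in> carrier P"
      show "c (hcomp x i) b \<in> carrier R"
        by (rule P.R.fin_supp_closed[OF c(1)[OF h[OF xy(1)]]])
      show "c (hcomp (x \<oplus>\<^bsub>P\<^esub> y) i) b = c (hcomp x i) b \<oplus> c (hcomp y i) b"
        using c(3)[OF h[OF xy(1)] h[OF xy(2)]] xy by (simp add: dg.hcomp_add)
    next
      fix r x assume rx: "r \<in> carrier R" "x \<in> carrier P"
      show "c (hcomp (r \<odot>\<^bsub>P\<^esub> x) i) b = r \<otimes> c (hcomp x i) b"
        using c(4)[OF rx(1) h[OF rx(2)]] rx by (simp add: dg.hcomp_smult)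
    qed
    have "(\<Oplus>\<^bsub>?G\<^esub>b\<in>{b. c (hcomp w i) b \<noteq> \<zero>}. c (hcomp w i) b \<odot>\<^bsub>?G\<^esub> b) \<in> IP"
    proof (rule G.M.finsum_induct)
      fix b assume "b \<in> {b. c (hcomp w i) b \<noteq> \<zero>}"
      then have "b \<in> B"
        using fin_supp_subset[OF c(1)[of "hcomp w i"]] w dg.hcomp_props(1) by auto
      then have "b \<in> gr i" using B by (auto simp: is_basis_def)
      then show "c (hcomp w i) b \<odot>\<^bsub>?G\<^esub> b \<in> carrier ?G" "c (hcomp w i) b \<odot>\<^bsub>?G\<^esub> b \<in> IP"
        using cI[of b] dg.gr_carrier dg.gr_smult I.Icarr by (auto intro: ideal_smult.smult)
    qed (use IP_zero ideal_smult.add in auto)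
    then show ?thesis
      using c(2)[of "hcomp w i"] w dg.hcomp_props(1) by simp
  qed
  note * = this
  show ?thesis
    by (rule dg.homogeneous_induct[where Z = IP and P = "\<lambda>w. w \<in> IP", OF w *])
      (simp_all add: IP_zero ideal_smult.add)
qed

text \<open>Here \<open>\<phi>\<close> lives on \<open>I\<close> rather than on
  \<open>I/I^2\<close>. Linearity with values in \<open>R/I\<close> forces it to vanish on products
  of two elements of \<open>I\<close>, so it is the same datum.\<close>

context
  fixes \<phi> :: "'a \<Rightarrow> 'a set"
  assumes \<phi>_closed: "\<And>a. a \<in> I \<Longrightarrow> \<phi> a \<in> carrier S"
    and \<phi>_add: "\<And>a b. \<lbrakk>a \<in> I; b \<in> I\<rbrakk> \<Longrightarrow> \<phi> (a \<oplus> b) = \<phi> a \<oplus>\<^bsub>S\<^esub> \<phi> b"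
    and \<phi>_smult: "\<And>r a. \<lbrakk>r \<in> carrier R; a \<in> I\<rbrakk> \<Longrightarrow> \<phi> (r \<otimes> a) = (I +> r) \<otimes>\<^bsub>S\<^esub> \<phi> a"
begin

abbreviation "\<Gamma> \<equiv> bockstein_rel R I P \<phi>"

lemma \<Gamma>_closed: "(u, w) \<in> \<Gamma> \<Longrightarrow> u \<in> IP \<and> w \<in> carrier P"
  by (induction rule: bockstein_rel.induct) (auto intro: ideal_smult.intros)

lemma \<Gamma>_total: "u \<in> IP \<Longrightarrow> \<exists>w. (u, w) \<in> \<Gamma>"
proof (induction rule: ideal_smult.induct)
  case (smult a x)
  then obtain r where "\<phi> a = I +> r" "r \<in> carrier R"
    using \<phi>_closed by (auto simp: S_carrier)
  with smult show ?case using bockstein_rel.smult[of a I r R \<phi> x P] by blast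
next
  case (add x y)
  then show ?case by (blast intro: bockstein_rel.add)
qed

lemma \<phi>_zero: "\<phi> \<zero> = I +> \<zero>"
proof -
  have "\<phi> (\<zero> \<otimes> \<zero>) = (I +> \<zero>) \<otimes>\<^bsub>S\<^esub> \<phi> \<zero>" by (rule \<phi>_smult) (auto simp: I.zero_closed)
  moreover have "I +> \<zero> = \<zero>\<^bsub>S\<^esub>"
    using ring_hom_zero[OF rcos_hom P.R.ring_axioms S.ring_axioms] .
  ultimately show ?thesis using \<phi>_closed[of \<zero>] by (simp add: I.zero_closed)
qed

text \<open>\<open>\<Gamma>\<close> acts coordinatewise, and \<open>P\<close> is free.\<close>

lemma \<Gamma>_functional:
  assumes "(u, w) \<in> \<Gamma>" "u = \<zero>\<^bsub>P\<^esub>"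
  shows "w \<in> IP"
proof (rule free_separates)
  show "w \<in> carrier P" using \<Gamma>_closed assms by blast
  fix l assume l: "\<And>x. x \<in> carrier P \<Longrightarrow> l x \<in> carrier R"
    "\<And>x y. \<lbrakk>x \<in> carrier P; y \<in> carrier P\<rbrakk> \<Longrightarrow> l (x \<oplus>\<^bsub>P\<^esub> y) = l x \<oplus> l y"
    "\<And>r x. \<lbrakk>r \<in> carrier R; x \<in> carrier P\<rbrakk> \<Longrightarrow> l (r \<odot>\<^bsub>P\<^esub> x) = r \<otimes> l x"
  \<comment> \<open>A functional carries the relation on \<open>P\<close> to the graph of
    \<open>\<phi>\<close> modulo \<open>I\<close>. For \<open>u\<close> zero this says that
    \<open>l w\<close> lies in the class \<open>\<phi> 0\<close>, which is zero.\<close>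
  have "l u \<in> I \<and> \<phi> (l u) = I +> l w" using assms(1)
  proof (induction rule: bockstein_rel.induct)
    case (smult a r p)
    then have "l (a \<odot>\<^bsub>P\<^esub> p) = l p \<otimes> a" "l (r \<odot>\<^bsub>P\<^esub> p) = l p \<otimes> r"
      using l I.Icarr by (simp_all add: P.R.m_comm)
    then show ?case
      using smult l(1) by (simp add: \<phi>_smult rcos_mult I.I_l_closed)
  next
    case (add u w u' w')
    then have "u \<in> carrier P" "u' \<in> carrier P" "w \<in> carrier P" "w' \<in> carrier P"
      using \<Gamma>_closed IP_closed by auto
    then show ?case
      using add l by (simp add: \<phi>_add I.a_closed ring_hom_add[OF rcos_hom])
  qed
  moreover have "l u = \<zero>"
    using l(3)[of \<zero> "\<zero>\<^bsub>P\<^esub>"] l(1)[of "\<zero>\<^bsub>P\<^esub>"] assms(2) by simp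
  ultimately have "I +> \<zero> = I +> l w" by (simp add: \<phi>_zero)
  then have "l w \<ominus> \<zero> \<in> I"
    using rcos_eq_iff[of "l w" \<zero>] l(1) \<Gamma>_closed[OF assms(1)] by simp
  then show "l w \<in> I"
    using l(1) \<Gamma>_closed[OF assms(1)] by (simp add: a_minus_def)
qed

lemma \<Gamma>_smult:
  assumes "(u, w) \<in> \<Gamma>" "r \<in> carrier R"
  shows "(r \<odot>\<^bsub>P\<^esub> u, r \<odot>\<^bsub>P\<^esub> w) \<in> \<Gamma>"
  using assms(1)
proof (induction rule: bockstein_rel.induct)
  case (smult a s p)
  then have "r \<odot>\<^bsub>P\<^esub> (a \<odot>\<^bsub>P\<^esub> p) = a \<odot>\<^bsub>P\<^esub> (r \<odot>\<^bsub>P\<^esub> p)" "r \<odot>\<^bsub>P\<^esub> (s \<odot>\<^bsub>P\<^esub> p) = s \<odot>\<^bsub>P\<^esub> (r \<odot>\<^bsub>P\<^esub> p)"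
    using assms(2) I.Icarr by (simp_all add: P.smult_assoc1[symmetric] P.R.m_comm)
  then show ?case
    using smult assms(2) by (simp add: bockstein_rel.smult)
next
  case (add u w u' w')
  then have "u \<in> carrier P" "u' \<in> carrier P" "w \<in> carrier P" "w' \<in> carrier P"
    using \<Gamma>_closed IP_closed by auto
  then show ?case using add assms(2) by (simp add: P.smult_r_distr bockstein_rel.add)
qed

lemma \<Gamma>_minus: "(u, w) \<in> \<Gamma> \<Longrightarrow> (\<ominus>\<^bsub>P\<^esub> u, \<ominus>\<^bsub>P\<^esub> w) \<in> \<Gamma>"
  using \<Gamma>_smult[of u w "\<ominus> \<one>"] \<Gamma>_closed[of u w] IP_closed by (simp add: P.smult_l_minus)

lemma \<Gamma>_sign: "(u, w) \<in> \<Gamma> \<Longrightarrow> (koszul_sign P i u, koszul_sign P i w) \<in> \<Gamma>"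
  by (simp add: koszul_sign_def \<Gamma>_minus)

text \<open>Pairs are generated from one \<open>p\<close> multiplied by two scalars, so applying a
  linear \<open>f\<close> replaces \<open>p\<close> by \<open>f p\<close>. The instances used are
  \<open>d\<close>, the homogeneous components and multiplication on either side.\<close>

lemma \<Gamma>_map:
  assumes "(u, w) \<in> \<Gamma>"
    and f: "\<And>x. x \<in> carrier P \<Longrightarrow> f x \<in> carrier P"
    "\<And>x y. \<lbrakk>x \<in> carrier P; y \<in> carrier P\<rbrakk> \<Longrightarrow> f (x \<oplus>\<^bsub>P\<^esub> y) = f x \<oplus>\<^bsub>P\<^esub> f y"
    "\<And>r x. \<lbrakk>r \<in> carrier R; x \<in> carrier P\<rbrakk> \<Longrightarrow> f (r \<odot>\<^bsub>P\<^esub> x) = r \<odot>\<^bsub>P\<^esub> f x"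
  shows "(f u, f w) \<in> \<Gamma>"
  using assms(1)
proof (induction rule: bockstein_rel.induct)
  case (smult a r p)
  then show ?case using f I.Icarr by (simp add: bockstein_rel.smult)
next
  case (add u w u' w')
  then have "u \<in> carrier P" "u' \<in> carrier P" "w \<in> carrier P" "w' \<in> carrier P"
    using \<Gamma>_closed IP_closed by auto
  then show ?case using add f by (simp add: bockstein_rel.add)
qed

lemma \<Gamma>_d: "(u, w) \<in> \<Gamma> \<Longrightarrow> (d u, d w) \<in> \<Gamma>"
  by (rule \<Gamma>_map) (simp_all add: dg.d_closed dg.d_add dg.d_smult)

lemma \<Gamma>_hcomp: "(u, w) \<in> \<Gamma> \<Longrightarrow> (hcomp u i, hcomp w i) \<in> \<Gamma>"
  by (rule \<Gamma>_map[where f = "\<lambda>x. hcomp x i"])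
    (simp_all add: dg.hcomp_closed dg.hcomp_add dg.hcomp_smult)

lemma \<Gamma>_mult:
  assumes "(u, w) \<in> \<Gamma>" "y \<in> carrier P"
  shows "(u \<otimes>\<^bsub>P\<^esub> y, w \<otimes>\<^bsub>P\<^esub> y) \<in> \<Gamma>" "(y \<otimes>\<^bsub>P\<^esub> u, y \<otimes>\<^bsub>P\<^esub> w) \<in> \<Gamma>"
  using assms
  by (auto intro!: \<Gamma>_map[where f = "\<lambda>x. x \<otimes>\<^bsub>P\<^esub> y"] \<Gamma>_map[where f = "\<lambda>x. y \<otimes>\<^bsub>P\<^esub> x"]
      simp: P.l_distr P.r_distr P.smult_mult_left P.smult_mult_right)

lemma \<Gamma>_diff:
  assumes "(u, w) \<in> \<Gamma>" "(u', w') \<in> \<Gamma>"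
  shows "(u \<ominus>\<^bsub>P\<^esub> u', w \<ominus>\<^bsub>P\<^esub> w') \<in> \<Gamma>"
  using assms by (simp add: a_minus_def bockstein_rel.add \<Gamma>_minus)

section \<open>The Bockstein map on Tor\<close>

definition "bockstein u = cls (SOME w. \<exists>z\<in>Z. cls z = u \<and> (d z, w) \<in> \<Gamma>)"

text \<open>Applying \<open>d\<close> to the pair gives a partner \<open>d w\<close> of
  \<open>d (d z)\<close>, that is, of zero. Hence \<open>d w \<in> IP\<close>.\<close>

lemma \<Gamma>_cycle:
  assumes "(d z, w) \<in> \<Gamma>" "z \<in> Z"
  shows "w \<in> Z"
  using \<Gamma>_functional[OF \<Gamma>_d[OF assms(1)]] \<Gamma>_closed[OF assms(1)] assms(2)
  by (simp add: Z_def dg.d_d)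

text \<open>If \<open>z\<close> and \<open>z'\<close> have the same class, then
  \<open>z' - z - d y\<close> lies in \<open>IP\<close> for some \<open>y\<close> and has a partner
  \<open>v\<close>. Both \<open>d v\<close> and \<open>w' - w\<close> are then partners of
  \<open>d z' - d z\<close>, so they agree modulo \<open>IP\<close>, and \<open>w\<close> and
  \<open>w'\<close> differ by a boundary up to \<open>IP\<close>.\<close>

lemma bockstein_cls:
  assumes z: "z \<in> Z" and w: "(d z, w) \<in> \<Gamma>"
  shows "bockstein (cls z) = cls w"
proof -
  have "cls w' = cls w" if z': "z' \<in> Z" "cls z' = cls z" and w': "(d z', w') \<in> \<Gamma>" for z' w'
  proof -
    note cl = Z_closed[OF z] Z_closed[OF z'(1)] \<Gamma>_cycle[OF w z] \<Gamma>_cycle[OF w' z'(1)]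
      Z_closed[OF \<Gamma>_cycle[OF w z]] Z_closed[OF \<Gamma>_cycle[OF w' z'(1)]]
    have diff: "z' \<ominus>\<^bsub>P\<^esub> z \<in> Z" "w' \<ominus>\<^bsub>P\<^esub> w \<in> Z"
      using z z' cl by (simp_all add: a_minus_def Z_add Z_minus)
    then obtain y where y: "y \<in> carrier P" "z' \<ominus>\<^bsub>P\<^esub> z \<ominus>\<^bsub>P\<^esub> d y \<in> IP"
      using z z' cls_eq_iff[of z' z] cls_eq_zero_iff[OF diff(1)] by auto
    then obtain v where v: "(z' \<ominus>\<^bsub>P\<^esub> z \<ominus>\<^bsub>P\<^esub> d y, v) \<in> \<Gamma>"
      using \<Gamma>_total by blast
    then have vP: "v \<in> carrier P" using \<Gamma>_closed by blast
    have "d (z' \<ominus>\<^bsub>P\<^esub> z \<ominus>\<^bsub>P\<^esub> d y) = d z' \<ominus>\<^bsub>P\<^esub> d z"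
      using cl y dg.d_closed by (simp add: a_minus_def dg.d_add d_minus dg.d_d)
    then have "(d z' \<ominus>\<^bsub>P\<^esub> d z, d v) \<in> \<Gamma>"
      using \<Gamma>_d[OF v] by simp
    from \<Gamma>_diff[OF \<Gamma>_diff[OF w' w] this] have "w' \<ominus>\<^bsub>P\<^esub> w \<ominus>\<^bsub>P\<^esub> d v \<in> IP"
      using \<Gamma>_functional cl dg.d_closed by (simp add: a_minus_def P.r_neg)
    then have "cls (w' \<ominus>\<^bsub>P\<^esub> w) = \<zero>\<^bsub>Tor\<^esub>"
      using cls_eq_zero_iff[OF diff(2)] vP by blast
    then show ?thesis using cls_eq_iff cl by simp
  qed
  moreover have "\<exists>z'\<in>Z. cls z' = cls z \<and> (d z', SOME w. \<exists>z'\<in>Z. cls z' = cls z \<and> (d z', w) \<in> \<Gamma>) \<in> \<Gamma>"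
    by (rule someI[of "\<lambda>w. \<exists>z'\<in>Z. cls z' = cls z \<and> (d z', w) \<in> \<Gamma>" w]) (use z w in blast)
  ultimately show ?thesis
    unfolding bockstein_def by blast
qed

lemma bockstein_exists:
  assumes "z \<in> Z"
  obtains w where "(d z, w) \<in> \<Gamma>" "w \<in> Z" "bockstein (cls z) = cls w"
proof -
  obtain w where "(d z, w) \<in> \<Gamma>" using \<Gamma>_total[OF Z_d[OF assms]] by blast
  from that[OF this \<Gamma>_cycle[OF this assms] bockstein_cls[OF assms this]] show ?thesis .
qed

lemma bockstein_closed: "u \<in> carrier Tor \<Longrightarrow> bockstein u \<in> carrier Tor"
proof -
  assume "u \<in> carrier Tor"
  then obtain z where z: "z \<in> Z" "u = cls z" using cls_surj by blast
  obtain w where "w \<in> Z" "bockstein (cls z) = cls w" by (rule bockstein_exists[OF z(1)])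
  then show ?thesis using z cls_closed by simp
qed

lemma bockstein_add:
  assumes "u \<in> carrier Tor" "v \<in> carrier Tor"
  shows "bockstein (u \<oplus>\<^bsub>Tor\<^esub> v) = bockstein u \<oplus>\<^bsub>Tor\<^esub> bockstein v"
proof -
  obtain x y where xy: "u = cls x" "x \<in> Z" "v = cls y" "y \<in> Z"
    using assms by (auto simp flip: cls_surj)
  obtain w where w: "(d x, w) \<in> \<Gamma>" "w \<in> Z" "bockstein u = cls w"
    by (rule bockstein_exists[OF xy(2), folded xy(1)])
  obtain w' where w': "(d y, w') \<in> \<Gamma>" "w' \<in> Z" "bockstein v = cls w'"
    by (rule bockstein_exists[OF xy(4), folded xy(3)])
  have "(d (x \<oplus>\<^bsub>P\<^esub> y), w \<oplus>\<^bsub>P\<^esub> w') \<in> \<Gamma>"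
    using w w' xy by (simp add: dg.d_add Z_closed bockstein_rel.add)
  then show ?thesis
    using bockstein_cls[of "x \<oplus>\<^bsub>P\<^esub> y"] w w' xy by (simp add: cls_add Z_add)
qed

lemma bockstein_smult:
  assumes "s \<in> carrier S" "u \<in> carrier Tor"
  shows "bockstein (s \<odot>\<^bsub>Tor\<^esub> u) = s \<odot>\<^bsub>Tor\<^esub> bockstein u"
proof -
  obtain r where r: "s = I +> r" "r \<in> carrier R" using assms by (auto simp: S_carrier)
  obtain x where x: "u = cls x" "x \<in> Z" using assms cls_surj by blast
  obtain w where w: "(d x, w) \<in> \<Gamma>" "w \<in> Z" "bockstein u = cls w"
    by (rule bockstein_exists[OF x(2), folded x(1)])
  have "(d (r \<odot>\<^bsub>P\<^esub> x), r \<odot>\<^bsub>P\<^esub> w) \<in> \<Gamma>"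
    using w r x by (simp add: dg.d_smult Z_closed \<Gamma>_smult)
  then show ?thesis
    using bockstein_cls[of "r \<odot>\<^bsub>P\<^esub> x"] w r x by (simp add: cls_smult Z_smult)
qed

lemma bockstein_degree_0:
  assumes "u \<in> Tgr 0"
  shows "bockstein u = \<zero>\<^bsub>Tor\<^esub>"
proof -
  obtain z where z: "u = cls z" "z \<in> Z" "z \<in> gr 0" using assms by (auto simp: Tgr_eq)
  obtain w where w: "(d z, w) \<in> \<Gamma>" "w \<in> Z" "bockstein u = cls w"
    by (rule bockstein_exists[OF z(2), folded z(1)])
  then show ?thesis
    using \<Gamma>_functional[OF w(1)] dg.d_degree_0[OF z(3)] cls_IP by simp
qed

lemma bockstein_degree_Suc:
  assumes "u \<in> Tgr (Suc i)"
  shows "bockstein u \<in> Tgr i"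
proof -
  obtain z where z: "u = cls z" "z \<in> Z" "z \<in> gr (Suc i)" using assms by (auto simp: Tgr_eq)
  obtain w where w: "(d z, w) \<in> \<Gamma>" "w \<in> Z"
    by (rule bockstein_exists[OF z(2)])
  \<comment> \<open>The partner \<open>w\<close> may be inhomogeneous. As \<open>d z\<close> is
    homogeneous of degree \<open>i\<close>, the component of \<open>w\<close> in that degree is
    again a partner.\<close>
  have "(d z, hcomp w i) \<in> \<Gamma>"
    using \<Gamma>_hcomp[OF w(1), of i] dg.hcomp_homogeneous[OF dg.d_degree_Suc[OF z(3)]] by simp
  then have "bockstein u = cls (hcomp w i)"
    using bockstein_cls z by simp
  then show ?thesis
    using w Z_hcomp dg.hcomp_props(1)[OF Z_closed] by (auto simp: Tgr_eq)
qed

text \<open>This is the Leibniz rule of \<open>d\<close> with \<open>d x\<close> and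
  \<open>d y\<close> replaced by partners, which is allowed because the relation is stable under
  multiplication and signs.\<close>

lemma bockstein_leibniz:
  assumes "u \<in> Tgr i" "v \<in> carrier Tor"
  shows "bockstein (u \<otimes>\<^bsub>Tor\<^esub> v) =
    bockstein u \<otimes>\<^bsub>Tor\<^esub> v \<oplus>\<^bsub>Tor\<^esub> koszul_sign Tor i (u \<otimes>\<^bsub>Tor\<^esub> bockstein v)"
proof -
  obtain x where x: "u = cls x" "x \<in> Z" "x \<in> gr i" using assms by (auto simp: Tgr_eq)
  obtain y where y: "v = cls y" "y \<in> Z" using assms cls_surj by blast
  obtain w where w: "(d x, w) \<in> \<Gamma>" "w \<in> Z" "bockstein u = cls w"
    by (rule bockstein_exists[OF x(2), folded x(1)])
  obtain w' where w': "(d y, w') \<in> \<Gamma>" "w' \<in> Z" "bockstein v = cls w'"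
    by (rule bockstein_exists[OF y(2), folded y(1)])
  have "(d (x \<otimes>\<^bsub>P\<^esub> y), w \<otimes>\<^bsub>P\<^esub> y \<oplus>\<^bsub>P\<^esub> koszul_sign P i (x \<otimes>\<^bsub>P\<^esub> w')) \<in> \<Gamma>"
    using w w' x y by (simp add: dg.leibniz Z_closed \<Gamma>_mult \<Gamma>_sign bockstein_rel.add)
  moreover have "koszul_sign P i (x \<otimes>\<^bsub>P\<^esub> w') \<in> Z"
    using x w' by (simp add: koszul_sign_def Z_mult Z_minus)
  ultimately show ?thesis
    using bockstein_cls[of "x \<otimes>\<^bsub>P\<^esub> y"] w w' x y by (simp add: cls_mult Z_mult cls_add cls_sign)
qed

text \<open>The case \<open>p = 1\<close> of \<open>bockstein_rel.smult\<close>: a partner of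
  \<open>a\<close> times the unit is a lift of \<open>\<phi> a\<close> times the unit.\<close>

lemma bockstein_degree_1:
  assumes "a \<in> I" "x \<in> gr 1" "d x = a \<odot>\<^bsub>P\<^esub> \<one>\<^bsub>P\<^esub>"
  shows "bockstein (cls x) = \<phi> a \<odot>\<^bsub>Tor\<^esub> \<one>\<^bsub>Tor\<^esub>"
proof -
  have "x \<in> Z"
    using assms dg.gr_carrier by (auto simp: Z_def intro: ideal_smult.smult)
  moreover obtain r where "\<phi> a = I +> r" "r \<in> carrier R"
    using \<phi>_closed[OF assms(1)] by (auto simp: S_carrier)
  ultimately show ?thesis
    using bockstein_cls[of x "r \<odot>\<^bsub>P\<^esub> \<one>\<^bsub>P\<^esub>"] assms bockstein_rel.smult[of a I r R \<phi> "\<one>\<^bsub>P\<^esub>" P]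
    by (simp add: cls_smult Z_one cls_one)
qed

end

end

section \<open>Building homomorphisms from Tor to an exterior algebra\<close>

locale tor_exterior = tor_setting R I P gr d aug + ext: exterior "R Quot I" N
  for R :: "('a, 'm) ring_scheme" (structure) and I :: "'a set"
    and P :: "('a, 'b, 'n) module_scheme" (structure)
    and gr :: "nat \<Rightarrow> 'b set" and d :: "'b \<Rightarrow> 'b" and aug :: "'b \<Rightarrow> 'a set"
    and N :: "('a set, 'c, 'k) module_scheme"
begin

abbreviation "E \<equiv> exterior_algebra S N"
abbreviation "Egr \<equiv> exterior_gr S N"
abbreviation "incl \<equiv> exterior_incl S N"
abbreviation "homs \<equiv> graded_algebra_hom S Tor Tgr E Egr"

lemma homsD:
  assumes "g \<in> homs"
  shows "g \<in> ring_hom Tor E"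
    "\<And>s u. \<lbrakk>s \<in> carrier S; u \<in> carrier Tor\<rbrakk> \<Longrightarrow> g (s \<odot>\<^bsub>Tor\<^esub> u) = s \<odot>\<^bsub>E\<^esub> g u"
    "\<And>i u. u \<in> Tgr i \<Longrightarrow> g u \<in> Egr i"
  using assms by (auto simp: graded_algebra_hom_def)

lemma aug_smult:
  assumes "r \<in> carrier R" "x \<in> carrier P"
  shows "aug (r \<odot>\<^bsub>P\<^esub> x) = (I +> r) \<otimes>\<^bsub>S\<^esub> aug x"
proof -
  have "r \<odot>\<^bsub>P\<^esub> x = (r \<odot>\<^bsub>P\<^esub> \<one>\<^bsub>P\<^esub>) \<otimes>\<^bsub>P\<^esub> x"
    using assms by (simp add: P.smult_mult_left)
  then show ?thesis
    using assms ring_hom_mult[OF dg.aug_hom, of "r \<odot>\<^bsub>P\<^esub> \<one>\<^bsub>P\<^esub>" x] by (simp add: dg.aug_smult_one)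
qed

interpretation aug: ring_hom_ring P S aug
  by (rule ring_hom_ringI2) (use P.ring_axioms S.ring_axioms dg.aug_hom in auto)

lemma aug_IP: "u \<in> IP \<Longrightarrow> aug u = \<zero>\<^bsub>S\<^esub>"
proof (induction rule: ideal_smult.induct)
  case (smult a x)
  have "I +> a = \<zero>\<^bsub>S\<^esub>"
    using I.a_rcos_const[OF smult(1)] by (simp add: FactRing_def)
  then show ?case using smult by (simp add: aug_smult I.Icarr)
next
  case (add x y)
  then show ?case by (simp add: IP_closed)
qed

text \<open>Only degree 1 uses exactness. From degree 2 on, \<open>d y\<close> has positive degree,
  where \<open>aug\<close> is zero.\<close>

lemma aug_d: "y \<in> carrier P \<Longrightarrow> aug (d y) = \<zero>\<^bsub>S\<^esub>"
proof (induction rule: dg.carrier_induct)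
  case (homogeneous i y)
  consider "i = 0" | "i = 1" | j where "i = Suc (Suc j)"
    by (metis One_nat_def not0_implies_Suc)
  then show ?case
  proof cases
    case 1
    then show ?thesis using homogeneous dg.d_degree_0 by simp
  next
    case 2
    then have "d y \<in> {x \<in> gr 0. aug x = \<zero>\<^bsub>S\<^esub>}"
      unfolding dg.exact_0 using homogeneous by blast
    then show ?thesis by simp
  next
    case 3
    then show ?thesis using homogeneous dg.d_degree_Suc dg.aug_degree_Suc by blast
  qed
next
  case (add x y)
  then show ?case by (simp add: dg.d_add dg.d_closed)
qed

text \<open>As \<open>aug\<close> kills \<open>IP\<close> and all boundaries, it descends to Tor.
  Composed with the scalars of \<open>E\<close> it is a homomorphism that vanishes in positive
  degrees.\<close>

lemma augmentation_hom: "\<exists>g \<in> homs. \<forall>u\<in>Tgr 1. g u = \<zero>\<^bsub>E\<^esub>"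
proof -
  define eps where "eps u = aug (SOME z. z \<in> Z \<and> cls z = u)" for u
  have eps: "eps (cls z) = aug z" if "z \<in> Z" for z
  proof -
    have "aug z' = aug z" if z': "z' \<in> Z \<and> cls z' = cls z" for z'
    proof -
      have cl: "z' \<in> carrier P" "z \<in> carrier P"
        using z' \<open>z \<in> Z\<close> Z_closed by auto
      have "z' \<ominus>\<^bsub>P\<^esub> z \<in> Z"
        using z' \<open>z \<in> Z\<close> by (simp add: a_minus_def Z_add Z_minus)
      then obtain y where y: "y \<in> carrier P" "z' \<ominus>\<^bsub>P\<^esub> z \<ominus>\<^bsub>P\<^esub> d y \<in> IP"
        using z' \<open>z \<in> Z\<close> cls_eq_iff[of z' z] cls_eq_zero_iff[of "z' \<ominus>\<^bsub>P\<^esub> z"] by auto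
      from aug_IP[OF y(2)] have "aug z' \<ominus>\<^bsub>S\<^esub> aug z = \<zero>\<^bsub>S\<^esub>"
        using cl y dg.d_closed by (simp add: a_minus_def aug_d)
      then show ?thesis using cl by simp
    qed
    moreover have "(SOME z'. z' \<in> Z \<and> cls z' = cls z) \<in> Z \<and> cls (SOME z'. z' \<in> Z \<and> cls z' = cls z) = cls z"
      by (rule someI[of _ z]) (use that in simp)
    ultimately show ?thesis unfolding eps_def by blast
  qed
  have aug_closed: "aug z \<in> carrier S" if "z \<in> Z" for z
    using that Z_closed by simp
  define g where "g u = eps u \<odot>\<^bsub>E\<^esub> \<one>\<^bsub>E\<^esub>" for u
  have g: "g (cls z) = aug z \<odot>\<^bsub>E\<^esub> \<one>\<^bsub>E\<^esub>" if "z \<in> Z" for z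
    using that by (simp add: g_def eps)
  have "g \<in> ring_hom Tor E"
  proof (rule ring_hom_memI)
    fix u v assume "u \<in> carrier Tor" "v \<in> carrier Tor"
    then obtain x y where xy: "u = cls x" "x \<in> Z" "v = cls y" "y \<in> Z"
      by (auto simp flip: cls_surj)
    show "g u \<in> carrier E" using xy by (simp add: g aug_closed)
    show "g (u \<otimes>\<^bsub>Tor\<^esub> v) = g u \<otimes>\<^bsub>E\<^esub> g v"
      using xy Z_closed
      by (simp add: g aug_closed Z_mult ext.E.smult_mult_left ext.E.smult_mult_right
          ext.E.smult_assoc1[symmetric] S.m_comm flip: cls_mult)
    show "g (u \<oplus>\<^bsub>Tor\<^esub> v) = g u \<oplus>\<^bsub>E\<^esub> g v"
      using xy Z_closed by (simp add: g aug_closed Z_add ext.E.smult_l_distr flip: cls_add)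
  next
    show "g \<one>\<^bsub>Tor\<^esub> = \<one>\<^bsub>E\<^esub>" by (simp add: g Z_one flip: cls_one)
  qed
  moreover have "g (s \<odot>\<^bsub>Tor\<^esub> u) = s \<odot>\<^bsub>E\<^esub> g u" if su: "s \<in> carrier S" "u \<in> carrier Tor" for s u
  proof -
    obtain r where "s = I +> r" "r \<in> carrier R" using su(1) by (auto simp: S_carrier)
    moreover obtain x where "u = cls x" "x \<in> Z" using su(2) by (auto simp flip: cls_surj)
    ultimately show ?thesis
      by (simp add: g Z_smult Z_closed aug_smult aug_closed rcos_closed ext.E.smult_assoc1
          flip: cls_smult)
  qed
  moreover have pos: "g u = \<zero>\<^bsub>E\<^esub>" if "u \<in> Tgr (Suc i)" for u i
    using that by (auto simp: Tgr_eq g dg.aug_degree_Suc)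
  moreover have "g u \<in> Egr i" if "u \<in> Tgr i" for u i
  proof (cases i)
    case 0
    then show ?thesis
      using that by (auto simp: Tgr_eq g aug_closed intro!: ext.Egr_smult ext.one_Egr)
  next
    case (Suc j)
    then show ?thesis using that pos ext.Egr_zero by simp
  qed
  ultimately have "g \<in> homs"
    by (simp add: graded_algebra_hom_def)
  then show ?thesis using pos[of _ 0] by auto
qed

text \<open>Since \<open>incl x\<close> has degree one and square zero, the derivation property of \<open>\<theta>\<close> makes
  \<open>g + incl x \<cdot> g \<theta>\<close> multiplicative.\<close>

lemma derivation_step:
  assumes g: "g \<in> homs" and x: "x \<in> carrier N"
    and closed: "\<And>u. u \<in> carrier Tor \<Longrightarrow> \<theta> u \<in> carrier Tor"
    and add: "\<And>u v. \<lbrakk>u \<in> carrier Tor; v \<in> carrier Tor\<rbrakk> \<Longrightarrow> \<theta> (u \<oplus>\<^bsub>Tor\<^esub> v) = \<theta> u \<oplus>\<^bsub>Tor\<^esub> \<theta> v"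
    and smult: "\<And>s u. \<lbrakk>s \<in> carrier S; u \<in> carrier Tor\<rbrakk> \<Longrightarrow> \<theta> (s \<odot>\<^bsub>Tor\<^esub> u) = s \<odot>\<^bsub>Tor\<^esub> \<theta> u"
    and deg0: "\<And>u. u \<in> Tgr 0 \<Longrightarrow> \<theta> u = \<zero>\<^bsub>Tor\<^esub>"
    and deg: "\<And>u i. u \<in> Tgr (Suc i) \<Longrightarrow> \<theta> u \<in> Tgr i"
    and leibniz: "\<And>u v i. \<lbrakk>u \<in> Tgr i; v \<in> carrier Tor\<rbrakk> \<Longrightarrow>
      \<theta> (u \<otimes>\<^bsub>Tor\<^esub> v) = \<theta> u \<otimes>\<^bsub>Tor\<^esub> v \<oplus>\<^bsub>Tor\<^esub> koszul_sign Tor i (u \<otimes>\<^bsub>Tor\<^esub> \<theta> v)"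
  shows "(\<lambda>u. g u \<oplus>\<^bsub>E\<^esub> incl x \<otimes>\<^bsub>E\<^esub> g (\<theta> u)) \<in> homs"
proof -
  interpret g: ring_hom_ring Tor E g
    by (rule ring_hom_ringI2) (use homsD(1)[OF g] Tor.ring_axioms ext.E.ring_axioms in auto)
  note g_smult = homsD(2)[OF g] and g_gr = homsD(3)[OF g]
  let ?e = "incl x"
  have e: "?e \<in> carrier E" by (rule ext.incl_closed[OF x])
  let ?g = "\<lambda>u. g u \<oplus>\<^bsub>E\<^esub> ?e \<otimes>\<^bsub>E\<^esub> g (\<theta> u)"
  have g_add: "?g (u \<oplus>\<^bsub>Tor\<^esub> v) = ?g u \<oplus>\<^bsub>E\<^esub> ?g v" if "u \<in> carrier Tor" "v \<in> carrier Tor" for u v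
    using that e closed by (simp add: add ext.E.r_distr ext.E.a_ac)
  have g_closed: "?g u \<in> carrier E" if "u \<in> carrier Tor" for u
    using that e closed by simp
  have sign: "g (koszul_sign Tor i u) = koszul_sign E i (g u)" if "u \<in> carrier Tor" for i u
    using that by (simp add: koszul_sign_def)
  \<comment> \<open>The product of the two added summands must disappear. Moving the right-hand
    \<open>?e\<close> past the homogeneous \<open>g (\<theta> u)\<close> creates
    \<open>?e \<otimes> ?e\<close>, up to sign. In degree 0 there is nothing to move past, since
    \<open>\<theta> u\<close> is zero.\<close>
  have ee: "?e \<otimes>\<^bsub>E\<^esub> g (\<theta> u) \<otimes>\<^bsub>E\<^esub> ?e = \<zero>\<^bsub>E\<^esub>" if u: "u \<in> Tgr i" for u i
  proof (cases i)
    case 0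
    then show ?thesis using deg0 u e by simp
  next
    case (Suc j)
    have cl: "g (\<theta> u) \<in> carrier E" using closed Tgr_closed[OF u] by simp
    have "?e \<otimes>\<^bsub>E\<^esub> g (\<theta> u) \<otimes>\<^bsub>E\<^esub> ?e = ?e \<otimes>\<^bsub>E\<^esub> koszul_sign E j (?e \<otimes>\<^bsub>E\<^esub> g (\<theta> u))"
      using ext.incl_comm[OF g_gr x, of "\<theta> u" j] deg[of u j] u Suc cl e by (simp add: ext.E.m_assoc)
    also have "\<dots> = koszul_sign E j (?e \<otimes>\<^bsub>E\<^esub> ?e \<otimes>\<^bsub>E\<^esub> g (\<theta> u))"
      using cl e by (simp add: koszul_sign_def ext.E.r_minus ext.E.m_assoc)
    finally show ?thesis
      using cl by (simp add: ext.incl_square[OF x] koszul_sign_def)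
  qed
  have g_mult: "?g (u \<otimes>\<^bsub>Tor\<^esub> v) = ?g u \<otimes>\<^bsub>E\<^esub> ?g v" if u: "u \<in> carrier Tor" and v: "v \<in> carrier Tor" for u v
    using u
  \<comment> \<open>The signs depend on the degree of the left factor only, so \<open>v\<close>
    stays arbitrary.\<close>
  proof (induction rule: Tor_induct)
    case (homogeneous i u)
    note u = Tgr_closed[OF homogeneous]
    note cl = e u v closed[OF u] closed[OF v]
    have comm: "g u \<otimes>\<^bsub>E\<^esub> ?e = koszul_sign E i (?e \<otimes>\<^bsub>E\<^esub> g u)"
      by (rule ext.incl_comm[OF g_gr[OF homogeneous] x])
    \<comment> \<open>The sign in the Leibniz rule of \<open>\<theta>\<close> is exactly the sign of
      exchanging \<open>?e\<close> and \<open>g u\<close>.\<close>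
    have "?e \<otimes>\<^bsub>E\<^esub> g (koszul_sign Tor i (u \<otimes>\<^bsub>Tor\<^esub> \<theta> v)) = g u \<otimes>\<^bsub>E\<^esub> ?e \<otimes>\<^bsub>E\<^esub> g (\<theta> v)"
      using cl by (simp add: sign comm) (simp add: koszul_sign_def ext.E.m_assoc ext.E.l_minus ext.E.r_minus)
    moreover have "koszul_sign Tor i (u \<otimes>\<^bsub>Tor\<^esub> \<theta> v) \<in> carrier Tor"
      using cl by (simp add: koszul_sign_def)
    ultimately have "?g (u \<otimes>\<^bsub>Tor\<^esub> v) = g u \<otimes>\<^bsub>E\<^esub> g v \<oplus>\<^bsub>E\<^esub>
        (?e \<otimes>\<^bsub>E\<^esub> g (\<theta> u) \<otimes>\<^bsub>E\<^esub> g v \<oplus>\<^bsub>E\<^esub> g u \<otimes>\<^bsub>E\<^esub> ?e \<otimes>\<^bsub>E\<^esub> g (\<theta> v))"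
      using cl by (simp add: leibniz[OF homogeneous v] ext.E.r_distr ext.E.m_assoc)
    also have "\<dots> = ?g u \<otimes>\<^bsub>E\<^esub> ?g v"
    proof -
      have "?e \<otimes>\<^bsub>E\<^esub> g (\<theta> u) \<otimes>\<^bsub>E\<^esub> (?e \<otimes>\<^bsub>E\<^esub> g (\<theta> v)) = \<zero>\<^bsub>E\<^esub>"
        using ee[OF homogeneous] cl by (simp flip: ext.E.m_assoc)
      then show ?thesis
        using cl by (simp add: ext.E.l_distr ext.E.r_distr ext.E.a_ac ext.E.m_assoc)
    qed
    finally show ?case .
  next
    case (add u u')
    then show ?case
      using v by (simp only: Tor.l_distr g_add Tor.m_closed g_closed ext.E.l_distr)
  qed
  have "?g \<in> ring_hom Tor E"
  proof (rule ring_hom_memI)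
    show "?g \<one>\<^bsub>Tor\<^esub> = \<one>\<^bsub>E\<^esub>" using deg0[OF Tgr_one] e by simp
  qed (fact g_closed g_mult g_add)+
  moreover have "?g (s \<odot>\<^bsub>Tor\<^esub> u) = s \<odot>\<^bsub>E\<^esub> ?g u" if "s \<in> carrier S" "u \<in> carrier Tor" for s u
    using that e closed
    by (simp add: smult g_smult ext.E.smult_r_distr ext.E.smult_mult_right)
  moreover have "?g u \<in> Egr i" if u: "u \<in> Tgr i" for u i
  proof (cases i)
    case 0
    then have "g u \<in> Egr 0" using u g_gr by simp
    then show ?thesis using 0 u deg0 e ext.Egr_closed by simp
  next
    case (Suc j)
    then show ?thesis
      using u deg g_gr ext.incl_Egr[OF _ x] by (intro ext.Egr_add) auto
  qed
  ultimately show ?thesis by (simp add: graded_algebra_hom_def)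
qed

text \<open>By \<open>bockstein_degree_1\<close>, \<open>\<theta>\<close> takes the class of such an
  \<open>x\<close> to a scalar multiple of the unit, where every homomorphism is determined by
  linearity. The step for \<open>b\<close> therefore adds exactly
  \<open>\<phi> b a \<odot> incl b\<close>, whatever the earlier steps were; this is why no relation
  between the different \<open>\<theta>\<close> is involved.\<close>

lemma coordinate_hom:
  assumes "finite U" "U \<subseteq> carrier N"
    and \<phi>_closed: "\<And>b a. \<lbrakk>b \<in> U; a \<in> I\<rbrakk> \<Longrightarrow> \<phi> b a \<in> carrier S"
    and \<phi>_add: "\<And>b a a'. \<lbrakk>b \<in> U; a \<in> I; a' \<in> I\<rbrakk> \<Longrightarrow> \<phi> b (a \<oplus> a') = \<phi> b a \<oplus>\<^bsub>S\<^esub> \<phi> b a'"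
    and \<phi>_smult: "\<And>b r a. \<lbrakk>b \<in> U; r \<in> carrier R; a \<in> I\<rbrakk> \<Longrightarrow> \<phi> b (r \<otimes> a) = (I +> r) \<otimes>\<^bsub>S\<^esub> \<phi> b a"
  shows "\<exists>g\<in>homs. \<forall>a\<in>I. \<forall>x\<in>gr 1. d x = a \<odot>\<^bsub>P\<^esub> \<one>\<^bsub>P\<^esub> \<longrightarrow>
    g (cls x) = (\<Oplus>\<^bsub>E\<^esub>b\<in>U. \<phi> b a \<odot>\<^bsub>E\<^esub> incl b)"
  using assms
proof (induction U rule: finite_induct)
  case empty
  have "cls x \<in> Tgr 1" if "a \<in> I" "x \<in> gr 1" "d x = a \<odot>\<^bsub>P\<^esub> \<one>\<^bsub>P\<^esub>" for a x
  proof -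
    have "x \<in> Z" using that dg.gr_carrier by (auto simp: Z_def intro!: ideal_smult.smult)
    then show ?thesis using that by (simp add: Tgr_eq)
  qed
  moreover obtain g where "g \<in> homs" "\<And>u. u \<in> Tgr 1 \<Longrightarrow> g u = \<zero>\<^bsub>E\<^esub>"
    using augmentation_hom by blast
  ultimately show ?case by (intro bexI[of _ g]) simp_all
next
  case (insert b U)
  then obtain g where g: "g \<in> homs"
    "\<And>a x. \<lbrakk>a \<in> I; x \<in> gr 1; d x = a \<odot>\<^bsub>P\<^esub> \<one>\<^bsub>P\<^esub>\<rbrakk> \<Longrightarrow> g (cls x) = (\<Oplus>\<^bsub>E\<^esub>b\<in>U. \<phi> b a \<odot>\<^bsub>E\<^esub> incl b)"
    by auto
  interpret g: ring_hom_ring Tor E g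
    by (rule ring_hom_ringI2) (use homsD(1)[OF g(1)] Tor.ring_axioms ext.E.ring_axioms in auto)
  have b: "b \<in> carrier N" "b \<in> insert b U" using insert by auto
  note \<phi> = insert.prems(2)[OF b(2)] insert.prems(3)[OF b(2)] insert.prems(4)[OF b(2)]
  let ?\<theta> = "bockstein (\<phi> b)"
  let ?g = "\<lambda>u. g u \<oplus>\<^bsub>E\<^esub> incl b \<otimes>\<^bsub>E\<^esub> g (?\<theta> u)"
  have hom: "?g \<in> homs"
    by (rule derivation_step[OF g(1) b(1)])
      \<comment> \<open>Every lemma about \<open>bockstein\<close> carries the three linearity
        hypotheses on \<open>\<phi>\<close>; here they are met by \<open>\<phi> b\<close>.\<close>
      (rule bockstein_closed bockstein_add bockstein_smult bockstein_degree_0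
        bockstein_degree_Suc bockstein_leibniz; (assumption | rule \<phi>; assumption))+
  have val: "?g (cls x) = (\<Oplus>\<^bsub>E\<^esub>b\<in>insert b U. \<phi> b a \<odot>\<^bsub>E\<^esub> incl b)"
    if ax: "a \<in> I" "x \<in> gr 1" "d x = a \<odot>\<^bsub>P\<^esub> \<one>\<^bsub>P\<^esub>" for a x
  proof -
    have cl: "\<phi> b' a \<odot>\<^bsub>E\<^esub> incl b' \<in> carrier E" if "b' \<in> insert b U" for b'
      using that insert.prems(1) insert.prems(2)[OF that ax(1)] ext.incl_closed by blast
    have "g (?\<theta> (cls x)) = \<phi> b a \<odot>\<^bsub>E\<^esub> \<one>\<^bsub>E\<^esub>"
    proof -
      have "?\<theta> (cls x) = \<phi> b a \<odot>\<^bsub>Tor\<^esub> \<one>\<^bsub>Tor\<^esub>"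
        by (rule bockstein_degree_1) (rule \<phi> ax; assumption?)+
      then show ?thesis using homsD(2)[OF g(1)] \<phi>(1)[OF ax(1)] by simp
    qed
    then have "?g (cls x) = (\<Oplus>\<^bsub>E\<^esub>b\<in>U. \<phi> b a \<odot>\<^bsub>E\<^esub> incl b) \<oplus>\<^bsub>E\<^esub> \<phi> b a \<odot>\<^bsub>E\<^esub> incl b"
      using g(2)[OF ax] ext.incl_closed[OF b(1)] \<phi>(1)[OF ax(1)]
      by (simp add: ext.E.smult_mult_right)
    also have "\<dots> = (\<Oplus>\<^bsub>E\<^esub>b\<in>insert b U. \<phi> b a \<odot>\<^bsub>E\<^esub> incl b)"
      using insert.hyps cl by (subst ext.E.M.finsum_insert) (auto simp: ext.E.a_comm)
    finally show ?thesis .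
  qed
  show ?case by (rule bexI[OF _ hom]) (intro ballI impI val)
qed

end

section \<open>The conormal module\<close>

context tor_setting
begin

abbreviation "I2 \<equiv> I \<cdot>\<^bsub>R\<^esub> I"
abbreviation "M \<equiv> conormal_module R I"
abbreviation "ct \<equiv> conormal_to_tor R I P gr d"

interpretation I2: ideal I2 R
  by (rule P.R.ideal_prod_is_ideal[OF I.ideal_axioms I.ideal_axioms])

lemma I2_eq_iff:
  "\<lbrakk>a \<in> carrier R; b \<in> carrier R\<rbrakk> \<Longrightarrow> I2 +> a = I2 +> b \<longleftrightarrow> a \<ominus> b \<in> I2"
  using I2.a_rcos_module_minus[OF P.R.ring_axioms, of b a] I2.a_rcos_self[of a]
    I2.a_repr_independence'[of a b] by auto

lemma conormal_simps:
  "carrier M = (\<lambda>a. I2 +> a) ` I" "\<zero>\<^bsub>M\<^esub> = I2 +> \<zero>"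
  "\<lbrakk>a \<in> I; b \<in> I\<rbrakk> \<Longrightarrow> I2 +> (a \<oplus> b) = (I2 +> a) \<oplus>\<^bsub>M\<^esub> (I2 +> b)"
proof -
  show "carrier M = (\<lambda>a. I2 +> a) ` I" by (simp add: conormal_module_def)
  show "\<zero>\<^bsub>M\<^esub> = I2 +> \<zero>"
    by (simp add: conormal_module_def P.R.a_coset_add_zero[OF I2.a_subset])
  show "I2 +> (a \<oplus> b) = (I2 +> a) \<oplus>\<^bsub>M\<^esub> (I2 +> b)" if "a \<in> I" "b \<in> I"
    using that by (simp add: conormal_module_def I2.a_rcos_sum I.Icarr)
qed

text \<open>\<open>rcoset_mult\<close> is a union over pairs of representatives \<open>i + r\<close>
  and \<open>q + a\<close>, with \<open>i\<close> in \<open>I\<close> and \<open>q\<close> in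
  \<open>I^2\<close>. Their product differs from \<open>r a\<close> by
  \<open>i q + i a + r q\<close>, which lies in \<open>I^2\<close>.\<close>

lemma conormal_smult:
  assumes "r \<in> carrier R" "a \<in> I"
  shows "I2 +> (r \<otimes> a) = (I +> r) \<odot>\<^bsub>M\<^esub> (I2 +> a)"
proof -
  have eq: "I2 +> (x \<otimes> y) = I2 +> (r \<otimes> a)" if x: "x \<in> I +> r" and y: "y \<in> I2 +> a" for x y
  proof -
    obtain i where i: "i \<in> I" "x = i \<oplus> r" using x by (auto simp: a_r_coset_def')
    obtain q where q: "q \<in> I2" "y = q \<oplus> a" using y by (auto simp: a_r_coset_def')
    note cl = I.Icarr[OF i(1)] I2.Icarr[OF q(1)] I.Icarr[OF assms(2)] assms(1)
    have "x \<otimes> y \<ominus> r \<otimes> a = i \<otimes> q \<oplus> i \<otimes> a \<oplus> r \<otimes> q"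
      unfolding i q using cl by algebra
    also have "\<dots> \<in> I2"
      using cl q i assms(2) by (intro I2.a_closed I2.I_l_closed ideal_prod.prod) auto
    finally show ?thesis
      using cl i q by (simp add: I2_eq_iff)
  qed
  have "I2 +> a \<noteq> {}" "I +> r \<noteq> {}"
    using I2.a_rcos_self[of a] I.a_rcos_self[of r] assms I.Icarr by auto
  then have "(\<Union>x\<in>I +> r. \<Union>y\<in>I2 +> a. I2 +> (x \<otimes> y)) = I2 +> (r \<otimes> a)"
    by (intro SUP_eq_const eq)
  then show ?thesis by (simp add: conormal_module_def rcoset_mult_def)
qed

lemma conormal_module: "module S M"
proof -
  let ?I = "with_smult (R\<lparr>carrier := I\<rparr>) (\<otimes>)"
  have simps: "carrier ?I = I" "\<zero>\<^bsub>?I\<^esub> = \<zero>" "(\<oplus>\<^bsub>?I\<^esub>) = (\<oplus>)" "(\<odot>\<^bsub>?I\<^esub>) = (\<otimes>)"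
    by (simp_all add: with_smult_def)
  have "module R ?I"
  proof (rule moduleI[OF P.R.is_cring abelian_groupI])
    show "\<exists>y\<in>carrier ?I. y \<oplus>\<^bsub>?I\<^esub> x = \<zero>\<^bsub>?I\<^esub>" if "x \<in> carrier ?I" for x
      using that I.Icarr by (intro bexI[of _ "\<ominus> x"]) (auto simp: simps P.R.l_neg I.a_inv_closed)
  qed (auto simp: simps I.a_closed I.zero_closed I.Icarr P.R.a_ac I.I_l_closed P.R.l_distr P.R.r_distr
      P.R.m_assoc)
  then show ?thesis
    by (rule module_image[OF _ S_cring rcos_hom, of _ "\<lambda>a. I2 +> a"])
      (simp_all add: simps S_carrier conormal_simps conormal_smult)
qed

section \<open>Degree-one lifts of elements of the ideal\<close>

lemma lift_I:
  assumes "a \<in> I"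
  obtains x where "x \<in> gr 1" "d x = a \<odot>\<^bsub>P\<^esub> \<one>\<^bsub>P\<^esub>"
proof -
  have "I +> a = \<zero>\<^bsub>S\<^esub>"
    using I.a_rcos_const[OF assms] by (simp add: FactRing_def)
  then have "a \<odot>\<^bsub>P\<^esub> \<one>\<^bsub>P\<^esub> \<in> {x \<in> gr 0. aug x = \<zero>\<^bsub>S\<^esub>}"
    using assms I.Icarr dg.aug_smult_one dg.gr_smult dg.gr_one by simp
  then show ?thesis using that unfolding dg.exact_0 by force
qed

lemma lift_I_Z: "\<lbrakk>a \<in> I; x \<in> gr 1; d x = a \<odot>\<^bsub>P\<^esub> \<one>\<^bsub>P\<^esub>\<rbrakk> \<Longrightarrow> x \<in> Z"
  using dg.gr_carrier by (auto simp: Z_def intro!: ideal_smult.smult)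

text \<open>For a product \<open>i j\<close>, lift \<open>j\<close> to \<open>y\<close> and take
  \<open>i \<odot> y\<close>. This lift lies in \<open>IP\<close>, so its class in Tor is
  zero.\<close>

lemma lift_I2: "q \<in> I2 \<Longrightarrow> \<exists>v. v \<in> gr 1 \<and> v \<in> IP \<and> d v = q \<odot>\<^bsub>P\<^esub> \<one>\<^bsub>P\<^esub>"
proof (induction rule: ideal_prod.induct)
  case (prod i j)
  obtain y where y: "y \<in> gr 1" "d y = j \<odot>\<^bsub>P\<^esub> \<one>\<^bsub>P\<^esub>" by (rule lift_I[OF prod(2)])
  have "d (i \<odot>\<^bsub>P\<^esub> y) = (i \<otimes> j) \<odot>\<^bsub>P\<^esub> \<one>\<^bsub>P\<^esub>"
    using y prod I.Icarr dg.gr_carrier[OF y(1)] by (simp add: dg.d_smult P.smult_assoc1)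
  then show ?case
    using y(1) prod I.Icarr dg.gr_carrier[OF y(1)] dg.gr_smult ideal_smult.smult by metis
next
  case (sum s t)
  then obtain u v where uv: "u \<in> gr 1" "u \<in> IP" "d u = s \<odot>\<^bsub>P\<^esub> \<one>\<^bsub>P\<^esub>"
      "v \<in> gr 1" "v \<in> IP" "d v = t \<odot>\<^bsub>P\<^esub> \<one>\<^bsub>P\<^esub>" by blast
  then have "d (u \<oplus>\<^bsub>P\<^esub> v) = (s \<oplus> t) \<odot>\<^bsub>P\<^esub> \<one>\<^bsub>P\<^esub>"
    using sum I2.Icarr IP_closed by (simp add: dg.d_add P.smult_l_distr)
  then show ?case using uv dg.gr_add ideal_smult.add by metis
qed

text \<open>Correct \<open>x - x'\<close> by a lift \<open>v \<in> IP\<close> of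
  \<open>a - a'\<close>. What remains is a cycle of degree 1, hence a boundary by exactness of
  \<open>P\<close>. This is what gives the description in \<open>conormal_to_tor\<close> a unique
  value.\<close>

lemma lift_unique:
  assumes "a \<in> I" "a' \<in> I" "I2 +> a = I2 +> a'"
    and x: "x \<in> gr 1" "d x = a \<odot>\<^bsub>P\<^esub> \<one>\<^bsub>P\<^esub>" and x': "x' \<in> gr 1" "d x' = a' \<odot>\<^bsub>P\<^esub> \<one>\<^bsub>P\<^esub>"
  shows "cls x = cls x'"
proof -
  have "a \<ominus> a' \<in> I2" using assms I.Icarr by (simp add: I2_eq_iff)
  then obtain v where v: "v \<in> gr 1" "v \<in> IP" "d v = (a \<ominus> a') \<odot>\<^bsub>P\<^esub> \<one>\<^bsub>P\<^esub>"
    using lift_I2 by blast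
  let ?y = "x \<ominus>\<^bsub>P\<^esub> x' \<ominus>\<^bsub>P\<^esub> v"
  note cl = dg.gr_carrier[OF x(1)] dg.gr_carrier[OF x'(1)] IP_closed[OF v(2)]
    I.Icarr[OF assms(1)] I.Icarr[OF assms(2)]
  have "d ?y = \<zero>\<^bsub>P\<^esub>"
    using cl x x' v
    by (simp add: a_minus_def dg.d_add d_minus P.smult_l_distr P.smult_l_minus P.r_neg)
  moreover have "?y \<in> gr 1"
    using x x' v by (simp add: a_minus_def dg.gr_add dg.gr_inv)
  ultimately have "?y \<in> {x \<in> gr (Suc 0). d x = \<zero>\<^bsub>P\<^esub>}" by simp
  then obtain y where y: "y \<in> gr 2" "?y = d y"
    unfolding dg.exact_Suc by (auto simp: numeral_2_eq_2)
  have yP: "y \<in> carrier P" using y dg.gr_carrier by blast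
  have "x \<ominus>\<^bsub>P\<^esub> x' \<ominus>\<^bsub>P\<^esub> d y = v"
  proof -
    have "w \<ominus>\<^bsub>P\<^esub> (w \<ominus>\<^bsub>P\<^esub> v) = v" if "w \<in> carrier P" for w
      using that cl by (simp add: a_minus_def P.minus_add P.a_assoc[symmetric] P.r_neg)
    then show ?thesis unfolding y(2)[symmetric] using cl by simp
  qed
  then have "cls (x \<ominus>\<^bsub>P\<^esub> x') = \<zero>\<^bsub>Tor\<^esub>"
    using cls_eq_zero_iff[of "x \<ominus>\<^bsub>P\<^esub> x'"] lift_I_Z[OF assms(1) x] lift_I_Z[OF assms(2) x'] v(2) yP
    by (auto simp: a_minus_def Z_add Z_minus)
  then show ?thesis
    using cls_eq_iff lift_I_Z[OF assms(1) x] lift_I_Z[OF assms(2) x'] by simp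
qed

lemma ct_eq:
  assumes "a \<in> I" "x \<in> gr 1" "d x = a \<odot>\<^bsub>P\<^esub> \<one>\<^bsub>P\<^esub>"
  shows "ct (I2 +> a) = cls x"
proof -
  have cls: "tor_class R I P d (pure_tensor R P S' y \<one>\<^bsub>S'\<^esub>) = cls y" for y
    by (simp add: cls_def iota_def)
  show ?thesis
    unfolding conormal_to_tor_def cls
  proof (rule the_equality)
    show "\<exists>a'\<in>I. \<exists>y\<in>gr 1. I2 +> a = I2 +> a' \<and> d y = a' \<odot>\<^bsub>P\<^esub> \<one>\<^bsub>P\<^esub> \<and> cls x = cls y"
      using assms by blast
  next
    fix u assume "\<exists>a'\<in>I. \<exists>y\<in>gr 1. I2 +> a = I2 +> a' \<and> d y = a' \<odot>\<^bsub>P\<^esub> \<one>\<^bsub>P\<^esub> \<and> u = cls y"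
    then show "u = cls x" using lift_unique[OF assms(1) _ _ assms(2,3)] by metis
  qed
qed

lemma ct_obtain:
  assumes "c \<in> carrier M"
  obtains a x where "c = I2 +> a" "a \<in> I" "x \<in> gr 1" "d x = a \<odot>\<^bsub>P\<^esub> \<one>\<^bsub>P\<^esub>" "x \<in> Z" "ct c = cls x"
proof -
  obtain a where a: "c = I2 +> a" "a \<in> I" using assms by (auto simp: conormal_simps)
  obtain x where x: "x \<in> gr 1" "d x = a \<odot>\<^bsub>P\<^esub> \<one>\<^bsub>P\<^esub>" by (rule lift_I[OF a(2)])
  show ?thesis
    by (rule that[OF a x lift_I_Z[OF a(2) x]]) (simp add: a ct_eq[OF a(2) x])
qed

lemma ct_Tgr: "c \<in> carrier M \<Longrightarrow> ct c \<in> Tgr 1"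
  using ct_obtain[of c] Tgr_eq[of 1] by (metis IntI imageI)

lemma ct_add:
  assumes "c \<in> carrier M" "c' \<in> carrier M"
  shows "ct (c \<oplus>\<^bsub>M\<^esub> c') = ct c \<oplus>\<^bsub>Tor\<^esub> ct c'"
proof -
  obtain a x where a: "c = I2 +> a" "a \<in> I" "x \<in> gr 1" "d x = a \<odot>\<^bsub>P\<^esub> \<one>\<^bsub>P\<^esub>" "x \<in> Z" "ct c = cls x"
    by (rule ct_obtain[OF assms(1)])
  obtain b y where b: "c' = I2 +> b" "b \<in> I" "y \<in> gr 1" "d y = b \<odot>\<^bsub>P\<^esub> \<one>\<^bsub>P\<^esub>" "y \<in> Z" "ct c' = cls y"
    by (rule ct_obtain[OF assms(2)])
  have "d (x \<oplus>\<^bsub>P\<^esub> y) = (a \<oplus> b) \<odot>\<^bsub>P\<^esub> \<one>\<^bsub>P\<^esub>"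
    using a(2-5) b(2-5) I.Icarr Z_closed by (simp add: dg.d_add P.smult_l_distr)
  moreover have "x \<oplus>\<^bsub>P\<^esub> y \<in> gr 1" using a b dg.gr_add by blast
  moreover have "a \<oplus> b \<in> I" using a b I.a_closed by blast
  ultimately have "ct (I2 +> (a \<oplus> b)) = cls (x \<oplus>\<^bsub>P\<^esub> y)" by (intro ct_eq)
  then show ?thesis
    using conormal_simps(3)[OF a(2) b(2)] cls_add[OF a(5) b(5)] a(1,6) b(1,6) by simp
qed

lemma ct_smult:
  assumes "s \<in> carrier S" "c \<in> carrier M"
  shows "ct (s \<odot>\<^bsub>M\<^esub> c) = s \<odot>\<^bsub>Tor\<^esub> ct c"
proof -
  obtain r where r: "s = I +> r" "r \<in> carrier R" using assms by (auto simp: S_carrier)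
  obtain a x where a: "c = I2 +> a" "a \<in> I" "x \<in> gr 1" "d x = a \<odot>\<^bsub>P\<^esub> \<one>\<^bsub>P\<^esub>" "x \<in> Z" "ct c = cls x"
    by (rule ct_obtain[OF assms(2)])
  have "d (r \<odot>\<^bsub>P\<^esub> x) = (r \<otimes> a) \<odot>\<^bsub>P\<^esub> \<one>\<^bsub>P\<^esub>"
    using a(2-5) r I.Icarr Z_closed by (simp add: dg.d_smult P.smult_assoc1)
  moreover have "r \<odot>\<^bsub>P\<^esub> x \<in> gr 1" using a r dg.gr_smult by blast
  moreover have "r \<otimes> a \<in> I" using a r I.I_l_closed by blast
  ultimately have "ct (I2 +> (r \<otimes> a)) = cls (r \<odot>\<^bsub>P\<^esub> x)" by (intro ct_eq)
  then show ?thesis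
    using conormal_smult[OF r(2) a(2)] cls_smult[OF r(2) a(5)] a(1,6) r by simp
qed

end

lemma (in module) direct_sum_projection:
  assumes F: "submodule F R M" and G: "submodule G R M"
    and FG: "F \<inter> G = {\<zero>\<^bsub>M\<^esub>}" "F <+>\<^bsub>M\<^esub> G = carrier M"
  obtains pr where
    "\<And>x. x \<in> carrier M \<Longrightarrow> pr x \<in> F" "\<And>x. x \<in> F \<Longrightarrow> pr x = x"
    "\<And>x y. \<lbrakk>x \<in> carrier M; y \<in> carrier M\<rbrakk> \<Longrightarrow> pr (x \<oplus>\<^bsub>M\<^esub> y) = pr x \<oplus>\<^bsub>M\<^esub> pr y"
    "\<And>r x. \<lbrakk>r \<in> carrier R; x \<in> carrier M\<rbrakk> \<Longrightarrow> pr (r \<odot>\<^bsub>M\<^esub> x) = r \<odot>\<^bsub>M\<^esub> pr x"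
proof -
  note FE = submoduleE[OF F] and GE = submoduleE[OF G]
  have cl: "f \<in> F \<Longrightarrow> f \<in> carrier M" "g \<in> G \<Longrightarrow> g \<in> carrier M" for f g
    using FE(1) GE(1) by auto
  have zero: "\<zero>\<^bsub>M\<^esub> \<in> F" "\<zero>\<^bsub>M\<^esub> \<in> G" using FG(1) by auto
  have uniq: "f = f'" if fg: "f \<in> F" "g \<in> G" "f' \<in> F" "g' \<in> G" "f \<oplus>\<^bsub>M\<^esub> g = f' \<oplus>\<^bsub>M\<^esub> g'" for f g f' g'
  proof -
    note c = cl(1)[OF fg(1)] cl(2)[OF fg(2)] cl(1)[OF fg(3)] cl(2)[OF fg(4)]
    have "f \<ominus>\<^bsub>M\<^esub> f' = (f \<oplus>\<^bsub>M\<^esub> g) \<ominus>\<^bsub>M\<^esub> (f' \<oplus>\<^bsub>M\<^esub> g)"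
      using c by (simp add: a_minus_def M.minus_add M.a_ac M.r_neg M.r_neg1)
    \<comment> \<open>Cancelling \<open>f'\<close> moves the difference to the other summand, so
      \<open>f - f'\<close> lies in \<open>F \<inter> G\<close>.\<close>
    also have "\<dots> = g' \<ominus>\<^bsub>M\<^esub> g"
    proof -
      have "(f' \<oplus>\<^bsub>M\<^esub> g') \<ominus>\<^bsub>M\<^esub> (f' \<oplus>\<^bsub>M\<^esub> g) = (f' \<ominus>\<^bsub>M\<^esub> f') \<oplus>\<^bsub>M\<^esub> (g' \<ominus>\<^bsub>M\<^esub> g)"
        using c by (simp add: a_minus_def M.minus_add M.a_ac)
      then show ?thesis
        unfolding fg(5) using c by (simp add: a_minus_def M.r_neg)
    qed
    finally have "f \<ominus>\<^bsub>M\<^esub> f' = g' \<ominus>\<^bsub>M\<^esub> g" .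
    moreover have "f \<ominus>\<^bsub>M\<^esub> f' \<in> F" "g' \<ominus>\<^bsub>M\<^esub> g \<in> G"
      using fg FE(3,5) GE(3,5) by (simp_all add: a_minus_def)
    ultimately have "f \<ominus>\<^bsub>M\<^esub> f' \<in> F \<inter> G" by simp
    then have "f \<ominus>\<^bsub>M\<^esub> f' = \<zero>\<^bsub>M\<^esub>" using FG(1) by simp
    moreover have "f = (f \<ominus>\<^bsub>M\<^esub> f') \<oplus>\<^bsub>M\<^esub> f'"
      using c by (simp add: a_minus_def M.a_assoc M.l_neg)
    ultimately show ?thesis using c by simp
  qed
  define pr where "pr x = (THE f. f \<in> F \<and> (\<exists>g\<in>G. x = f \<oplus>\<^bsub>M\<^esub> g))" for x
  have pr_eq: "pr (f \<oplus>\<^bsub>M\<^esub> g) = f" if "f \<in> F" "g \<in> G" for f g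
    unfolding pr_def by (rule the_equality) (use that uniq in blast)+
  have decomp: "\<exists>f\<in>F. \<exists>g\<in>G. x = f \<oplus>\<^bsub>M\<^esub> g" if "x \<in> carrier M" for x
    using that unfolding FG(2)[symmetric] set_add_def' by blast
  show ?thesis
  proof
    fix x assume "x \<in> carrier M"
    then show "pr x \<in> F" using decomp pr_eq by metis
  next
    fix x assume "x \<in> F"
    then show "pr x = x" using pr_eq[OF _ zero(2)] cl by simp
  next
    fix x y assume "x \<in> carrier M" "y \<in> carrier M"
    then obtain f g f' g' where fg: "f \<in> F" "g \<in> G" "x = f \<oplus>\<^bsub>M\<^esub> g" "f' \<in> F" "g' \<in> G" "y = f' \<oplus>\<^bsub>M\<^esub> g'"
      using decomp by metis
    then have "x \<oplus>\<^bsub>M\<^esub> y = (f \<oplus>\<^bsub>M\<^esub> f') \<oplus>\<^bsub>M\<^esub> (g \<oplus>\<^bsub>M\<^esub> g')"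
      using cl by (simp add: M.a_ac)
    then show "pr (x \<oplus>\<^bsub>M\<^esub> y) = pr x \<oplus>\<^bsub>M\<^esub> pr y"
      using fg FE(5) GE(5) by (simp add: pr_eq)
  next
    fix r x assume r: "r \<in> carrier R" and "x \<in> carrier M"
    then obtain f g where fg: "f \<in> F" "g \<in> G" "x = f \<oplus>\<^bsub>M\<^esub> g"
      using decomp by metis
    then have "r \<odot>\<^bsub>M\<^esub> x = r \<odot>\<^bsub>M\<^esub> f \<oplus>\<^bsub>M\<^esub> r \<odot>\<^bsub>M\<^esub> g"
      using cl r by (simp add: smult_r_distr)
    then show "pr (r \<odot>\<^bsub>M\<^esub> x) = r \<odot>\<^bsub>M\<^esub> pr x"
      using fg r FE(4) GE(4) by (simp add: pr_eq)
  qed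
qed

context tor_setting
begin

lemma conormal_coordinates:
  assumes noeth: "noetherian_ring R" and F: "free_direct_summand S M F"
  obtains U \<phi> where "finite U" "U \<subseteq> F"
    "\<And>b a. a \<in> I \<Longrightarrow> \<phi> b a \<in> carrier S"
    "\<And>b a a'. \<lbrakk>a \<in> I; a' \<in> I\<rbrakk> \<Longrightarrow> \<phi> b (a \<oplus> a') = \<phi> b a \<oplus>\<^bsub>S\<^esub> \<phi> b a'"
    "\<And>b r a. \<lbrakk>r \<in> carrier R; a \<in> I\<rbrakk> \<Longrightarrow> \<phi> b (r \<otimes> a) = (I +> r) \<otimes>\<^bsub>S\<^esub> \<phi> b a"
    "\<And>a. \<lbrakk>a \<in> I; I2 +> a \<in> F\<rbrakk> \<Longrightarrow>
      (\<Oplus>\<^bsub>M\<lparr>carrier := F\<rparr>\<^esub>b\<in>U. \<phi> b a \<odot>\<^bsub>M\<^esub> b) = I2 +> a"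
proof -
  interpret M: module S M by (rule conormal_module)
  let ?F = "M\<lparr>carrier := F\<rparr>"
  obtain G B where FG: "submodule F S M" "submodule G S M" "F \<inter> G = {\<zero>\<^bsub>M\<^esub>}" "F <+>\<^bsub>M\<^esub> G = carrier M"
    and F_mod: "module S ?F" and B: "is_basis S ?F B"
    using F by (auto simp: free_direct_summand_def free_module_def)
  interpret F: module S ?F by (rule F_mod)
  obtain pr where pr: "\<And>x. x \<in> carrier M \<Longrightarrow> pr x \<in> F" "\<And>x. x \<in> F \<Longrightarrow> pr x = x"
    "\<And>x y. \<lbrakk>x \<in> carrier M; y \<in> carrier M\<rbrakk> \<Longrightarrow> pr (x \<oplus>\<^bsub>M\<^esub> y) = pr x \<oplus>\<^bsub>M\<^esub> pr y"
    "\<And>r x. \<lbrakk>r \<in> carrier S; x \<in> carrier M\<rbrakk> \<Longrightarrow> pr (r \<odot>\<^bsub>M\<^esub> x) = r \<odot>\<^bsub>M\<^esub> pr x"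
    by (rule M.direct_sum_projection[OF FG], rule that) assumption+
  obtain c where c: "\<And>x. x \<in> carrier ?F \<Longrightarrow> c x \<in> fin_supp S B"
    "\<And>x. x \<in> carrier ?F \<Longrightarrow> (\<Oplus>\<^bsub>?F\<^esub>b\<in>{b. c x b \<noteq> \<zero>\<^bsub>S\<^esub>}. c x b \<odot>\<^bsub>?F\<^esub> b) = x"
    "\<And>x y b. \<lbrakk>x \<in> carrier ?F; y \<in> carrier ?F\<rbrakk> \<Longrightarrow> c (x \<oplus>\<^bsub>?F\<^esub> y) b = c x b \<oplus>\<^bsub>S\<^esub> c y b"
    "\<And>r x b. \<lbrakk>r \<in> carrier S; x \<in> carrier ?F\<rbrakk> \<Longrightarrow> c (r \<odot>\<^bsub>?F\<^esub> x) b = r \<otimes>\<^bsub>S\<^esub> c x b"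
    by (rule F.basis_coordinates[OF B], rule that) assumption+
  have cls: "I2 +> a \<in> carrier M" if "a \<in> I" for a
    using that by (simp add: conormal_simps)
  have prF: "pr (I2 +> a) \<in> carrier ?F" if "a \<in> I" for a
    using pr(1)[OF cls[OF that]] by simp
  define \<phi> where "\<phi> b a = c (pr (I2 +> a)) b" for b a
  have \<phi>_closed: "\<phi> b a \<in> carrier S" if "a \<in> I" for a b
    unfolding \<phi>_def by (rule S.fin_supp_closed[OF c(1)[OF prF[OF that]]])
  have \<phi>_add: "\<phi> b (a \<oplus> a') = \<phi> b a \<oplus>\<^bsub>S\<^esub> \<phi> b a'" if "a \<in> I" "a' \<in> I" for a a' b
    using c(3)[OF prF[OF that(1)] prF[OF that(2)]] that
    by (simp add: \<phi>_def conormal_simps(3) pr(3) cls)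
  have \<phi>_smult: "\<phi> b (r \<otimes> a) = (I +> r) \<otimes>\<^bsub>S\<^esub> \<phi> b a" if "r \<in> carrier R" "a \<in> I" for r a b
    using c(4)[OF rcos_closed[OF that(1)] prF[OF that(2)]] that
    by (simp add: \<phi>_def conormal_smult pr(4) cls rcos_closed)
  obtain X where X: "X \<subseteq> carrier R" "finite X" "I = genideal R X"
    using noetherian_ring.finetely_gen[OF noeth I.ideal_axioms] by blast
  have XI: "X \<subseteq> I" using P.R.genideal_self[OF X(1)] X(3) by simp
  \<comment> \<open>The construction handles finitely many functionals. \<open>U\<close> collects
    the basis elements that occur in the coordinates of the finitely many generators of
    \<open>I\<close>.\<close>
  define U where "U = (\<Union>a\<in>X. {b. \<phi> b a \<noteq> \<zero>\<^bsub>S\<^esub>})"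
  have fin: "finite {b. \<phi> b a \<noteq> \<zero>\<^bsub>S\<^esub>}" and sub: "{b. \<phi> b a \<noteq> \<zero>\<^bsub>S\<^esub>} \<subseteq> B" if "a \<in> I" for a
    using fin_supp_finite[OF c(1)[OF prF[OF that]]] fin_supp_subset[OF c(1)[OF prF[OF that]]]
    by (simp_all add: \<phi>_def)
  have U: "finite U" "U \<subseteq> B"
    using fin sub X(2) XI by (auto simp: U_def)
  \<comment> \<open>The elements of \<open>I\<close> without coordinates outside \<open>U\<close>
    form an ideal of \<open>R\<close>. It contains the generators \<open>X\<close>, so it is all of
    \<open>I\<close>.\<close>
  let ?L = "{a \<in> I. \<forall>b. b \<notin> U \<longrightarrow> \<phi> b a = \<zero>\<^bsub>S\<^esub>}"
  have zeroL: "\<phi> b \<zero> = \<zero>\<^bsub>S\<^esub>" for b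
    using \<phi>_smult[of \<zero> \<zero> b] \<phi>_closed[of \<zero> b] I.zero_closed
      ring_hom_zero[OF rcos_hom P.R.ring_axioms S.ring_axioms] by simp
  have L_smult: "r \<otimes> a \<in> ?L" if "a \<in> ?L" "r \<in> carrier R" for a r
    using that by (simp add: \<phi>_smult I.I_l_closed rcos_closed)
  have "ideal ?L R"
  proof (rule idealI)
    show "ring R" by (rule P.R.ring_axioms)
    show "subgroup ?L (add_monoid R)"
    proof (rule P.R.add.subgroupI)
      have "\<zero> \<in> ?L"
        using zeroL additive_subgroup.zero_closed[OF I.is_additive_subgroup] by simp
      then show "?L \<noteq> {}" by blast
      show "\<ominus> a \<in> ?L" if "a \<in> ?L" for a
        using L_smult[OF that, of "\<ominus> \<one>"] that I.Icarr by (simp add: P.R.l_minus)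
      show "a \<oplus> b \<in> ?L" if "a \<in> ?L" "b \<in> ?L" for a b
        using that by (simp add: \<phi>_add)
    qed (use I.Icarr in auto)
    show "x \<otimes> a \<in> ?L" if "a \<in> ?L" "x \<in> carrier R" for a x
      using L_smult[OF that] .
    show "a \<otimes> x \<in> ?L" if "a \<in> ?L" "x \<in> carrier R" for a x
      using L_smult[OF that] that I.Icarr P.R.m_comm[of a x] by simp
  qed
  then have "genideal R X \<subseteq> ?L"
    by (rule P.R.genideal_minimal) (use XI in \<open>auto simp: U_def\<close>)
  then have I_L: "\<phi> b a = \<zero>\<^bsub>S\<^esub>" if "a \<in> I" "b \<notin> U" for a b
    using that X(3) by auto
  show ?thesis
  proof
    show "U \<subseteq> F" using U B by (auto simp: is_basis_def)
    fix a assume a: "a \<in> I" "I2 +> a \<in> F"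
    have "lin_ext S ?F (\<lambda>b. b) (c (I2 +> a)) = (\<Oplus>\<^bsub>?F\<^esub>b\<in>U. c (I2 +> a) b \<odot>\<^bsub>?F\<^esub> b)"
    proof (rule F.lin_ext_superset)
      show "(\<lambda>b. b) \<in> B \<rightarrow> carrier ?F" using B by (auto simp: is_basis_def)
      show "c (I2 +> a) \<in> fin_supp S B" using c(1) a(2) by simp
      show "{g. c (I2 +> a) g \<noteq> \<zero>\<^bsub>S\<^esub>} \<subseteq> U"
        using I_L[OF a(1)] pr(2)[OF a(2)] by (auto simp: \<phi>_def)
    qed (fact U)+
    then show "(\<Oplus>\<^bsub>?F\<^esub>b\<in>U. \<phi> b a \<odot>\<^bsub>M\<^esub> b) = I2 +> a"
      using c(2)[of "I2 +> a"] pr(2)[OF a(2)] a(2) by (simp add: \<phi>_def lin_ext_def)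
  qed (fact U \<phi>_closed \<phi>_add \<phi>_smult)+
qed

end

section \<open>The splitting\<close>

theorem mainTheorem1:
  fixes R :: "('a, 'm) ring_scheme"
    and I :: "'a set"
    and F :: "'a set set"
    and P :: "('a, 'b, 'n) module_scheme"
    and gr :: "nat \<Rightarrow> 'b set"
    and d :: "'b \<Rightarrow> 'b"
    and aug :: "'b \<Rightarrow> 'a set"
  defines "S \<equiv> R Quot I"
    and "E \<equiv> exterior_algebra (R Quot I) ((conormal_module R I)\<lparr>carrier := F\<rparr>)"
    and "Egr \<equiv> exterior_gr (R Quot I) ((conormal_module R I)\<lparr>carrier := F\<rparr>)"
  assumes "noetherian_ring R" and "local_ring R" and "ideal I R"
    and "free_direct_summand S (conormal_module R I) F"
    and "free_comm_dg_resolution R I P gr d aug"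
  shows "(\<exists>!h. is_natural_map R I F P gr d h) \<and>
    (\<forall>h. is_natural_map R I F P gr d h \<longrightarrow>
      (\<exists>g \<in> graded_algebra_hom S (tor_algebra R I P d) (tor_gr R I P gr d) E Egr.
         \<forall>x\<in>carrier E. g (h x) = x))"
proof -
  interpret res: free_comm_dg_resolution R I P gr d aug by fact
  interpret tor_setting R I P gr d aug
    by (intro tor_setting.intro residue_tensor.intro res.assoc_algebra_axioms
        res.ideal_axioms res.free_comm_dg_resolution_axioms)
  let ?N = "M\<lparr>carrier := F\<rparr>"
  let ?E = "exterior_algebra (R Quot I) ?N"
  have F: "submodule F (R Quot I) M" "module (R Quot I) ?N"
    using assms(7) by (auto simp: S_def free_direct_summand_def free_module_def)
  interpret N: module "R Quot I" ?N by (rule F(2))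
  interpret tor_exterior R I P gr d aug ?N
    by (intro tor_exterior.intro tor_setting_axioms exterior.intro F)
  note E_def [simp] and Egr_def [simp] and S_def [simp]
  have FM: "c \<in> carrier M" if "c \<in> F" for c
    using that subgroup.subset[OF submodule.axioms(1)[OF F(1)]] by auto
  have natural_iff: "is_natural_map R I F P gr d h \<longleftrightarrow>
      h \<in> extensional (carrier E) \<and> h \<in> graded_algebra_hom S E Egr Tor Tgr \<and>
      (\<forall>c\<in>F. h (incl c) = ct c)" for h
    by (simp add: is_natural_map_def Let_def)
  \<comment> \<open>Existence comes from the universal property, applied to the canonical map
    \<open>ct\<close> on \<open>F\<close>.\<close>
  obtain h where h: "h \<in> ring_hom E Tor"
    "\<And>s u. \<lbrakk>s \<in> carrier S; u \<in> carrier E\<rbrakk> \<Longrightarrow> h (s \<odot>\<^bsub>E\<^esub> u) = s \<odot>\<^bsub>Tor\<^esub> h u"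
    "\<And>x. x \<in> carrier ?N \<Longrightarrow> h (incl x) = ct x"
  proof (rule ext.hom_exists[OF Tor_assoc_algebra, of ct])
    fix x assume x: "x \<in> carrier ?N"
    then show "ct x \<in> carrier Tor" using Tgr_closed[OF ct_Tgr] FM by simp
    show "ct x \<otimes>\<^bsub>Tor\<^esub> ct x = \<zero>\<^bsub>Tor\<^esub>" using x odd_square ct_Tgr FM by simp
  qed (use that ct_add ct_smult FM in simp_all)
  have h_gr: "h u \<in> Tgr n" if "u \<in> Egr n" for u n
    by (rule ext.hom_graded[OF Tor_assoc_algebra])
      (use h that ct_Tgr FM Tgr_submodule Tgr_one Tgr_mult in auto)
  \<comment> \<open>Restriction to the carrier supplies the extensionality demanded by
    \<open>is_natural_map\<close> and changes no value there.\<close>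
  have "is_natural_map R I F P gr d (restrict h (carrier E))"
  proof -
    have "restrict h (carrier E) \<in> ring_hom E Tor"
      using h(1) by (auto simp: ring_hom_def)
    then show ?thesis
      unfolding natural_iff graded_algebra_hom_def
      using h(2,3) h_gr ext.Egr_closed ext.incl_closed by auto
  qed
  moreover have "h = h'" if nat: "is_natural_map R I F P gr d h" "is_natural_map R I F P gr d h'"
    for h h'
  proof (rule extensionalityI)
    show "h \<in> extensional (carrier E)" "h' \<in> extensional (carrier E)"
      using nat natural_iff by blast+
    show "h u = h' u" if "u \<in> carrier E" for u
      by (rule ext.hom_determined[of Tor])
        (use nat that Tor.ring_axioms in \<open>auto simp: natural_iff graded_algebra_hom_def\<close>)
  qed
  ultimately have ex1: "\<exists>!h. is_natural_map R I F P gr d h" by blast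
  have "\<exists>g \<in> graded_algebra_hom S Tor Tgr E Egr. \<forall>x\<in>carrier E. g (h x) = x"
    if nat: "is_natural_map R I F P gr d h" for h
  proof -
    obtain U \<phi> where U: "finite U" "U \<subseteq> F"
      and \<phi>: "\<And>b a. a \<in> I \<Longrightarrow> \<phi> b a \<in> carrier (R Quot I)"
      "\<And>b a a'. \<lbrakk>a \<in> I; a' \<in> I\<rbrakk> \<Longrightarrow> \<phi> b (a \<oplus>\<^bsub>R\<^esub> a') = \<phi> b a \<oplus>\<^bsub>R Quot I\<^esub> \<phi> b a'"
      "\<And>b r a. \<lbrakk>r \<in> carrier R; a \<in> I\<rbrakk> \<Longrightarrow> \<phi> b (r \<otimes>\<^bsub>R\<^esub> a) = (I +>\<^bsub>R\<^esub> r) \<otimes>\<^bsub>R Quot I\<^esub> \<phi> b a"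
      "\<And>a. \<lbrakk>a \<in> I; I2 +>\<^bsub>R\<^esub> a \<in> F\<rbrakk> \<Longrightarrow> (\<Oplus>\<^bsub>?N\<^esub>b\<in>U. \<phi> b a \<odot>\<^bsub>M\<^esub> b) = I2 +>\<^bsub>R\<^esub> a"
      by (rule conormal_coordinates[OF assms(4) assms(7)[unfolded S_def]], rule that) assumption+
    obtain g where g: "g \<in> homs"
      "\<And>a x. \<lbrakk>a \<in> I; x \<in> gr 1; d x = a \<odot>\<^bsub>P\<^esub> \<one>\<^bsub>P\<^esub>\<rbrakk> \<Longrightarrow> g (cls x) = (\<Oplus>\<^bsub>E\<^esub>b\<in>U. \<phi> b a \<odot>\<^bsub>E\<^esub> incl b)"
      using coordinate_hom[OF U(1), of \<phi>] U(2) \<phi>(1-3) by auto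
    \<comment> \<open>On the lift of \<open>c\<close> the map \<open>g\<close> gives the coordinates
      of \<open>c\<close> against the elements \<open>incl b\<close>. Since \<open>incl\<close> is
      linear, this sum is \<open>incl\<close> of the expansion of \<open>c\<close>.\<close>
    have g_ct: "g (ct c) = incl c" if c: "c \<in> F" for c
    proof -
      obtain a x where ax: "c = I2 +>\<^bsub>R\<^esub> a" "a \<in> I" "x \<in> gr 1" "d x = a \<odot>\<^bsub>P\<^esub> \<one>\<^bsub>P\<^esub>" "ct c = cls x"
        by (rule ct_obtain[OF FM[OF c]])
      have closed: "\<phi> b a \<odot>\<^bsub>?N\<^esub> b \<in> carrier ?N" if "b \<in> U" for b
        using that U(2) \<phi>(1)[OF ax(2)] by (intro N.smult_closed) auto
      have zero: "incl \<zero>\<^bsub>?N\<^esub> = \<zero>\<^bsub>E\<^esub>"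
      proof -
        have "incl \<zero>\<^bsub>?N\<^esub> = incl (\<zero>\<^bsub>R Quot I\<^esub> \<odot>\<^bsub>?N\<^esub> \<zero>\<^bsub>?N\<^esub>)"
          by (subst N.smult_r_null) (rule S.zero_closed refl)+
        also have "\<dots> = \<zero>\<^bsub>R Quot I\<^esub> \<odot>\<^bsub>E\<^esub> incl \<zero>\<^bsub>?N\<^esub>"
          unfolding E_def by (rule ext.incl_smult) (rule S.zero_closed N.M.zero_closed)+
        also have "\<dots> = \<zero>\<^bsub>E\<^esub>"
          unfolding E_def by (rule ext.E.smult_l_null[OF ext.incl_closed]) (rule N.M.zero_closed)
        finally show ?thesis .
      qed
      have "incl c = incl (\<Oplus>\<^bsub>?N\<^esub>b\<in>U. \<phi> b a \<odot>\<^bsub>?N\<^esub> b)"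
        using \<phi>(4)[OF ax(2)] ax(1) c by simp
      also have "\<dots> = (\<Oplus>\<^bsub>E\<^esub>b\<in>U. incl (\<phi> b a \<odot>\<^bsub>?N\<^esub> b))"
        unfolding E_def
        by (rule additive_finsum[OF N.M.abelian_monoid_axioms ext.E.M.abelian_monoid_axioms
              ext.incl_closed ext.incl_add])
          (use zero closed in auto)
      also have "\<dots> = (\<Oplus>\<^bsub>E\<^esub>b\<in>U. \<phi> b a \<odot>\<^bsub>E\<^esub> incl b)"
        unfolding E_def
        by (rule ext.E.M.finsum_cong')
          (use U(2) \<phi>(1)[OF ax(2)] ext.incl_closed ext.incl_smult in auto)
      finally show ?thesis using g(2)[OF ax(2-4)] ax(5) by simp
    qed
    have h: "h \<in> ring_hom E Tor"
      "\<And>s u. \<lbrakk>s \<in> carrier S; u \<in> carrier E\<rbrakk> \<Longrightarrow> h (s \<odot>\<^bsub>E\<^esub> u) = s \<odot>\<^bsub>Tor\<^esub> h u"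
      "\<And>x. x \<in> carrier ?N \<Longrightarrow> h (incl x) = ct x"
      using nat by (auto simp: natural_iff graded_algebra_hom_def)
    have "g (h u) = u" if "u \<in> carrier E" for u
    \<comment> \<open>Both maps are linear ring endomorphisms of the exterior algebra. They agree on
      \<open>F\<close>, which generates it, so the identity obtained in degree one is
      enough.\<close>
    proof (rule ext.hom_determined[of ?E "\<lambda>u. g (h u)" "\<lambda>u. u"])
      show "(\<lambda>u. g (h u)) \<in> ring_hom ?E ?E"
        using ring_hom_trans[OF h(1) homsD(1)[OF g(1)]] by (simp add: comp_def)
      show "(\<lambda>u. u) \<in> ring_hom ?E ?E" by (auto intro: ring_hom_memI)
    qed (use that h(2,3) homsD(2)[OF g(1)] g_ct ext.E.ring_axioms ring_hom_closed[OF h(1)] in simp_all)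
    then show ?thesis using g(1) by auto
  qed
  with ex1 show ?thesis by simp
qed

end
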